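(* Let $v$ be a vertex of degree $d$ and $\beta>0$. There is an algorithm which, given $w^v$, $\Delta_v$, the fixed values $w'_{ux}$ for $\{v,u,x\}\in\Delta_v$, $\lambda$, $\varepsilon_1$ and $\beta$, computes the $\beta$-smooth sensitivity $S^*_{f'_v,\beta}(w^v)$ of the unbiased local count function $f'_v$ in $O(d^2\log^2 d)$ time.
   Context: Let $G=(V,E)$ be a finite simple undirected graph, $v\in V$ with incident edge set $E(v)$ of size $d$, and incident weights $w^v\in\mathbb{Z}^{E(v)}$. Let $\Delta_v$ be a set of triangles containing $v$, and for each $\{v,u,x\}\in\Delta_v$ let $w'_{ux}\in\mathbb{Z}$ be a fixed value. Let $\lambda\in\mathbb{Z}$, $\varepsilon_1>0$, $p=e^{-\varepsilon_1}$, and $h:\mathbb{Z}\to\mathbb{R}$ with $h(k)=0$ for $k>\lambda$, $h(\lambda)=-\frac{p}{(1-p)^2}$, $h(\lambda-1)=1+\frac{p}{(1-p)^2}$, $h(k)=1$ for $k<\lambda-1$. The unbiased local count is $f'_v(w)=\sum_{\{v,u,x\}\in\Delta_v}h(w_{vu}+w_{vx}+w'_{ux})$ for $w\in\mathbb{Z}^{E(v)}$. For $f:\mathbb{Z}^d\to\mathbb{R}$, $LS_f(y)=\max\{|f(y)-f(y')|:\|y-y'\|_1\le1\}$ and $S^*_{f,\beta}(w)=\max_{y\in\mathbb{Z}^d}LS_f(y)e^{-\beta\|w-y\|_1}$. *)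

theory Defs
  imports Complex_Main "HOL-Library.FuncSet" "HOL-Library.Landau_Symbols"
begin

section \<open>Graphs and the unbiased local count\<close>

definition simple_graph :: "'a set \<Rightarrow> 'a set set \<Rightarrow> bool" where
  "simple_graph V E \<longleftrightarrow> finite V \<and> (\<forall>e\<in>E. e \<subseteq> V \<and> card e = 2)"

definition incident :: "'a set set \<Rightarrow> 'a \<Rightarrow> 'a set set" where
  "incident E v = {e \<in> E. v \<in> e}"

definition triangles_at :: "'a set set \<Rightarrow> 'a \<Rightarrow> 'a set set" where
  "triangles_at E v = {{v, u, x} | u x. {v, u} \<in> E \<and> {v, x} \<in> E \<and> {u, x} \<in> E \<and>
                                       v \<noteq> u \<and> v \<noteq> x \<and> u \<noteq> x}"

definition hfun :: "int \<Rightarrow> real \<Rightarrow> int \<Rightarrow> real" where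
  "hfun lam eps1 k = (let p = exp (- eps1) in
     if k > lam then 0
     else if k = lam then - (p / (1 - p)\<^sup>2)
     else if k = lam - 1 then 1 + p / (1 - p)\<^sup>2
     else 1)"

text \<open>
  Weight vectors are functions on edges.  For a triangle \<open>t = {v, u, x}\<close> we have
  \<open>t - {v} = {u, x}\<close>, so the inner sum is \<open>w {v, u} + w {v, x}\<close> and \<open>w' (t - {v})\<close> is the fixed
  value of the edge opposite to \<open>v\<close>.
\<close>

definition local_count ::
  "int \<Rightarrow> real \<Rightarrow> 'a \<Rightarrow> 'a set set \<Rightarrow> ('a set \<Rightarrow> int) \<Rightarrow> ('a set \<Rightarrow> int) \<Rightarrow> real" where
  "local_count lam eps1 v \<Delta> w' w =
     (\<Sum>t\<in>\<Delta>. hfun lam eps1 ((\<Sum>u\<in>t - {v}. w {v, u}) + w' (t - {v})))"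


section \<open>Smooth sensitivity\<close>

text \<open>
  The lattice of integer vectors with coordinates in a finite set \<open>I\<close> is the set of extensional
  functions \<open>I \<rightarrow>\<^sub>E UNIV\<close>.
\<close>

definition l1_dist :: "'i set \<Rightarrow> ('i \<Rightarrow> int) \<Rightarrow> ('i \<Rightarrow> int) \<Rightarrow> int" where
  "l1_dist I y y' = (\<Sum>i\<in>I. \<bar>y i - y' i\<bar>)"

definition local_sens :: "'i set \<Rightarrow> (('i \<Rightarrow> int) \<Rightarrow> real) \<Rightarrow> ('i \<Rightarrow> int) \<Rightarrow> real" where
  "local_sens I f y =
     (GREATEST a. a \<in> {\<bar>f y - f y'\<bar> | y'. y' \<in> I \<rightarrow>\<^sub>E UNIV \<and> l1_dist I y y' \<le> 1})"

definition smooth_sens ::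
  "'i set \<Rightarrow> (('i \<Rightarrow> int) \<Rightarrow> real) \<Rightarrow> real \<Rightarrow> ('i \<Rightarrow> int) \<Rightarrow> real" where
  "smooth_sens I f \<beta> w =
     (GREATEST a. a \<in> {local_sens I f y * exp (- \<beta> * real_of_int (l1_dist I w y)) | y.
                        y \<in> I \<rightarrow>\<^sub>E UNIV})"


section \<open>A unit-cost random access machine over the integers and the reals\<close>

text \<open>
  Programs are finite syntactic objects in a structured imperative language with integer and real
  scalars and arrays.  Every operation costs one time unit.  On integers the operations are
  addition, subtraction, halving and comparison, and integers serve as array addresses.  On reals
  they are the field operations, the exponential function and comparison (exact arithmetic).
  Integers can be converted to reals but there is no rounding operation in the other direction,
  and the only constants are integers, so that unit cost per operation cannot be exploited by packing
  data into large integers or by precomputed advice in real constants.  Division by 0 yields 0.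
\<close>

type_synonym vname = string

datatype iexp =
    IConst int
  | IVar vname
  | IArr vname iexp
  | IAdd iexp iexp
  | ISub iexp iexp
  | IHalf iexp

datatype rexp =
    RVar vname
  | RArr vname iexp
  | ROfInt iexp
  | RAdd rexp rexp
  | RSub rexp rexp
  | RMul rexp rexp
  | RDiv rexp rexp
  | RExp rexp

datatype bexp =
    ILess iexp iexp
  | RLess rexp rexp
  | BNot bexp
  | BAnd bexp bexp

datatype com =
    Skip
  | IAssign vname iexp
  | RAssign vname rexp
  | IStore vname iexp iexp
  | RStore vname iexp rexp
  | Seq com com
  | If bexp com com
  | While bexp com

record state =
  ivar :: "vname \<Rightarrow> int"
  rvar :: "vname \<Rightarrow> real"
  iarr :: "vname \<Rightarrow> int \<Rightarrow> int"
  rarr :: "vname \<Rightarrow> int \<Rightarrow> real"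

fun ival :: "iexp \<Rightarrow> state \<Rightarrow> int" where
  "ival (IConst n) s = n"
| "ival (IVar x) s = ivar s x"
| "ival (IArr a i) s = iarr s a (ival i s)"
| "ival (IAdd e1 e2) s = ival e1 s + ival e2 s"
| "ival (ISub e1 e2) s = ival e1 s - ival e2 s"
| "ival (IHalf e) s = ival e s div 2"

fun rval :: "rexp \<Rightarrow> state \<Rightarrow> real" where
  "rval (RVar x) s = rvar s x"
| "rval (RArr a i) s = rarr s a (ival i s)"
| "rval (ROfInt e) s = real_of_int (ival e s)"
| "rval (RAdd e1 e2) s = rval e1 s + rval e2 s"
| "rval (RSub e1 e2) s = rval e1 s - rval e2 s"
| "rval (RMul e1 e2) s = rval e1 s * rval e2 s"
| "rval (RDiv e1 e2) s = rval e1 s / rval e2 s"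
| "rval (RExp e) s = exp (rval e s)"

fun bval :: "bexp \<Rightarrow> state \<Rightarrow> bool" where
  "bval (ILess e1 e2) s \<longleftrightarrow> ival e1 s < ival e2 s"
| "bval (RLess e1 e2) s \<longleftrightarrow> rval e1 s < rval e2 s"
| "bval (BNot b) s \<longleftrightarrow> \<not> bval b s"
| "bval (BAnd b1 b2) s \<longleftrightarrow> bval b1 s \<and> bval b2 s"

fun icost :: "iexp \<Rightarrow> nat" where
  "icost (IConst n) = 1"
| "icost (IVar x) = 1"
| "icost (IArr a i) = 1 + icost i"
| "icost (IAdd e1 e2) = 1 + icost e1 + icost e2"
| "icost (ISub e1 e2) = 1 + icost e1 + icost e2"
| "icost (IHalf e) = 1 + icost e"

fun rcost :: "rexp \<Rightarrow> nat" where
  "rcost (RVar x) = 1"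
| "rcost (RArr a i) = 1 + icost i"
| "rcost (ROfInt e) = 1 + icost e"
| "rcost (RAdd e1 e2) = 1 + rcost e1 + rcost e2"
| "rcost (RSub e1 e2) = 1 + rcost e1 + rcost e2"
| "rcost (RMul e1 e2) = 1 + rcost e1 + rcost e2"
| "rcost (RDiv e1 e2) = 1 + rcost e1 + rcost e2"
| "rcost (RExp e) = 1 + rcost e"

fun bcost :: "bexp \<Rightarrow> nat" where
  "bcost (ILess e1 e2) = 1 + icost e1 + icost e2"
| "bcost (RLess e1 e2) = 1 + rcost e1 + rcost e2"
| "bcost (BNot b) = 1 + bcost b"
| "bcost (BAnd b1 b2) = 1 + bcost b1 + bcost b2"

text \<open>\<open>exec c s t s'\<close>: started in \<open>s\<close>, the program \<open>c\<close> halts in \<open>s'\<close> after \<open>t\<close> time units.\<close>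

inductive exec :: "com \<Rightarrow> state \<Rightarrow> nat \<Rightarrow> state \<Rightarrow> bool" where
  Skip: "exec Skip s 1 s"
| IAssign: "exec (IAssign x e) s (1 + icost e) (s\<lparr>ivar := (ivar s)(x := ival e s)\<rparr>)"
| RAssign: "exec (RAssign x e) s (1 + rcost e) (s\<lparr>rvar := (rvar s)(x := rval e s)\<rparr>)"
| IStore: "exec (IStore a i e) s (1 + icost i + icost e)
             (s\<lparr>iarr := (iarr s)(a := (iarr s a)(ival i s := ival e s))\<rparr>)"
| RStore: "exec (RStore a i e) s (1 + icost i + rcost e)
             (s\<lparr>rarr := (rarr s)(a := (rarr s a)(ival i s := rval e s))\<rparr>)"
| Seq: "exec c1 s t1 s' \<Longrightarrow> exec c2 s' t2 s'' \<Longrightarrow> exec (Seq c1 c2) s (t1 + t2) s''"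
| IfTrue: "bval b s \<Longrightarrow> exec c1 s t s' \<Longrightarrow> exec (If b c1 c2) s (1 + bcost b + t) s'"
| IfFalse: "\<not> bval b s \<Longrightarrow> exec c2 s t s' \<Longrightarrow> exec (If b c1 c2) s (1 + bcost b + t) s'"
| WhileFalse: "\<not> bval b s \<Longrightarrow> exec (While b c) s (1 + bcost b) s"
| WhileTrue: "bval b s \<Longrightarrow> exec c s t1 s' \<Longrightarrow> exec (While b c) s' t2 s'' \<Longrightarrow>
              exec (While b c) s (1 + bcost b + t1 + t2) s''"

inductive_cases Skip_E: "exec Skip s t s'"
inductive_cases IAssign_E: "exec (IAssign x e) s t s'"
inductive_cases RAssign_E: "exec (RAssign x e) s t s'"
inductive_cases IStore_E: "exec (IStore a i e) s t s'"
inductive_cases RStore_E: "exec (RStore a i e) s t s'"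
inductive_cases Seq_E: "exec (Seq c1 c2) s t s'"
inductive_cases If_E: "exec (If b c1 c2) s t s'"
inductive_cases While_E: "exec (While b c) s t s'"

lemma exec_deterministic:
  "exec c s t s' \<Longrightarrow> exec c s u r \<Longrightarrow> u = t \<and> r = s'"
proof (induction arbitrary: u r rule: exec.induct)
  case (Skip s)
  then show ?case by (rule Skip_E) simp
next
  case (IAssign x e s)
  then show ?case by (rule IAssign_E) simp
next
  case (RAssign x e s)
  then show ?case by (rule RAssign_E) simp
next
  case (IStore a i e s)
  then show ?case by (rule IStore_E) simp
next
  case (RStore a i e s)
  then show ?case by (rule RStore_E) simp
next
  case (Seq c1 s t1 s' c2 t2 s'')
  from Seq.prems obtain u1 u2 r1 where "u = u1 + u2" "exec c1 s u1 r1" "exec c2 r1 u2 r"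
    by (rule Seq_E)
  then show ?case using Seq.IH by metis
next
  case (IfTrue b s c1 t s' c2)
  from IfTrue.prems IfTrue.hyps(1) obtain t' where "u = 1 + bcost b + t'" "exec c1 s t' r"
    by (elim If_E) auto
  then show ?case using IfTrue.IH by metis
next
  case (IfFalse b s c2 t s' c1)
  from IfFalse.prems IfFalse.hyps(1) obtain t' where "u = 1 + bcost b + t'" "exec c2 s t' r"
    by (elim If_E) auto
  then show ?case using IfFalse.IH by metis
next
  case (WhileFalse b s c)
  from WhileFalse.prems show ?case
    by (rule While_E) (simp_all only: WhileFalse.hyps not_True_eq_False simp_thms)
next
  case (WhileTrue b s c t1 s' t2 s'')
  from WhileTrue.prems obtain u1 u2 r1 where
    u: "u = Suc (bcost b + u1 + u2)" and c: "exec c s u1 r1" and loop: "exec (While b c) r1 u2 r"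
    by (rule While_E) (use WhileTrue.hyps(1) in blast)+
  have 1: "u1 = t1" "r1 = s'" using WhileTrue.IH(1)[OF c] by blast+
  have "u2 = t2" "r = s''" using WhileTrue.IH(2)[OF loop[unfolded 1]] by blast+
  with u 1 show ?case by simp
qed


section \<open>Input representation\<close>

text \<open>
  The list \<open>es\<close> enumerates the incident edges, i.e. it identifies the vectors indexed by \<open>E(v)\<close>
  with \<open>d\<close>-dimensional ones.  The list \<open>ts\<close> enumerates the triangles, in any order and without
  repetition: the pair \<open>(i, j)\<close> stands for the triangle spanned by the \<open>i\<close>-th and the \<open>j\<close>-th
  incident edge.
\<close>

definition triangle_of :: "'a set list \<Rightarrow> nat \<times> nat \<Rightarrow> 'a set" where
  "triangle_of es = (\<lambda>(i, j). es ! i \<union> es ! j)"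

definition enumerates ::
  "'a set set \<Rightarrow> 'a \<Rightarrow> 'a set set \<Rightarrow> 'a set list \<Rightarrow> (nat \<times> nat) list \<Rightarrow> bool" where
  "enumerates E v \<Delta> es ts \<longleftrightarrow>
     distinct es \<and> set es = incident E v \<and>
     set ts \<subseteq> {..<length es} \<times> {..<length es} \<and>
     distinct (map (triangle_of es) ts) \<and> set (map (triangle_of es) ts) = \<Delta>"

definition array_of :: "int list \<Rightarrow> int \<Rightarrow> int" where
  "array_of xs k = (if 0 \<le> k \<and> k < int (length xs) then xs ! nat k else 0)"

definition input_state ::
  "'a \<Rightarrow> 'a set list \<Rightarrow> (nat \<times> nat) list \<Rightarrow> ('a set \<Rightarrow> int) \<Rightarrow> ('a set \<Rightarrow> int) \<Rightarrow>
   int \<Rightarrow> real \<Rightarrow> real \<Rightarrow> state" where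
  "input_state v es ts w w' lam eps1 \<beta> =
    \<lparr>ivar = (\<lambda>_. 0)(''d'' := int (length es), ''m'' := int (length ts), ''lambda'' := lam),
     rvar = (\<lambda>_. 0)(''eps1'' := eps1, ''beta'' := \<beta>),
     iarr = (\<lambda>_ _. 0)
       (''w'' := array_of (map w es),
        ''tri1'' := array_of (map (\<lambda>(i, j). int i) ts),
        ''tri2'' := array_of (map (\<lambda>(i, j). int j) ts),
        ''triw'' := array_of (map (\<lambda>p. w' (triangle_of es p - {v})) ts)),
     rarr = (\<lambda>_ _. 0)\<rparr>"

end

theory Submission
  imports Defs "HOL-Real_Asymp.Real_Asymp"
begin

text \<open>
  Lowering the weight of the edge \<open>u\<close> by one changes the count by a sum, over the triangles at \<open>u\<close>,
  of terms that only depend on the weight of the triangle minus \<open>\<lambda>\<close>: \<open>1 + 2c\<close> at \<open>0\<close>, \<open>-c\<close>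
  at \<open>\<plusminus>1\<close> and \<open>0\<close> elsewhere, where \<open>c = p / (1 - p)\<^sup>2\<close>.  For a fixed edge \<open>u\<close> whose own weight has
  moved by \<open>-q\<close>, the other edges can be moved independently of each other, so it is optimal to
  move those \<open>k\<close> triangles that are nearest to the target; the sign of the sum decides which
  target.  The value is log-concave in \<open>k\<close>, so the best \<open>k\<close> is found by binary search, and after
  sorting and forming prefix sums each evaluation is one further binary search for the window of
  nearest triangles.  By piecewise linearity of the cost it suffices to try the \<open>O(d)\<close> shifts \<open>q\<close>
  within distance 2 of 0 or of the excess weight of some triangle at \<open>u\<close>.
\<close>

section \<open>The objective for one edge\<close>

text \<open>Smooth sensitivity is a maximum over pairs of neighbouring vectors: an edge
  \<open>u\<close> together with a vector \<open>z\<close> before and after lowering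
  \<open>z u\<close>. The vectors form an infinite lattice and the absolute value destroys
  concavity, so each sign of the sum gets its own family of candidates. The exact optimum for a
  given shift is never computed. It is enough that every objective value is at most some
  \<open>cand\<close> and every \<open>cand\<close> is at most some objective value; then the two
  maxima agree, although a single \<open>cand\<close> may underestimate. That the other edges move
  independently rests on the graph being simple: the triangles at \<open>u\<close> have pairwise
  different second edges at \<open>v\<close>.

  An edge with \<open>n\<close> triangles, \<open>n \<le> d\<close>, has \<open>5 * (n + 1)\<close>
  centres to try, and each takes logarithmically many evaluations of logarithmic cost, which yields
  the bound when summed over \<open>d\<close> edges. Sorting is done once for all edges: a single
  tournament over the \<open>m \<le> d * d\<close> triangles fills every bucket in sorted
  order.\<close>

definition minsum :: "(nat \<Rightarrow> int) \<Rightarrow> nat \<Rightarrow> nat \<Rightarrow> int" where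
  "minsum f n k = Min (sum f ` {S. S \<subseteq> {..<n} \<and> card S = k})"

lemma finite_subsets_card: "finite {S. S \<subseteq> {..<n::nat} \<and> card S = k}"
  by (rule finite_subset[of _ "Pow {..<n}"]) auto

lemma minsum_le: "S \<subseteq> {..<n} \<Longrightarrow> card S = k \<Longrightarrow> minsum f n k \<le> sum f S"
  unfolding minsum_def by (intro Min_le finite_imageI finite_subsets_card) auto

lemma minsum_attained:
  assumes "k \<le> n" obtains S where "S \<subseteq> {..<n}" "card S = k" "sum f S = minsum f n k"
proof -
  have "{..<k} \<in> {S. S \<subseteq> {..<n} \<and> card S = k}" using assms by auto
  then have "minsum f n k \<in> sum f ` {S. S \<subseteq> {..<n} \<and> card S = k}"
    unfolding minsum_def by (intro Min_in finite_imageI finite_subsets_card) blast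
  then show thesis using that by auto
qed

text \<open>Exchange: an element of an optimal \<open>k + 2\<close>-set that is missing from an
  optimal \<open>k\<close>-set is moved across, which leaves two sets of size \<open>k + 1\<close>
  with the same total.\<close>

lemma minsum_convex:
  assumes "Suc (Suc k) \<le> n"
  shows "2 * minsum f n (Suc k) \<le> minsum f n k + minsum f n (Suc (Suc k))"
proof -
  obtain S where S: "S \<subseteq> {..<n}" "card S = k" "sum f S = minsum f n k"
    using assms minsum_attained[of k n f] by auto
  obtain U where U: "U \<subseteq> {..<n}" "card U = Suc (Suc k)" "sum f U = minsum f n (Suc (Suc k))"
    using assms minsum_attained[of "Suc (Suc k)" n f] by auto
  have fin: "finite S" "finite U" using finite_subset[OF S(1)] finite_subset[OF U(1)] by auto
  have "\<not> U \<subseteq> S" using card_mono[OF fin(1), of U] S U by auto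
  then obtain x where x: "x \<in> U" "x \<notin> S" by auto
  have "minsum f n (Suc k) \<le> sum f (insert x S)"
    using x S U fin by (intro minsum_le) auto
  moreover have "minsum f n (Suc k) \<le> sum f (U - {x})"
    using x S U fin by (intro minsum_le) auto
  moreover have "sum f (insert x S) = f x + sum f S" using x fin by simp
  moreover have "sum f (U - {x}) = sum f U - f x" using x fin by (simp add: sum_diff1)
  ultimately show ?thesis using S U by linarith
qed

lemma minsum_mono:
  assumes "Suc k \<le> n" "\<And>x. 0 \<le> f x"
  shows "minsum f n k \<le> minsum f n (Suc k)"
proof -
  obtain U where U: "U \<subseteq> {..<n}" "card U = Suc k" "sum f U = minsum f n (Suc k)"
    using assms minsum_attained[of "Suc k" n f] by auto
  have fin: "finite U" using U(1) by (rule finite_subset) simp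
  obtain x where x: "x \<in> U" using U(2) by fastforce
  have "minsum f n k \<le> sum f (U - {x})" using x U fin by (intro minsum_le) auto
  also have "\<dots> \<le> sum f U" using fin assms by (intro sum_mono2) auto
  finally show ?thesis using U by simp
qed

text \<open>Certificate for a greedy choice: a competitor \<open>S\<close> of the same size arises
  from \<open>W\<close> by matching \<open>W - S\<close> with \<open>S - W\<close>, and along the
  matching values do not decrease.\<close>

lemma minsum_eqI:
  assumes W: "W \<subseteq> {..<n}" "card W = k"
    and le: "\<And>x y. x \<in> W \<Longrightarrow> y < n \<Longrightarrow> y \<notin> W \<Longrightarrow> f x \<le> f y"
  shows "minsum f n k = sum f W"
proof (rule antisym)
  show "minsum f n k \<le> sum f W" using W by (rule minsum_le)
  have "k \<le> n" using W card_mono[of "{..<n}" W] by auto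
  then obtain S where S: "S \<subseteq> {..<n}" "card S = k" "sum f S = minsum f n k"
    using minsum_attained by blast
  have fin: "finite S" "finite W" using finite_subset[OF S(1)] finite_subset[OF W(1)] by auto
  have card_eq: "card (W - S) = card (S - W)"
    using fin W S card_Diff_subset_Int[of W S] card_Diff_subset_Int[of S W] by (simp add: Int_commute)
  then obtain \<pi> where \<pi>: "bij_betw \<pi> (W - S) (S - W)"
    using fin finite_same_card_bij[of "W - S" "S - W"] by auto
  have "sum f (W - S) \<le> (\<Sum>x\<in>W - S. f (\<pi> x))"
    using \<pi> S le by (intro sum_mono) (auto dest!: bij_betwE)
  also have "\<dots> = sum f (S - W)" using \<pi> by (rule sum.reindex_bij_betw)
  finally have "sum f (W - S) \<le> sum f (S - W)" .
  moreover have "sum f W = sum f (W - S) + sum f (W \<inter> S)"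
    using fin by (metis add.commute sum.Int_Diff)
  moreover have "sum f S = sum f (S - W) + sum f (W \<inter> S)"
    using fin by (metis add.commute sum.Int_Diff Int_commute)
  ultimately show "sum f W \<le> minsum f n k" using S by linarith
qed

text \<open>This is \<open>hfun lam eps1 (k - 1) - hfun lam eps1 k\<close> at \<open>t = k - lam\<close>.\<close>

definition contr :: "real \<Rightarrow> int \<Rightarrow> real" where
  "contr c t = (if t = 0 then 1 + 2 * c else if \<bar>t\<bar> = 1 then - c else 0)"

text \<open>
  The edge itself moves by \<open>- p\<close>, but of the two neighbouring vectors either one may serve as the
  centre of the smoothing, so the cost is the distance of \<open>- p\<close> to \<open>{0, 1}\<close>.
\<close>

definition dd :: "int \<Rightarrow> int" where
  "dd p = (if 0 \<le> p then p else - p - 1)"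

text \<open>Once the edge itself has moved by \<open>- p\<close>, item \<open>x\<close> stands at
  \<open>b x - p\<close>; the rest of the way to its final excess \<open>t x\<close> is paid by the
  other edge of that triangle.\<close>

definition move_cost :: "(nat \<Rightarrow> int) \<Rightarrow> nat \<Rightarrow> int \<Rightarrow> (nat \<Rightarrow> int) \<Rightarrow> int" where
  "move_cost b n p t = dd p + (\<Sum>x<n. \<bar>t x - (b x - p)\<bar>)"

definition objective :: "real \<Rightarrow> real \<Rightarrow> (nat \<Rightarrow> int) \<Rightarrow> nat \<Rightarrow> int \<Rightarrow> (nat \<Rightarrow> int) \<Rightarrow> real" where
  "objective \<beta> c b n p t = \<bar>\<Sum>x<n. contr c (t x)\<bar> * exp (- \<beta> * move_cost b n p t)"

text \<open>The value 0 accounts for the kink of \<open>dd\<close>. The margin 2 guarantees that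
  outside of the centres a unit step of \<open>p\<close> keeps every unmoved item at distance at
  least 2 from 0, where \<open>contr\<close> vanishes.\<close>

definition centres :: "(nat \<Rightarrow> int) \<Rightarrow> nat \<Rightarrow> int set" where
  "centres b n = {y + j | y j. y \<in> insert 0 (b ` {..<n}) \<and> j \<in> {-2..2}}"

lemma dd_nonneg [simp]: "0 \<le> dd p"
  by (simp add: dd_def)

lemma move_cost_nonneg: "0 \<le> move_cost b n p t"
  by (simp add: move_cost_def sum_nonneg)

text \<open>
  Away from the centres the cost is affine in \<open>p\<close> near \<open>p\<close>, so one of \<open>p - 1\<close> and \<open>p + 1\<close> is at
  least as good; the induction is on the cost, then on \<open>\<bar>p\<bar>\<close>.
\<close>

lemma objective_le_at_centre:
  assumes "\<beta> > 0"
  shows "\<exists>q\<in>centres b n. \<exists>t'. objective \<beta> c b n p t \<le> objective \<beta> c b n q t'"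
proof (induction "(nat (move_cost b n p t), nat \<bar>p\<bar>)" arbitrary: p t
    rule: wf_induct_rule[OF wf_lex_prod[OF wf_less_than wf_less_than]])
  case (1 p t)
  show ?case
  proof (cases "p \<in> centres b n")
    case True then show ?thesis by auto
  next
    case False
    have far0: "\<bar>p\<bar> \<ge> 3"
    proof (rule ccontr)
      assume "\<not> \<bar>p\<bar> \<ge> 3"
      then have "p \<in> {-2..2}" by auto
      then have "p \<in> centres b n" unfolding centres_def by (intro CollectI exI[of _ 0] exI[of _ p]) auto
      then show False using False by simp
    qed
    have far: "\<bar>b x - p\<bar> \<ge> 3" if "x < n" for x
    proof (rule ccontr)
      assume "\<not> \<bar>b x - p\<bar> \<ge> 3"
      then have "p - b x \<in> {-2..2}" by auto
      then have "p \<in> centres b n" unfolding centres_def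
        using that by (intro CollectI exI[of _ "b x"] exI[of _ "p - b x"]) auto
      then show False using False by simp
    qed
    \<comment> \<open>Items that contribute keep their targets; every other item stays where the
      edge's own move puts it, at no cost and, by \<open>far\<close>, without contributing.\<close>
    define t' where "t' q x = (if \<bar>t x\<bar> \<le> 1 then t x else b x - q)" for q x
    have eq: "(\<Sum>x<n. contr c (t' q x)) = (\<Sum>x<n. contr c (t x))" if "\<bar>q - p\<bar> \<le> 1" for q
    proof (rule sum.cong[OF refl])
      fix x assume "x \<in> {..<n}"
      then show "contr c (t' q x) = contr c (t x)"
        using far[of x] that by (auto simp: contr_def t'_def)
    qed
    have better: "objective \<beta> c b n p t \<le> objective \<beta> c b n q (t' q)"
      if "\<bar>q - p\<bar> \<le> 1" "move_cost b n q (t' q) \<le> move_cost b n p t" for q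
      unfolding objective_def eq[OF that(1)] using that(2) assms by (intro mult_left_mono) auto
    have le: "move_cost b n p (t' p) \<le> move_cost b n p t"
      unfolding move_cost_def t'_def by (intro add_left_mono sum_mono) auto
    \<comment> \<open>No absolute value changes its sign between \<open>p - 1\<close> and
      \<open>p + 1\<close>, so the cost is exactly affine there.\<close>
    have avg: "move_cost b n (p - 1) (t' (p - 1)) + move_cost b n (p + 1) (t' (p + 1))
        = 2 * move_cost b n p (t' p)"
    proof -
      have "(\<Sum>x<n. \<bar>t' (p - 1) x - (b x - (p - 1))\<bar>) + (\<Sum>x<n. \<bar>t' (p + 1) x - (b x - (p + 1))\<bar>)
        = (\<Sum>x<n. 2 * \<bar>t' p x - (b x - p)\<bar>)"
        unfolding sum.distrib[symmetric]
      proof (rule sum.cong[OF refl])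
        fix x assume "x \<in> {..<n}"
        then show "\<bar>t' (p - 1) x - (b x - (p - 1))\<bar> + \<bar>t' (p + 1) x - (b x - (p + 1))\<bar>
          = 2 * \<bar>t' p x - (b x - p)\<bar>"
          using far[of x] unfolding t'_def by (cases "\<bar>t x\<bar> \<le> 1") (simp_all, arith?)
      qed
      moreover have "dd (p - 1) + dd (p + 1) = 2 * dd p"
        using far0 by (auto simp: dd_def)
      ultimately show ?thesis by (simp add: move_cost_def sum_distrib_left[symmetric])
    qed
    have "\<exists>q. \<bar>q - p\<bar> \<le> 1 \<and> (move_cost b n q (t' q) < move_cost b n p t \<or>
        (move_cost b n q (t' q) = move_cost b n p t \<and> \<bar>q\<bar> < \<bar>p\<bar>))"
    proof -
      \<comment> \<open>\<open>e\<close> points away from 0. On a tie the choice falls on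
        \<open>p - e\<close>, which has the smaller absolute value, so the lexicographic measure
        decreases.\<close>
      define e :: int where "e = (if 0 < p then 1 else - 1)"
      have e: "\<bar>e\<bar> = 1" "\<bar>p - e\<bar> < \<bar>p\<bar>" using far0 by (auto simp: e_def)
      have "move_cost b n (p - e) (t' (p - e)) + move_cost b n (p + e) (t' (p + e)) \<le> 2 * move_cost b n p t"
        using avg le by (auto simp: e_def)
      then consider "move_cost b n (p - e) (t' (p - e)) \<le> move_cost b n p t"
        | "move_cost b n (p + e) (t' (p + e)) < move_cost b n p t" by linarith
      then show ?thesis
      proof cases
        case 1 then show ?thesis using e by (intro exI[of _ "p - e"]) auto
      next
        case 2 then show ?thesis using e by (intro exI[of _ "p + e"]) auto
      qed
    qed
    then obtain q where q: "\<bar>q - p\<bar> \<le> 1" "move_cost b n q (t' q) < move_cost b n p t \<or>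
        (move_cost b n q (t' q) = move_cost b n p t \<and> \<bar>q\<bar> < \<bar>p\<bar>)" by blast
    then have "((nat (move_cost b n q (t' q)), nat \<bar>q\<bar>), (nat (move_cost b n p t), nat \<bar>p\<bar>))
        \<in> less_than <*lex*> less_than"
      using move_cost_nonneg[of b n q "t' q"] by auto
    from 1[OF this] obtain q' t'' where
      "q' \<in> centres b n" "objective \<beta> c b n q (t' q) \<le> objective \<beta> c b n q' t''" by blast
    moreover have "objective \<beta> c b n p t \<le> objective \<beta> c b n q (t' q)"
      using q by (intro better) auto
    ultimately show ?thesis by (blast intro: order_trans)
  qed
qed

section \<open>Candidates for a fixed shift and a fixed sign\<close>

definition dist_of :: "bool \<Rightarrow> int \<Rightarrow> int" where
  "dist_of neg y = (if neg then \<bar>\<bar>y\<bar> - 1\<bar> else \<bar>y\<bar>)"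

definition near :: "(nat \<Rightarrow> int) \<Rightarrow> nat \<Rightarrow> int \<Rightarrow> int \<Rightarrow> nat set" where
  "near b n p r = {x. x < n \<and> \<bar>b x - p\<bar> \<le> r}"

text \<open>
  The sum reached by moving \<open>k\<close> items to the target when \<open>K\<close> items start within distance 1; the
  negative case aims at \<open>\<plusminus>1\<close>.  It is only a lower bound, since unmoved items that already are at
  the target are charged as well, but adding those to the \<open>k\<close> items costs nothing.
\<close>

definition gain :: "bool \<Rightarrow> real \<Rightarrow> nat \<Rightarrow> nat \<Rightarrow> real" where
  "gain neg c K k = (if neg then c * real k - (1 + 2 * c) * real (K - k)
                     else (1 + 2 * c) * real k - c * real (K - k))"

definition cand :: "bool \<Rightarrow> real \<Rightarrow> real \<Rightarrow> (nat \<Rightarrow> int) \<Rightarrow> nat \<Rightarrow> int \<Rightarrow> nat \<Rightarrow> real" where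
  "cand neg \<beta> c b n p k = gain neg c (card (near b n p 1)) k *
     exp (- \<beta> * (dd p + minsum (\<lambda>x. dist_of neg (b x - p)) n k))"

lemma sum_contr:
  fixes n :: nat
  shows "(\<Sum>x<n. contr c (t x)) = (1 + 2 * c) * card {x. x < n \<and> t x = 0} - c * card {x. x < n \<and> \<bar>t x\<bar> = 1}"
proof -
  have filter: "{x. x < n \<and> Q x} = {x \<in> {..<n}. Q x}" for Q by auto
  have "(\<Sum>x<n. contr c (t x)) = (\<Sum>x<n. (if t x = 0 then 1 + 2 * c else 0)) + (\<Sum>x<n. (if \<bar>t x\<bar> = 1 then - c else 0))"
    unfolding sum.distrib[symmetric] by (rule sum.cong) (auto simp: contr_def)
  also have "\<dots> = (\<Sum>x\<in>{x \<in> {..<n}. t x = 0}. 1 + 2 * c) + (\<Sum>x\<in>{x \<in> {..<n}. \<bar>t x\<bar> = 1}. - c)"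
    by (subst (1 2) sum.inter_filter) simp_all
  finally show ?thesis unfolding filter by simp
qed

text \<open>The right \<open>k\<close> is the size of \<open>S\<close>: the items that end at the
  target, together with those that start near and end at distance 2 or more. The latter start within
  distance 1 of the target and travel at least 1, so bringing them to the target instead costs no
  more. Every other near item ends in \<open>B\<close>, where it counts against the sum.\<close>

lemma objective_le_cand_aux:
  assumes "\<beta> > 0" "c > 0" and t: "(if neg then - 1 else 1) * (\<Sum>x<n. contr c (t x)) \<ge> 0"
  shows "\<exists>k\<le>n. objective \<beta> c b n p t \<le> cand neg \<beta> c b n p k"
proof -
  define N where "N = near b n p 1"
  define S where "S = {x. x < n \<and> (if neg then \<bar>t x\<bar> = 1 else t x = 0)} \<union> {x. x < n \<and> x \<in> N \<and> \<bar>t x\<bar> \<ge> 2}"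
  define A where "A = {x. x < n \<and> (if neg then \<bar>t x\<bar> = 1 else t x = 0)}"
  define B where "B = {x. x < n \<and> (if neg then t x = 0 else \<bar>t x\<bar> = 1)}"
  have fin: "finite S" "finite A" "finite B" "finite N" by (auto simp: S_def A_def B_def N_def near_def)
  have Sn: "S \<subseteq> {..<n}" by (auto simp: S_def)
  have AS: "card A \<le> card S" using fin by (intro card_mono) (auto simp: A_def S_def)
  have "N \<subseteq> B \<union> S" by (auto simp: N_def near_def S_def B_def)
  then have "card N \<le> card (B \<union> S)" using fin by (intro card_mono) auto
  also have "\<dots> \<le> card B + card S" by (rule card_Un_le)
  finally have NB: "card N - card S \<le> card B" by simp
  have val: "\<bar>\<Sum>x<n. contr c (t x)\<bar> \<le> gain neg c (card N) (card S)"
  proof (cases neg)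
    case True
    have "\<bar>\<Sum>x<n. contr c (t x)\<bar> = c * card A - (1 + 2 * c) * card B"
      using t True by (simp add: sum_contr A_def B_def)
    also have "\<dots> \<le> c * card S - (1 + 2 * c) * real (card N - card S)"
      using AS NB assms by (intro diff_mono mult_left_mono) auto
    finally show ?thesis using True by (simp add: gain_def)
  next
    case False
    have "\<bar>\<Sum>x<n. contr c (t x)\<bar> = (1 + 2 * c) * card A - c * card B"
      using t False by (simp add: sum_contr A_def B_def)
    also have "\<dots> \<le> (1 + 2 * c) * card S - c * real (card N - card S)"
      using AS NB assms by (intro diff_mono mult_left_mono) auto
    finally show ?thesis using False by (simp add: gain_def)
  qed
  have "minsum (\<lambda>x. dist_of neg (b x - p)) n (card S) \<le> (\<Sum>x\<in>S. dist_of neg (b x - p))"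
    using Sn by (intro minsum_le) auto
  also have "\<dots> \<le> (\<Sum>x\<in>S. \<bar>t x - (b x - p)\<bar>)"
    by (rule sum_mono) (auto simp: S_def N_def near_def dist_of_def split: if_splits)
  also have "\<dots> \<le> (\<Sum>x<n. \<bar>t x - (b x - p)\<bar>)" using Sn by (intro sum_mono2) auto
  finally have cost: "dd p + minsum (\<lambda>x. dist_of neg (b x - p)) n (card S) \<le> move_cost b n p t"
    by (simp add: move_cost_def)
  \<comment> \<open>Nonnegativity of the gain is what allows the estimates of gain and cost to be
    multiplied.\<close>
  have "0 \<le> gain neg c (card N) (card S)" using val by linarith
  then have "objective \<beta> c b n p t \<le> cand neg \<beta> c b n p (card S)"
    unfolding objective_def cand_def N_def[symmetric] using val cost assms
    by (intro mult_mono) auto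
  moreover have "card S \<le> n" using card_mono[OF _ Sn] by simp
  ultimately show ?thesis by blast
qed

lemma objective_le_cand:
  assumes "\<beta> > 0" "c > 0"
  shows "\<exists>neg. \<exists>k\<le>n. objective \<beta> c b n p t \<le> cand neg \<beta> c b n p k"
proof (cases "(\<Sum>x<n. contr c (t x)) \<ge> 0")
  case True
  then show ?thesis using objective_le_cand_aux[OF assms, where neg = False and n = n and t = t and b = b and p = p] by auto
next
  case False
  then show ?thesis using objective_le_cand_aux[OF assms, where neg = True and n = n and t = t and b = b and p = p] by auto
qed

lemma initial_segment:
  fixes f :: "nat \<Rightarrow> int"
  assumes "k \<le> n"
  obtains W where "W \<subseteq> {..<n}" "card W = k" "\<And>x y. x \<in> W \<Longrightarrow> y < n \<Longrightarrow> y \<notin> W \<Longrightarrow> f x \<le> f y"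
proof -
  have "\<exists>W\<subseteq>{..<n}. card W = k \<and> (\<forall>x\<in>W. \<forall>y<n. y \<notin> W \<longrightarrow> f x \<le> f y)" using assms
  proof (induction k)
    case 0 then show ?case by (intro exI[of _ "{}"]) auto
  next
    case (Suc k)
    then obtain W where W: "W \<subseteq> {..<n}" "card W = k" "\<forall>x\<in>W. \<forall>y<n. y \<notin> W \<longrightarrow> f x \<le> f y" by auto
    have fin: "finite W" using W(1) by (rule finite_subset) simp
    have ne: "{..<n} - W \<noteq> {}"
    proof
      assume "{..<n} - W = {}"
      then have "W = {..<n}" using W by auto
      then show False using W Suc by simp
    qed
    define z where "z = arg_min_on f ({..<n} - W)"
    have z: "z \<in> {..<n} - W" "\<And>y. y \<in> {..<n} - W \<Longrightarrow> f z \<le> f y"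
      unfolding z_def using ne arg_min_if_finite[of "{..<n} - W" f] arg_min_least[of "{..<n} - W" _ f] by auto
    show ?case
      using W z fin by (intro exI[of _ "insert z W"]) auto
  qed
  then show thesis using that by blast
qed

text \<open>A cheapest \<open>k\<close>-set goes to the target (to the nearer of 1 and - 1 in the
  negative case) and all else stays. The gain is reached if at most \<open>card N - k\<close> near
  items stay, hence if the set consists of near items only or contains all of them. Costs alone do
  not ensure this: in the negative case an item at 0 is as expensive as one at distance 2.\<close>

lemma cand_le_objective:
  assumes "\<beta> > 0" "c > 0" "k \<le> n"
  shows "\<exists>t. cand neg \<beta> c b n p k \<le> objective \<beta> c b n p t"
proof -
  \<comment> \<open>Among the items of equal cost, those within distance 1 of the centre have to come first.\<close>
  define f where "f x = 2 * dist_of neg (b x - p) + (if \<bar>b x - p\<bar> \<ge> 2 then 1 else 0)" for x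
  obtain W where W: "W \<subseteq> {..<n}" "card W = k" "\<And>x y. x \<in> W \<Longrightarrow> y < n \<Longrightarrow> y \<notin> W \<Longrightarrow> f x \<le> f y"
    using initial_segment[OF assms(3), of f] by blast
  have fin: "finite W" using W(1) by (rule finite_subset) simp
  define N where "N = near b n p 1"
  have finN: "finite N" by (auto simp: N_def near_def)
  have ms: "minsum (\<lambda>x. dist_of neg (b x - p)) n k = (\<Sum>x\<in>W. dist_of neg (b x - p))"
  proof (rule minsum_eqI[OF W(1,2)])
    fix x y assume "x \<in> W" "y < n" "y \<notin> W"
    then have "f x \<le> f y" using W by blast
    then show "dist_of neg (b x - p) \<le> dist_of neg (b y - p)"
      by (simp add: f_def split: if_splits)
  qed
  have disj: "W \<subseteq> N \<or> N \<subseteq> W"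
  proof (rule ccontr)
    assume "\<not> ?thesis"
    then obtain x y where xy: "x \<in> W" "x \<notin> N" "y \<in> N" "y \<notin> W" by blast
    then have "x < n" "y < n" using W by (auto simp: N_def near_def)
    then have "f x \<le> f y" using W(3) xy by blast
    moreover have "\<bar>b y - p\<bar> \<le> 1" "\<bar>b x - p\<bar> \<ge> 2" using xy \<open>x < n\<close> by (auto simp: N_def near_def)
    ultimately show False by (cases neg) (simp_all add: f_def dist_of_def, arith?)
  qed
  then have NW: "card (N - W) = card N - k"
  proof
    assume "W \<subseteq> N"
    then show ?thesis using fin W by (simp add: card_Diff_subset)
  next
    assume "N \<subseteq> W"
    then have "card N \<le> k" "card (N - W) = 0" using fin W card_mono by (blast, metis Diff_eq_empty_iff card.empty)
    then show ?thesis by linarith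
  qed
  define t where "t x = (if x \<in> W then (if neg then (if b x - p \<ge> 0 then 1 else - 1) else 0) else b x - p)" for x
  have "(\<Sum>x<n. \<bar>t x - (b x - p)\<bar>) = (\<Sum>x\<in>W. \<bar>t x - (b x - p)\<bar>)"
    using W by (intro sum.mono_neutral_right) (auto simp: t_def)
  also have "\<dots> = (\<Sum>x\<in>W. dist_of neg (b x - p))"
    by (rule sum.cong) (auto simp: t_def dist_of_def)
  finally have cost: "move_cost b n p t = dd p + minsum (\<lambda>x. dist_of neg (b x - p)) n k"
    by (simp add: move_cost_def ms)
  define A where "A = {x. x < n \<and> (if neg then \<bar>t x\<bar> = 1 else t x = 0)}"
  define B where "B = {x. x < n \<and> (if neg then t x = 0 else \<bar>t x\<bar> = 1)}"
  have "k \<le> card A" unfolding W(2)[symmetric] using W by (intro card_mono) (auto simp: A_def t_def)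
  moreover have "card B \<le> card N - k" unfolding NW[symmetric] using finN
    by (intro card_mono) (auto simp: B_def t_def N_def near_def split: if_splits)
  ultimately have "gain neg c (card N) k \<le>
      (if neg then c * card A - (1 + 2 * c) * card B else (1 + 2 * c) * card A - c * card B)"
    unfolding gain_def using assms by (auto intro!: diff_mono mult_left_mono)
  also have "\<dots> \<le> \<bar>\<Sum>x<n. contr c (t x)\<bar>"
    by (auto simp: sum_contr A_def B_def)
  finally show ?thesis
    unfolding objective_def cand_def cost N_def[symmetric]
    by (intro exI[of _ t]) (auto simp: cost intro!: mult_right_mono)
qed

section \<open>Unimodality in \<open>k\<close>\<close>

text \<open>The value is \<open>V k * E k\<close> with \<open>V\<close> increasing and concave,
  \<open>E\<close> positive, nonincreasing and log-concave. However, \<open>V\<close> may start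
  negative, where log-concavity is no help. A failure to rise can only occur where
  \<open>V k > 0\<close>, and from there on the inequality for a product of log-concave sequences
  applies.\<close>

lemma cand_unimodal:
  assumes \<beta>: "\<beta> > 0" and c: "c > 0" and k: "Suc (Suc k) \<le> n"
    and ge: "cand neg \<beta> c b n p (Suc k) \<le> cand neg \<beta> c b n p k"
  shows "cand neg \<beta> c b n p (Suc (Suc k)) \<le> cand neg \<beta> c b n p (Suc k)"
proof -
  define A where "A = minsum (\<lambda>x. dist_of neg (b x - p)) n"
  define V where "V = gain neg c (card (near b n p 1))"
  define E where "E i = exp (- \<beta> * (dd p + A i))" for i
  have F: "cand neg \<beta> c b n p i = V i * E i" for i
    by (simp add: cand_def V_def E_def A_def)
  have Epos: "E i > 0" for i by (simp add: E_def)
  have A1: "A k \<le> A (Suc k)" unfolding A_def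
    using k by (intro minsum_mono) (auto simp: dist_of_def)
  have A2: "2 * A (Suc k) \<le> A k + A (Suc (Suc k))" unfolding A_def using k by (rule minsum_convex)
  have V1: "V k < V (Suc k)" "V (Suc k) < V (Suc (Suc k))"
  proof -
    have *: "V i < V (Suc i)" for i
    proof -
      have "real (card (near b n p 1) - Suc i) \<le> real (card (near b n p 1) - i)" by simp
      then have "c * real (card (near b n p 1) - Suc i) \<le> c * real (card (near b n p 1) - i)"
        "(1 + 2 * c) * real (card (near b n p 1) - Suc i) \<le> (1 + 2 * c) * real (card (near b n p 1) - i)"
        using c by (intro mult_left_mono; simp)+
      then show ?thesis using c by (auto simp: V_def gain_def algebra_simps)
    qed
    show "V k < V (Suc k)" "V (Suc k) < V (Suc (Suc k))" using * by auto
  qed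
  have V2: "V k + V (Suc (Suc k)) \<le> 2 * V (Suc k)"
  proof -
    define K where "K = card (near b n p 1)"
    have "2 * real (K - Suc k) \<le> real (K - k) + real (K - Suc (Suc k))" by linarith
    then have "c * (2 * real (K - Suc k)) \<le> c * (real (K - k) + real (K - Suc (Suc k)))"
      "(1 + 2 * c) * (2 * real (K - Suc k)) \<le> (1 + 2 * c) * (real (K - k) + real (K - Suc (Suc k)))"
      using c by (intro mult_left_mono; simp)+
    then show ?thesis by (auto simp: V_def gain_def K_def[symmetric] algebra_simps)
  qed
  have E1: "E (Suc k) \<le> E k" using A1 \<beta> by (simp add: E_def)
  have E2: "E k * E (Suc (Suc k)) \<le> E (Suc k) * E (Suc k)"
  proof -
    have "real_of_int (2 * A (Suc k)) \<le> real_of_int (A k + A (Suc (Suc k)))" using A2 by (simp only: of_int_le_iff)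
    then have "\<beta> * (2 * real_of_int (A (Suc k))) \<le> \<beta> * (real_of_int (A k) + real_of_int (A (Suc (Suc k))))"
      using \<beta> by (intro mult_left_mono) auto
    then show ?thesis by (simp add: E_def exp_add[symmetric] algebra_simps)
  qed
  \<comment> \<open>While \<open>V k\<close> is at most 0 the value strictly rises: either
    \<open>V\<close> becomes positive, or it grows and a smaller \<open>E\<close> only brings a
    nonpositive product closer to 0.\<close>
  have Vk: "V k > 0"
  proof (rule ccontr)
    assume "\<not> V k > 0"
    show False
    proof (cases "V (Suc k) > 0")
      case True
      then have "V (Suc k) * E (Suc k) > 0" using Epos by simp
      moreover have "V k * E k \<le> 0" using \<open>\<not> V k > 0\<close> Epos[of k] by (simp add: mult_nonpos_nonneg)
      ultimately show False using ge F by (metis not_le order_le_less_trans)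
    next
      case False
      have "V k * E k < V (Suc k) * E k" using V1 Epos by simp
      also have "\<dots> \<le> V (Suc k) * E (Suc k)" using False E1 by (intro mult_left_mono_neg) auto
      finally show False using ge F by (simp add: not_le[symmetric])
    qed
  qed
  have "V k * V (Suc (Suc k)) \<le> V (Suc k) * V (Suc k)"
  proof -
    have "V k * V (Suc (Suc k)) \<le> V k * (2 * V (Suc k) - V k)"
      using V2 Vk by (intro mult_left_mono) auto
    also have "\<dots> \<le> V (Suc k) * V (Suc k)"
      using zero_le_square[of "V (Suc k) - V k"] by (simp add: algebra_simps)
    finally show ?thesis .
  qed
  then have "(V k * V (Suc (Suc k))) * (E k * E (Suc (Suc k))) \<le> (V (Suc k) * V (Suc k)) * (E (Suc k) * E (Suc k))"
    by (rule mult_mono[OF _ E2]) (use Epos in \<open>auto simp: less_imp_le\<close>)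
  also have "\<dots> = (V (Suc k) * E (Suc k)) * (V (Suc k) * E (Suc k))" by (simp add: algebra_simps)
  also have "\<dots> \<le> (V (Suc k) * E (Suc k)) * (V k * E k)"
    using ge Vk V1 Epos F by (intro mult_left_mono) (auto simp: less_imp_le)
  finally have "(V k * E k) * (V (Suc (Suc k)) * E (Suc (Suc k))) \<le> (V k * E k) * (V (Suc k) * E (Suc k))"
    by (simp add: algebra_simps)
  then show ?thesis unfolding F using Vk Epos[of k] by (simp add: mult_le_cancel_left_pos)
qed

lemma cand_search_correct:
  assumes \<beta>: "\<beta> > 0" and c: "c > 0" and r: "r \<le> n"
    and up: "\<And>i. i < r \<Longrightarrow> cand neg \<beta> c b n p i < cand neg \<beta> c b n p (Suc i)"
    and down: "\<And>i. r \<le> i \<Longrightarrow> i < n \<Longrightarrow> \<not> cand neg \<beta> c b n p i < cand neg \<beta> c b n p (Suc i)"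
    and k: "k \<le> n"
  shows "cand neg \<beta> c b n p k \<le> cand neg \<beta> c b n p r"
proof (cases "k \<le> r")
  case True
  have "cand neg \<beta> c b n p (r - i) \<le> cand neg \<beta> c b n p r" if "i \<le> r" for i using that
  proof (induction i)
    case (Suc i)
    then have "Suc (r - Suc i) = r - i" by simp
    then show ?case using up[of "r - Suc i"] Suc by simp
  qed simp
  from this[of "r - k"] True show ?thesis by simp
next
  case False
  have "r + i \<le> n \<Longrightarrow> cand neg \<beta> c b n p (r + i) \<le> cand neg \<beta> c b n p r" for i
  proof (induction i)
    case (Suc i)
    then show ?case using down[of "r + i"] by simp
  qed simp
  from this[of "k - r"] False k show ?thesis by simp
qed

text \<open>Turns unimodality into the monotone predicate that a binary search over \<open>k\<close>
  requires.\<close>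

lemma cand_rising_down_closed:
  assumes \<beta>: "\<beta> > 0" and c: "c > 0" and "i \<le> j" "j < n"
    and "cand neg \<beta> c b n p j < cand neg \<beta> c b n p (Suc j)"
  shows "cand neg \<beta> c b n p i < cand neg \<beta> c b n p (Suc i)"
  using assms(3,4,5)
proof (induction "j - i" arbitrary: j)
  case 0 then show ?case by simp
next
  case (Suc e)
  then obtain j' where j': "j = Suc j'" "i \<le> j'" by (cases j) auto
  have "cand neg \<beta> c b n p j' < cand neg \<beta> c b n p (Suc j')"
    using cand_unimodal[OF \<beta> c, of j' n neg b p] Suc.prems j' by fastforce
  then show ?case using Suc.hyps(1)[of j'] Suc.hyps(2) Suc.prems j' by simp
qed

section \<open>The nearest items in a sorted list\<close>

text \<open>For sorted items, \<open>b i + b (i + k) < 2 * p\<close> implies that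
  \<open>b (i + k)\<close> is no farther from \<open>p\<close> than \<open>b i\<close>, and its
  failure implies the opposite. So the test decides whether the window starting at \<open>i\<close>
  should be shifted to the right, and \<open>l\<close> is where shifting stops.\<close>

lemma window_minsum:
  assumes mono: "\<And>i j. i \<le> j \<Longrightarrow> j < n \<Longrightarrow> b i \<le> b j" and lk: "l + k \<le> n"
    and left: "\<And>i. i < l \<Longrightarrow> b i + b (i + k) < 2 * p"
    and right: "\<And>i. l \<le> i \<Longrightarrow> i < n - k \<Longrightarrow> \<not> b i + b (i + k) < 2 * p"
  shows "minsum (\<lambda>x. \<bar>b x - p\<bar>) n k = (\<Sum>x\<in>{l..<l+k}. \<bar>b x - p\<bar>)"
    and "x \<in> {l..<l+k} \<Longrightarrow> y < n \<Longrightarrow> y \<notin> {l..<l+k} \<Longrightarrow> \<bar>b x - p\<bar> \<le> \<bar>b y - p\<bar>"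
proof -
  show *: "\<bar>b x - p\<bar> \<le> \<bar>b y - p\<bar>" if "x \<in> {l..<l+k}" "y < n" "y \<notin> {l..<l+k}" for x y
  proof (cases "y < l")
    case True
    have "b y \<le> b (l - 1)" "b x \<le> b (l - 1 + k)" "b y \<le> b x" using True that lk by (auto intro!: mono)
    then show ?thesis using left[of "l - 1"] True by linarith
  next
    case False
    then have y: "l < n - k" "l + k \<le> y" using that by auto
    then have "b (l + k) \<le> b y" "b l \<le> b x" "b x \<le> b y" using that lk by (auto intro!: mono)
    then show ?thesis using right[of l] y by linarith
  qed
  then show "minsum (\<lambda>x. \<bar>b x - p\<bar>) n k = (\<Sum>x\<in>{l..<l+k}. \<bar>b x - p\<bar>)"
    using lk by (intro minsum_eqI) auto
qed

text \<open>In the negative case the cheapest items need not be the nearest to \<open>p\<close>, so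
  a window does not serve directly. Below the number of near items no window is required: items at
  distance exactly 1 are free, and after them the items at \<open>p\<close> cost 1 each.\<close>

lemma minsum_neg_small:
  assumes k: "k < card (near b n p 1)"
  shows "minsum (\<lambda>x. \<bar>\<bar>b x - p\<bar> - 1\<bar>) n k = int (k - (card (near b n p 1) - card (near b n p 0)))"
proof -
  define N O1 where "N = near b n p 1" and "O1 = near b n p 1 - near b n p 0"
  have fin: "finite N" "finite O1" "finite (near b n p 0)" by (auto simp: N_def O1_def near_def)
  have sub: "near b n p 0 \<subseteq> N" by (auto simp: N_def near_def)
  have cO: "card O1 = card N - card (near b n p 0)"
    using fin sub by (simp add: O1_def N_def card_Diff_subset)
  have "O1 \<subseteq> N" by (auto simp: O1_def N_def)
  show ?thesis
  proof (cases "k \<le> card O1")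
    case True
    then obtain W where W: "W \<subseteq> O1" "card W = k" by (meson obtain_subset_with_card_n)
    have "minsum (\<lambda>x. \<bar>\<bar>b x - p\<bar> - 1\<bar>) n k = (\<Sum>x\<in>W. \<bar>\<bar>b x - p\<bar> - 1\<bar>)"
      using W by (intro minsum_eqI) (force simp: O1_def near_def)+
    also have "\<dots> = 0" using W by (intro sum.neutral) (force simp: O1_def near_def)
    finally show ?thesis using True cO by (simp add: N_def)
  next
    case False
    then have "O1 \<subseteq> N \<and> card O1 \<le> k \<and> k \<le> card N" using k \<open>O1 \<subseteq> N\<close> by (simp add: N_def)
    then obtain W where W: "O1 \<subseteq> W" "W \<subseteq> N" "card W = k"
      using exists_subset_between[of O1 k N] fin by auto
    have finW: "finite W" using W(2) fin(1) by (rule finite_subset)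
    have "minsum (\<lambda>x. \<bar>\<bar>b x - p\<bar> - 1\<bar>) n k = (\<Sum>x\<in>W. \<bar>\<bar>b x - p\<bar> - 1\<bar>)"
    proof (rule minsum_eqI)
      fix x y assume "x \<in> W" "y < n" "y \<notin> W"
      then have "x \<in> N" "y \<notin> O1" using W by blast+
      then have "\<bar>b x - p\<bar> \<le> 1" "\<bar>b y - p\<bar> \<noteq> 1"
        using \<open>y < n\<close> by (auto simp: N_def O1_def near_def)
      then show "\<bar>\<bar>b x - p\<bar> - 1\<bar> \<le> \<bar>\<bar>b y - p\<bar> - 1\<bar>" by auto
    qed (use W in \<open>auto simp: N_def near_def\<close>)
    also have "\<dots> = (\<Sum>x\<in>W - O1. \<bar>\<bar>b x - p\<bar> - 1\<bar>)"
      using finW by (intro sum.mono_neutral_right) (auto simp: O1_def near_def)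
    also have "\<dots> = (\<Sum>x\<in>W - O1. 1)"
    proof (rule sum.cong[OF refl])
      fix x assume "x \<in> W - O1"
      then have "x \<in> near b n p 0" using W(2) by (auto simp: O1_def N_def)
      then show "\<bar>\<bar>b x - p\<bar> - 1\<bar> = 1" by (simp add: near_def)
    qed
    also have "\<dots> = int (k - card O1)" using W(1,3) fin(2) by (simp add: card_Diff_subset)
    finally show ?thesis using cO by (simp add: N_def)
  qed
qed

text \<open>Now the \<open>k\<close> nearest items include all near ones, and the cost of an item at
  distance \<open>r\<close> is \<open>r - 1\<close> unless \<open>r = 0\<close>. An item at
  \<open>p\<close> costs 1 instead of - 1, whence the correction by 2 for each of them.\<close>

lemma minsum_neg_large:
  assumes W: "W \<subseteq> {..<n}" "card W = k"
    and le: "\<And>x y. x \<in> W \<Longrightarrow> y < n \<Longrightarrow> y \<notin> W \<Longrightarrow> \<bar>b x - p\<bar> \<le> \<bar>b y - p\<bar>"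
    and k: "card (near b n p 1) \<le> k"
  shows "minsum (\<lambda>x. \<bar>\<bar>b x - p\<bar> - 1\<bar>) n k = (\<Sum>x\<in>W. \<bar>b x - p\<bar>) - int k + 2 * int (card (near b n p 0))"
proof -
  have fin: "finite W" "finite (near b n p 0)" "finite (near b n p 1)"
    using finite_subset[OF W(1)] by (auto simp: near_def)
  have N: "near b n p 1 \<subseteq> W"
  proof
    \<comment> \<open>A near item outside \<open>W\<close> would force all of \<open>W\<close> to be
      near, which makes more than \<open>k\<close> near items.\<close>
    fix y assume y: "y \<in> near b n p 1"
    show "y \<in> W"
    proof (rule ccontr)
      assume "y \<notin> W"
      then have "insert y W \<subseteq> near b n p 1"
        using le[of _ y] y W by (force simp: near_def subset_iff)
      then have "card (insert y W) \<le> card (near b n p 1)" using fin by (intro card_mono)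
      then show False using \<open>y \<notin> W\<close> fin W k by simp
    qed
  qed
  then have Z: "near b n p 0 \<subseteq> W" by (force simp: near_def)
  have "minsum (\<lambda>x. \<bar>\<bar>b x - p\<bar> - 1\<bar>) n k = (\<Sum>x\<in>W. \<bar>\<bar>b x - p\<bar> - 1\<bar>)"
  proof (rule minsum_eqI[OF W])
    fix x y assume xy: "x \<in> W" "y < n" "y \<notin> W"
    then have "y \<notin> near b n p 1" using N by auto
    then have "\<bar>b y - p\<bar> \<ge> 2" using xy by (auto simp: near_def)
    then show "\<bar>\<bar>b x - p\<bar> - 1\<bar> \<le> \<bar>\<bar>b y - p\<bar> - 1\<bar>" using le[OF xy] by linarith
  qed
  also have "\<dots> = (\<Sum>x\<in>W. \<bar>b x - p\<bar> - 1 + (if x \<in> near b n p 0 then 2 else 0))"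
    using W by (intro sum.cong) (auto simp: near_def)
  also have "\<dots> = (\<Sum>x\<in>W. \<bar>b x - p\<bar>) - int k + (\<Sum>x\<in>W. if x \<in> near b n p 0 then 2 else 0)"
    using W by (simp add: sum.distrib sum_subtractf)
  also have "(\<Sum>x\<in>W. if x \<in> near b n p 0 then 2 else 0) = 2 * int (card (near b n p 0))"
    using fin Z by (simp add: sum.If_cases Int_absorb1)
  finally show ?thesis .
qed

section \<open>Timed execution of programs\<close>

text \<open>Total correctness within a time budget. Since \<open>exec\<close> is deterministic,
  assignments and branches satisfy equivalences, so simplification can execute straight-line code
  symbolically.\<close>

definition runs :: "com \<Rightarrow> state \<Rightarrow> nat \<Rightarrow> (state \<Rightarrow> bool) \<Rightarrow> bool" where
  "runs c s T Q \<longleftrightarrow> (\<exists>t s'. exec c s t s' \<and> t \<le> T \<and> Q s')"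

lemma runs_Skip [simp]: "runs Skip s T Q \<longleftrightarrow> 1 \<le> T \<and> Q s"
  unfolding runs_def by (metis exec.Skip exec_deterministic)

lemma runs_IAssign [simp]: "runs (IAssign x e) s T Q \<longleftrightarrow> 1 + icost e \<le> T \<and> Q (s\<lparr>ivar := (ivar s)(x := ival e s)\<rparr>)"
  unfolding runs_def by (metis exec.IAssign exec_deterministic)

lemma runs_RAssign [simp]: "runs (RAssign x e) s T Q \<longleftrightarrow> 1 + rcost e \<le> T \<and> Q (s\<lparr>rvar := (rvar s)(x := rval e s)\<rparr>)"
  unfolding runs_def by (metis exec.RAssign exec_deterministic)

lemma runs_IStore [simp]: "runs (IStore a i e) s T Q \<longleftrightarrow> 1 + icost i + icost e \<le> T \<and>
    Q (s\<lparr>iarr := (iarr s)(a := (iarr s a)(ival i s := ival e s))\<rparr>)"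
  unfolding runs_def by (metis exec.IStore exec_deterministic)

lemma runs_mono: "runs c s T Q \<Longrightarrow> T \<le> T' \<Longrightarrow> (\<And>s'. Q s' \<Longrightarrow> Q' s') \<Longrightarrow> runs c s T' Q'"
  unfolding runs_def by (meson order_trans)

lemma runs_Seq:
  assumes "runs c1 s T1 Q1" "\<And>s'. Q1 s' \<Longrightarrow> runs c2 s' T2 Q" "T1 + T2 \<le> T"
  shows "runs (Seq c1 c2) s T Q"
proof -
  obtain t1 s1 where 1: "exec c1 s t1 s1" "t1 \<le> T1" "Q1 s1" using assms(1) by (auto simp: runs_def)
  obtain t2 s2 where 2: "exec c2 s1 t2 s2" "t2 \<le> T2" "Q s2" using assms(2)[OF 1(3)] by (auto simp: runs_def)
  show ?thesis unfolding runs_def using exec.Seq[OF 1(1) 2(1)] 1 2 assms(3) by fastforce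
qed

lemma runs_Seq_prim:
  assumes "exec c1 s t1 s1"
  shows "runs (Seq c1 c2) s T Q \<longleftrightarrow> t1 \<le> T \<and> runs c2 s1 (T - t1) Q"
proof
  assume "runs (Seq c1 c2) s T Q"
  then obtain t s2 where t: "exec (Seq c1 c2) s t s2" "t \<le> T" "Q s2" by (auto simp: runs_def)
  from t(1) obtain u1 u2 r where u: "t = u1 + u2" "exec c1 s u1 r" "exec c2 r u2 s2" by (rule Seq_E)
  have "u1 = t1" "r = s1" using exec_deterministic[OF assms u(2)] by auto
  then show "t1 \<le> T \<and> runs c2 s1 (T - t1) Q" using u t by (auto simp: runs_def intro!: exI[of _ u2] exI[of _ s2])
next
  assume *: "t1 \<le> T \<and> runs c2 s1 (T - t1) Q"
  show "runs (Seq c1 c2) s T Q"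
    by (rule runs_Seq[where ?T1.0 = t1 and ?Q1.0 = "\<lambda>s'. s' = s1" and ?T2.0 = "T - t1"])
      (use * assms in \<open>auto simp: runs_def\<close>)
qed

lemmas runs_Seq_assign [simp] =
  runs_Seq_prim[OF exec.IAssign] runs_Seq_prim[OF exec.RAssign] runs_Seq_prim[OF exec.IStore]
  runs_Seq_prim[OF exec.Skip]

lemma runs_If [simp]:
  "runs (If b c1 c2) s T Q \<longleftrightarrow> 1 + bcost b \<le> T \<and> runs (if bval b s then c1 else c2) s (T - (1 + bcost b)) Q"
proof
  assume "runs (If b c1 c2) s T Q"
  then obtain t s2 where t: "exec (If b c1 c2) s t s2" "t \<le> T" "Q s2" by (auto simp: runs_def)
  from t(1) show "1 + bcost b \<le> T \<and> runs (if bval b s then c1 else c2) s (T - (1 + bcost b)) Q"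
    by (rule If_E) (use t in \<open>auto simp: runs_def intro!: exI\<close>)
next
  assume *: "1 + bcost b \<le> T \<and> runs (if bval b s then c1 else c2) s (T - (1 + bcost b)) Q"
  then obtain t s2 where t: "exec (if bval b s then c1 else c2) s t s2" "t \<le> T - (1 + bcost b)" "Q s2"
    by (auto simp: runs_def)
  have "exec (If b c1 c2) s (1 + bcost b + t) s2"
    using t(1) by (cases "bval b s") (simp_all only: if_True if_False exec.IfTrue exec.IfFalse simp_thms)
  then show "runs (If b c1 c2) s T Q" unfolding runs_def using t * by fastforce
qed

lemma runs_Seq_assoc: "runs (Seq (Seq a b) c) s T Q \<longleftrightarrow> runs (Seq a (Seq b c)) s T Q"
proof
  assume "runs (Seq (Seq a b) c) s T Q"
  then obtain t s3 where t: "exec (Seq (Seq a b) c) s t s3" "t \<le> T" "Q s3" by (auto simp: runs_def)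
  from t(1) obtain u t3 s2 where 1: "t = u + t3" "exec (Seq a b) s u s2" "exec c s2 t3 s3" by (rule Seq_E)
  from 1(2) obtain t1 t2 s1 where 2: "u = t1 + t2" "exec a s t1 s1" "exec b s1 t2 s2" by (rule Seq_E)
  have "exec (Seq a (Seq b c)) s (t1 + (t2 + t3)) s3" using 1 2 by (blast intro: exec.Seq)
  then show "runs (Seq a (Seq b c)) s T Q" unfolding runs_def using t 1 2 by fastforce
next
  assume "runs (Seq a (Seq b c)) s T Q"
  then obtain t s3 where t: "exec (Seq a (Seq b c)) s t s3" "t \<le> T" "Q s3" by (auto simp: runs_def)
  from t(1) obtain t1 u s1 where 1: "t = t1 + u" "exec a s t1 s1" "exec (Seq b c) s1 u s3" by (rule Seq_E)
  from 1(3) obtain t2 t3 s2 where 2: "u = t2 + t3" "exec b s1 t2 s2" "exec c s2 t3 s3" by (rule Seq_E)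
  have "exec (Seq (Seq a b) c) s (t1 + t2 + t3) s3" using 1 2 by (blast intro: exec.Seq)
  then show "runs (Seq (Seq a b) c) s T Q" unfolding runs_def using t 1 2 by fastforce
qed

text \<open>Carries the continuation into the branch taken, so that no assertion has to be invented
  for the point where the branches join.\<close>

lemma runs_Seq_If [simp]:
  "runs (Seq (If b c1 c2) c) s T Q \<longleftrightarrow>
     1 + bcost b \<le> T \<and> runs (Seq (if bval b s then c1 else c2) c) s (T - (1 + bcost b)) Q"
proof
  assume "runs (Seq (If b c1 c2) c) s T Q"
  then obtain t s2 where t: "exec (Seq (If b c1 c2) c) s t s2" "t \<le> T" "Q s2" by (auto simp: runs_def)
  from t(1) obtain t1 t2 s1 where 1: "t = t1 + t2" "exec (If b c1 c2) s t1 s1" "exec c s1 t2 s2" by (rule Seq_E)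
  have "\<exists>t'. t1 = 1 + bcost b + t' \<and> exec (if bval b s then c1 else c2) s t' s1"
    using 1(2) by (rule If_E) auto
  then obtain t' where "t1 = 1 + bcost b + t'" "exec (if bval b s then c1 else c2) s t' s1" by blast
  then have "exec (Seq (if bval b s then c1 else c2) c) s (t' + t2) s2" "t' + t2 \<le> T - (1 + bcost b)" "1 + bcost b \<le> T"
    using 1 t by (auto intro: exec.Seq)
  then show "1 + bcost b \<le> T \<and> runs (Seq (if bval b s then c1 else c2) c) s (T - (1 + bcost b)) Q"
    using t(3) unfolding runs_def by blast
next
  assume *: "1 + bcost b \<le> T \<and> runs (Seq (if bval b s then c1 else c2) c) s (T - (1 + bcost b)) Q"
  then obtain t s2 where t: "exec (Seq (if bval b s then c1 else c2) c) s t s2" "t \<le> T - (1 + bcost b)" "Q s2"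
    by (auto simp: runs_def)
  from t(1) obtain t1 t2 s1 where 1: "t = t1 + t2" "exec (if bval b s then c1 else c2) s t1 s1" "exec c s1 t2 s2"
    by (rule Seq_E)
  have "exec (If b c1 c2) s (1 + bcost b + t1) s1"
    using 1(2) by (cases "bval b s") (simp_all only: if_True if_False exec.IfTrue exec.IfFalse simp_thms)
  then have "exec (Seq (If b c1 c2) c) s (1 + bcost b + t1 + t2) s2" using 1(3) by (rule exec.Seq)
  then show "runs (Seq (If b c1 c2) c) s T Q" unfolding runs_def using t * 1(1) by fastforce
qed

text \<open>The index of \<open>I\<close> bounds the number of remaining rounds; the loop may exit
  at any index.\<close>

lemma runs_While:
  assumes "I N s"
    and step: "\<And>k s. I k s \<Longrightarrow> bval b s \<Longrightarrow> \<exists>k'. k = Suc k' \<and> runs c s \<tau> (I k')"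
    and exit: "\<And>k s. I k s \<Longrightarrow> \<not> bval b s \<Longrightarrow> Q s"
    and T: "Suc N * (1 + bcost b) + N * \<tau> \<le> T"
  shows "runs (While b c) s T Q"
proof -
  have "runs (While b c) s (Suc N * (1 + bcost b) + N * \<tau>) Q" using assms(1)
  proof (induction N arbitrary: s rule: less_induct)
    case (less N)
    show ?case
    proof (cases "bval b s")
      case True
      then obtain k where k: "N = Suc k" "runs c s \<tau> (I k)" using step less.prems by blast
      then obtain t1 s1 where 1: "exec c s t1 s1" "t1 \<le> \<tau>" "I k s1" by (auto simp: runs_def)
      obtain t2 s2 where 2: "exec (While b c) s1 t2 s2" "t2 \<le> Suc k * (1 + bcost b) + k * \<tau>" "Q s2"
        using less.IH[of k s1] k 1 by (auto simp: runs_def)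
      have "exec (While b c) s (1 + bcost b + t1 + t2) s2" using True 1(1) 2(1) by (rule exec.WhileTrue)
      moreover have "1 + bcost b + t1 + t2 \<le> Suc N * (1 + bcost b) + N * \<tau>"
        using 1 2 k by (simp add: algebra_simps)
      ultimately show ?thesis unfolding runs_def using 2(3) by blast
    next
      case False
      have "exec (While b c) s (1 + bcost b) s" using False by (rule exec.WhileFalse)
      moreover have "1 + bcost b \<le> Suc N * (1 + bcost b) + N * \<tau>" by simp
      ultimately show ?thesis unfolding runs_def using exit[OF less.prems False] by blast
    qed
  qed
  then show ?thesis using T by (rule runs_mono)
qed

section \<open>Frame conditions\<close>

fun iwrites :: "com \<Rightarrow> vname set" where
  "iwrites (IAssign x e) = {x}"
| "iwrites (Seq a b) = iwrites a \<union> iwrites b"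
| "iwrites (If b c1 c2) = iwrites c1 \<union> iwrites c2"
| "iwrites (While b c) = iwrites c"
| "iwrites _ = {}"

fun rwrites :: "com \<Rightarrow> vname set" where
  "rwrites (RAssign x e) = {x}"
| "rwrites (Seq a b) = rwrites a \<union> rwrites b"
| "rwrites (If b c1 c2) = rwrites c1 \<union> rwrites c2"
| "rwrites (While b c) = rwrites c"
| "rwrites _ = {}"

fun awrites :: "com \<Rightarrow> vname set" where
  "awrites (IStore a i e) = {a}"
| "awrites (Seq a b) = awrites a \<union> awrites b"
| "awrites (If b c1 c2) = awrites c1 \<union> awrites c2"
| "awrites (While b c) = awrites c"
| "awrites _ = {}"

text \<open>Written names are collected syntactically, so that preservation of everything else
  reduces to comparing strings and stays out of the invariants.\<close>

definition same :: "com \<Rightarrow> state \<Rightarrow> state \<Rightarrow> bool" where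
  "same c s s' \<longleftrightarrow> (\<forall>x. x \<notin> iwrites c \<longrightarrow> ivar s' x = ivar s x) \<and>
     (\<forall>x. x \<notin> rwrites c \<longrightarrow> rvar s' x = rvar s x) \<and> (\<forall>x. x \<notin> awrites c \<longrightarrow> iarr s' x = iarr s x)"

lemma exec_same: "exec c s t s' \<Longrightarrow> same c s s'"
  by (induction rule: exec.induct) (auto simp: same_def)

lemma runs_same: "runs c s T Q \<Longrightarrow> (\<And>s'. same c s s' \<Longrightarrow> Q s' \<Longrightarrow> Q' s') \<Longrightarrow> runs c s T Q'"
  unfolding runs_def using exec_same by blast

lemma same_refl [simp]: "same c s s" by (simp add: same_def)

text \<open>A loop test or branch condition cannot run commands, hence the probe is computed by
  \<open>pre\<close> and \<open>b\<close> only inspects its outcome.\<close>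

definition bsearch :: "vname \<Rightarrow> vname \<Rightarrow> vname \<Rightarrow> com \<Rightarrow> bexp \<Rightarrow> com" where
  "bsearch lo hi mid pre b = While (ILess (IVar lo) (IVar hi))
     (Seq (IAssign mid (IHalf (IAdd (IVar lo) (IVar hi))))
     (Seq pre
       (If b (IAssign lo (IAdd (IVar mid) (IConst 1))) (IAssign hi (IVar mid)))))"

text \<open>With \<open>k\<close> rounds left the interval satisfies \<open>h - l < 2 ^ k\<close>.
  The midpoint drops out of the interval after being probed, so the strict bound survives halving,
  and \<open>k = 0\<close> means that the interval is empty.\<close>

lemma bsearch_runs:
  fixes \<phi> :: "nat \<Rightarrow> bool"
  assumes dist: "lo \<noteq> hi" "lo \<noteq> mid" "hi \<noteq> mid" "{lo, hi, mid} \<inter> iwrites pre = {}"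
    and init: "ivar s lo = 0" "ivar s hi = int n" "n < 2 ^ L"
    and test: "\<And>s' x. same (bsearch lo hi mid pre b) s s' \<Longrightarrow> ivar s' mid = int x \<Longrightarrow> x < n \<Longrightarrow>
        runs pre s' \<tau> (\<lambda>s''. bval b s'' \<longleftrightarrow> \<phi> x)"
    and mono: "\<And>x y. x \<le> y \<Longrightarrow> y < n \<Longrightarrow> \<phi> y \<Longrightarrow> \<phi> x"
    and T: "4 + L * (\<tau> + bcost b + 15) \<le> T"
  shows "runs (bsearch lo hi mid pre b) s T (\<lambda>s'. same (bsearch lo hi mid pre b) s s' \<and>
     (\<exists>r\<le>n. ivar s' lo = int r \<and> (\<forall>x<r. \<phi> x) \<and> (\<forall>x. r \<le> x \<longrightarrow> x < n \<longrightarrow> \<not> \<phi> x)))"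
proof -
  let ?c = "bsearch lo hi mid pre b"
  let ?body = "Seq (IAssign mid (IHalf (IAdd (IVar lo) (IVar hi))))
     (Seq pre (If b (IAssign lo (IAdd (IVar mid) (IConst 1))) (IAssign hi (IVar mid))))"
  define I where "I k s' \<longleftrightarrow> same ?c s s' \<and> (\<exists>l h. l \<le> h \<and> h \<le> n \<and> h - l < 2 ^ k \<and> ivar s' lo = int l \<and> ivar s' hi = int h
     \<and> (\<forall>x<l. \<phi> x) \<and> (\<forall>x. h \<le> x \<longrightarrow> x < n \<longrightarrow> \<not> \<phi> x))" for k s'
  have w: "iwrites ?c = {lo, hi, mid} \<union> iwrites pre" "rwrites ?c = rwrites pre" "awrites ?c = awrites pre"
    by (auto simp: bsearch_def)
  show ?thesis unfolding bsearch_def[of lo hi mid pre b]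
  proof (rule runs_While[where I = I and N = L and \<tau> = "\<tau> + bcost b + 10"])
    show "I L s" using init by (auto simp: I_def intro!: exI[of _ 0] exI[of _ n])
  next
    fix k s'
    assume I: "I k s'" and "bval (ILess (IVar lo) (IVar hi)) s'"
    then obtain l h where lh: "l < h" "h \<le> n" "h - l < 2 ^ k" "ivar s' lo = int l" "ivar s' hi = int h"
      "\<forall>x<l. \<phi> x" "\<forall>x. h \<le> x \<longrightarrow> x < n \<longrightarrow> \<not> \<phi> x" by (auto simp: I_def)
    have sm: "same ?c s s'" using I by (simp add: I_def)
    obtain k' where k': "k = Suc k'" using lh by (cases k) auto
    define x where "x = (l + h) div 2"
    have x: "l \<le> x" "x < h" "x - l < 2 ^ k'" "h - Suc x < 2 ^ k'" using lh k' by (auto simp: x_def)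
    define s1 where "s1 = s'\<lparr>ivar := (ivar s')(mid := int x)\<rparr>"
    have s1: "same ?c s s1" "ivar s1 mid = int x" "ivar s1 lo = int l" "ivar s1 hi = int h"
      using sm w lh dist by (auto simp: same_def s1_def)
    have mid: "ival (IHalf (IAdd (IVar lo) (IVar hi))) s' = int x" using lh by (simp add: x_def zdiv_int)
    have "runs pre s1 \<tau> (\<lambda>s''. bval b s'' \<longleftrightarrow> \<phi> x)" using test[OF s1(1,2)] x lh by simp
    then have pre: "runs pre s1 \<tau> (\<lambda>s''. (bval b s'' \<longleftrightarrow> \<phi> x) \<and> same pre s1 s'')"
      by (rule runs_same) auto
    have "runs ?body s' (\<tau> + bcost b + 10) (I k')"
      unfolding runs_Seq_assign mid s1_def[symmetric]
    proof (intro conjI)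
      show "runs (Seq pre (If b (IAssign lo (IAdd (IVar mid) (IConst 1))) (IAssign hi (IVar mid)))) s1
        (\<tau> + bcost b + 10 - (1 + icost (IHalf (IAdd (IVar lo) (IVar hi))))) (I k')"
      proof (rule runs_Seq[OF pre, where ?T2.0 = "bcost b + 5"])
        fix s2 assume s2: "(bval b s2 \<longleftrightarrow> \<phi> x) \<and> same pre s1 s2"
        then have v: "ivar s2 mid = int x" "ivar s2 lo = int l" "ivar s2 hi = int h"
          using dist s1 by (auto simp: same_def)
        have sm2: "same ?c s s2" using s2 s1(1) w by (auto simp: same_def)
        have upd: "same ?c s (s2\<lparr>ivar := (ivar s2)(lo := i)\<rparr>)" "same ?c s (s2\<lparr>ivar := (ivar s2)(hi := i)\<rparr>)" for i
          using sm2 w by (auto simp: same_def)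
        show "runs (If b (IAssign lo (IAdd (IVar mid) (IConst 1))) (IAssign hi (IVar mid))) s2 (bcost b + 5) (I k')"
        proof (cases "\<phi> x")
          case True
          have "\<forall>y<Suc x. \<phi> y" using mono[of _ x] True x lh by (auto simp: less_Suc_eq_le)
          then have "I k' (s2\<lparr>ivar := (ivar s2)(lo := int x + 1)\<rparr>)"
            unfolding I_def using upd x lh v dist
            by (intro conjI exI[of _ "Suc x"] exI[of _ h]) auto
          then show ?thesis using True s2 v by simp
        next
          case False
          have "\<forall>y. x \<le> y \<longrightarrow> y < n \<longrightarrow> \<not> \<phi> y" using mono[of x] False by auto
          then have "I k' (s2\<lparr>ivar := (ivar s2)(hi := int x)\<rparr>)"
            unfolding I_def using upd x lh v dist
            by (intro conjI exI[of _ l] exI[of _ x]) auto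
          then show ?thesis using False s2 v by simp
        qed
      qed simp
    qed simp
    then show "\<exists>k'. k = Suc k' \<and> runs ?body s' (\<tau> + bcost b + 10) (I k')" using k' by blast
  next
    fix k s'
    assume I: "I k s'" and "\<not> bval (ILess (IVar lo) (IVar hi)) s'"
    then show "same (While (ILess (IVar lo) (IVar hi)) ?body) s s' \<and>
     (\<exists>r\<le>n. ivar s' lo = int r \<and> (\<forall>x<r. \<phi> x) \<and> (\<forall>x. r \<le> x \<longrightarrow> x < n \<longrightarrow> \<not> \<phi> x))"
      by (auto simp: I_def bsearch_def)
  next
    show "Suc L * (1 + bcost (ILess (IVar lo) (IVar hi))) + L * (\<tau> + bcost b + 10) \<le> T"
      using T by (simp add: algebra_simps)
  qed
qed

section \<open>Evaluating a centre\<close>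

notation IAssign (infix "::=" 62) and RAssign (infix ":::=" 62) and Seq (infixr ";;" 60)
  and IAdd (infixl "\<oplus>" 65) and ISub (infixl "\<ominus>" 65)

abbreviation rnum :: "int \<Rightarrow> rexp" where "rnum k \<equiv> ROfInt (IConst k)"

section \<open>The value of one candidate\<close>

definition window_prog :: com where
  "window_prog =
    ''lo'' ::= IConst 0;; ''hi'' ::= IVar ''n'' \<ominus> IVar ''k'';;
    bsearch ''lo'' ''hi'' ''mid'' Skip
      (ILess (IArr ''adj'' (IVar ''off'' \<oplus> IVar ''mid'') \<oplus>
              IArr ''adj'' (IVar ''off'' \<oplus> IVar ''mid'' \<oplus> IVar ''k''))
             (IVar ''ctr'' \<oplus> IVar ''ctr''))"

text \<open>\<open>q\<close> is the rank of the centre, and \<open>z\<close> is \<open>q\<close>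
  clamped to the window, as in \<open>window_cost\<close>. The machine does not multiply integers,
  so the product with the centre is formed in the reals.\<close>

definition cost_prog :: com where
  "cost_prog =
    ''r'' ::= IVar ''lo'' \<oplus> IVar ''k'';; ''z'' ::= IVar ''q'';;
    If (ILess (IVar ''z'') (IVar ''lo'')) (''z'' ::= IVar ''lo'') Skip;;
    If (ILess (IVar ''r'') (IVar ''z'')) (''z'' ::= IVar ''r'') Skip;;
    ''a'' :::= RAdd
      (ROfInt (IArr ''pre'' (IVar ''r'') \<oplus> IArr ''pre'' (IVar ''lo'')
               \<ominus> IArr ''pre'' (IVar ''z'') \<ominus> IArr ''pre'' (IVar ''z'')))
      (RMul (ROfInt (IVar ''ctr'')) (ROfInt (IVar ''z'' \<oplus> IVar ''z'' \<ominus> IVar ''lo'' \<ominus> IVar ''r'')))"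

text \<open>In the negative case the window sum is turned into a distance to 1 or - 1 by the
  formulas of \<open>minsum_neg_small\<close> and \<open>minsum_neg_large\<close>. Resetting a
  negative \<open>x\<close> to 0 imitates truncated subtraction of natural numbers.\<close>

definition value_prog :: "bool \<Rightarrow> com" where
  "value_prog neg =
    (if neg then
       If (ILess (IVar ''k'') (IVar ''k01''))
        (''x'' ::= IVar ''k'' \<oplus> IVar ''k0'' \<ominus> IVar ''k01'';;
         If (ILess (IVar ''x'') (IConst 0)) (''x'' ::= IConst 0) Skip;;
         ''a'' :::= ROfInt (IVar ''x''))
        (''a'' :::= RAdd (RVar ''a'') (ROfInt (IVar ''k0'' \<oplus> IVar ''k0'' \<ominus> IVar ''k'')))
     else Skip);;
    ''x'' ::= IVar ''k01'' \<ominus> IVar ''k'';;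
    If (ILess (IVar ''x'') (IConst 0)) (''x'' ::= IConst 0) Skip;;
    (if neg then
       ''f'' :::= RSub (RMul (RVar ''c'') (ROfInt (IVar ''k'')))
         (RMul (RAdd (rnum 1) (RMul (rnum 2) (RVar ''c''))) (ROfInt (IVar ''x'')))
     else
       ''f'' :::= RSub (RMul (RAdd (rnum 1) (RMul (rnum 2) (RVar ''c''))) (ROfInt (IVar ''k'')))
         (RMul (RVar ''c'') (ROfInt (IVar ''x''))));;
    ''f'' :::= RMul (RVar ''f'') (RExp (RMul (RSub (rnum 0) (RVar ''beta''))
                 (RAdd (ROfInt (IVar ''dd'')) (RVar ''a''))))"

definition cand_prog :: "bool \<Rightarrow> com" where
  "cand_prog neg = window_prog;; cost_prog;; value_prog neg"

lemma writes_cand_prog [simp]: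
  "iwrites window_prog = {''lo'', ''hi'', ''mid''}" "rwrites window_prog = {}" "awrites window_prog = {}"
  "iwrites (cand_prog neg) = {''lo'', ''hi'', ''mid'', ''r'', ''z'', ''x''}" "rwrites (cand_prog neg) = {''a'', ''f''}"
  "awrites (cand_prog neg) = {}"
  by (auto simp: cand_prog_def window_prog_def cost_prog_def value_prog_def bsearch_def)

text \<open>These facts are fixed for one edge; \<open>located\<close> adds those that depend on the
  centre but not on \<open>k\<close>.\<close>

definition ready :: "(nat \<Rightarrow> int) \<Rightarrow> nat \<Rightarrow> real \<Rightarrow> real \<Rightarrow> state \<Rightarrow> bool" where
  "ready b n \<beta> c s \<longleftrightarrow> ivar s ''n'' = int n \<and> rvar s ''beta'' = \<beta> \<and> rvar s ''c'' = c \<and>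
    (\<forall>x<n. iarr s ''adj'' (ivar s ''off'' + int x) = b x) \<and>
    (\<forall>x\<le>n. iarr s ''pre'' (int x) = (\<Sum>i<x. b i))"

definition located :: "(nat \<Rightarrow> int) \<Rightarrow> nat \<Rightarrow> int \<Rightarrow> state \<Rightarrow> bool" where
  "located b n p s \<longleftrightarrow> ivar s ''ctr'' = p \<and> ivar s ''dd'' = dd p \<and>
    ivar s ''k0'' = int (card (near b n p 0)) \<and> ivar s ''k01'' = int (card (near b n p 1)) \<and>
    (\<exists>q\<le>n. ivar s ''q'' = int q \<and> (\<forall>x<q. b x < p) \<and> (\<forall>x. q \<le> x \<longrightarrow> x < n \<longrightarrow> \<not> b x < p))"

lemma window_runs:
  assumes rdy: "ready b n \<beta> c s" and p: "ivar s ''ctr'' = p" and k: "ivar s ''k'' = int k" "k \<le> n"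
    and n: "n < 2 ^ L" and sorted: "\<And>i j. i \<le> j \<Longrightarrow> j < n \<Longrightarrow> b i \<le> b j"
  shows "runs window_prog s (20 + 40 * L) (\<lambda>s'. \<exists>l. l + k \<le> n \<and> ivar s' ''lo'' = int l \<and>
     (\<forall>i<l. b i + b (i + k) < 2 * p) \<and> (\<forall>i. l \<le> i \<longrightarrow> i < n - k \<longrightarrow> \<not> b i + b (i + k) < 2 * p))"
proof -
  define s1 where "s1 = s\<lparr>ivar := (ivar s)(''lo'' := 0, ''hi'' := int (n - k))\<rparr>"
  let ?b = "ILess (IArr ''adj'' (IVar ''off'' \<oplus> IVar ''mid'') \<oplus>
              IArr ''adj'' (IVar ''off'' \<oplus> IVar ''mid'' \<oplus> IVar ''k''))
             (IVar ''ctr'' \<oplus> IVar ''ctr'')"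
  have s1: "ival (IVar ''n'' \<ominus> IVar ''k'') s = int (n - k)"
    using rdy k by (simp add: ready_def of_nat_diff)
  have "runs (bsearch ''lo'' ''hi'' ''mid'' Skip ?b) s1 (4 + L * (1 + bcost ?b + 15))
    (\<lambda>s'. same (bsearch ''lo'' ''hi'' ''mid'' Skip ?b) s1 s' \<and> (\<exists>r\<le>n - k. ivar s' ''lo'' = int r \<and>
      (\<forall>x<r. b x + b (x + k) < 2 * p) \<and> (\<forall>x. r \<le> x \<longrightarrow> x < n - k \<longrightarrow> \<not> b x + b (x + k) < 2 * p)))"
  proof (rule bsearch_runs)
    fix s' x
    assume sm: "same (bsearch ''lo'' ''hi'' ''mid'' Skip ?b) s1 s'" and x: "ivar s' ''mid'' = int x" "x < n - k"
    have v: "ivar s' ''off'' = ivar s ''off''" "ivar s' ''ctr'' = p" "ivar s' ''k'' = int k" "iarr s' ''adj'' = iarr s ''adj''"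
      using sm p k by (simp_all add: same_def bsearch_def s1_def)
    have "iarr s ''adj'' (ivar s ''off'' + int x) = b x" "iarr s ''adj'' (ivar s ''off'' + int x + int k) = b (x + k)"
      using rdy x by (simp_all add: ready_def add.assoc flip: of_nat_add)
    then show "runs Skip s' 1 (\<lambda>s''. bval ?b s'' = (b x + b (x + k) < 2 * p))"
      using v x by simp
  next
    fix x y assume "x \<le> y" "y < n - k" "b y + b (y + k) < 2 * p"
    then show "b x + b (x + k) < 2 * p" using sorted[of x y] sorted[of "x + k" "y + k"] by linarith
  next
    show "n - k < 2 ^ L" using n by linarith
  qed (auto simp: s1_def)
  then have "runs (bsearch ''lo'' ''hi'' ''mid'' Skip ?b) s1 (13 + 40 * L) (\<lambda>s'. \<exists>l. l + k \<le> n \<and> ivar s' ''lo'' = int l \<and>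
     (\<forall>i<l. b i + b (i + k) < 2 * p) \<and> (\<forall>i. l \<le> i \<longrightarrow> i < n - k \<longrightarrow> \<not> b i + b (i + k) < 2 * p))"
    by (rule runs_mono) (use k in auto)
  then show ?thesis unfolding window_prog_def using s1
    by (auto simp: s1_def elim!: runs_mono)
qed

text \<open>Items left of \<open>z\<close> lie below \<open>p\<close> and the others do not, so the
  absolute values open with one sign on each side and prefix sums evaluate both sides.\<close>

lemma window_cost:
  assumes sorted: "\<And>i j. i \<le> j \<Longrightarrow> j < n \<Longrightarrow> b i \<le> b j" and r: "l + k \<le> n"
    and q: "\<forall>x<q. b x < p" "\<forall>x. q \<le> x \<longrightarrow> x < n \<longrightarrow> \<not> b x < p"
    and z: "z = min (max q l) (l + k)"
  shows "(\<Sum>x\<in>{l..<l+k}. \<bar>b x - p\<bar>) =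
    (\<Sum>i<l+k. b i) + (\<Sum>i<l. b i) - 2 * (\<Sum>i<z. b i) + p * (2 * int z - int l - int (l + k))"
proof -
  have lz: "l \<le> z" "z \<le> l + k" using z by auto
  have split: "(\<Sum>i<z. b i) = (\<Sum>i<l. b i) + (\<Sum>i\<in>{l..<z}. b i)"
    "(\<Sum>i<l+k. b i) = (\<Sum>i<z. b i) + (\<Sum>i\<in>{z..<l+k}. b i)"
    using lz by (simp_all add: lessThan_atLeast0 sum.atLeastLessThan_concat)
  have "(\<Sum>x\<in>{l..<l+k}. \<bar>b x - p\<bar>) = (\<Sum>x\<in>{l..<z}. \<bar>b x - p\<bar>) + (\<Sum>x\<in>{z..<l+k}. \<bar>b x - p\<bar>)"
    using lz by (simp add: sum.atLeastLessThan_concat)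
  also have "(\<Sum>x\<in>{l..<z}. \<bar>b x - p\<bar>) = (\<Sum>x\<in>{l..<z}. p - b x)"
  proof (rule sum.cong[OF refl])
    fix x assume "x \<in> {l..<z}"
    then have "x < q" using z by auto
    then show "\<bar>b x - p\<bar> = p - b x" using q(1) by fastforce
  qed
  also have "(\<Sum>x\<in>{z..<l+k}. \<bar>b x - p\<bar>) = (\<Sum>x\<in>{z..<l+k}. b x - p)"
  proof (rule sum.cong[OF refl])
    fix x assume "x \<in> {z..<l+k}"
    then have "q \<le> x" "x < n" using z r by auto
    then show "\<bar>b x - p\<bar> = b x - p" using q(2) by fastforce
  qed
  finally show ?thesis using lz unfolding split
    by (simp add: sum_subtractf of_nat_diff algebra_simps)
qed

lemma cost_runs:
  assumes rdy: "ready b n \<beta> c s" and loc: "located b n p s" and k: "ivar s ''k'' = int k"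
    and sorted: "\<And>i j. i \<le> j \<Longrightarrow> j < n \<Longrightarrow> b i \<le> b j"
    and l: "ivar s ''lo'' = int l" "l + k \<le> n"
  shows "runs cost_prog s 60 (\<lambda>s'. rvar s' ''a'' = real_of_int (\<Sum>x\<in>{l..<l+k}. \<bar>b x - p\<bar>))"
proof -
  obtain q where q: "ivar s ''q'' = int q" "\<forall>x<q. b x < p" "\<forall>x. q \<le> x \<longrightarrow> x < n \<longrightarrow> \<not> b x < p"
    and p: "ivar s ''ctr'' = p"
    using loc by (auto simp: located_def)
  have pre: "iarr s ''pre'' (int x) = (\<Sum>i<x. b i)" if "x \<le> n" for x using rdy that by (simp add: ready_def)
  define z where "z = min (max q l) (l + k)"
  define A P0 P1 P2 where "A = (\<Sum>x\<in>{l..<l+k}. \<bar>b x - p\<bar>)" and "P0 = (\<Sum>i<l. b i)"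
    and "P1 = (\<Sum>i<l+k. b i)" and "P2 = (\<Sum>i<z. b i)"
  have cost: "A = P1 + P0 - 2 * P2 + p * (2 * int z - int l - int (l + k))"
    unfolding A_def P0_def P1_def P2_def using sorted l(2) q(2,3) z_def by (rule window_cost)
  have "z \<le> l + k" by (simp add: z_def)
  then have pre': "iarr s ''pre'' (int l) = P0" "iarr s ''pre'' (int z) = P2"
     "iarr s ''pre'' (int l + int k) = P1"
    using l(2) pre by (auto simp: P0_def P1_def P2_def simp flip: of_nat_add)
  \<comment> \<open>The possible outcomes of the two clamping tests.\<close>
  consider "q < l" "z = l" | "l \<le> q" "q \<le> l + k" "z = q" | "l + k < q" "l \<le> q" "z = l + k"
    unfolding z_def by linarith
  then show ?thesis unfolding A_def[symmetric]
    by cases (use pre' in \<open>simp_all add: cost_prog_def l k q(1) p cost algebra_simps\<close>)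
qed

lemma value_runs:
  assumes rdy: "ready b n \<beta> c s" and loc: "located b n p s" and k: "ivar s ''k'' = int k"
    and W: "W \<subseteq> {..<n}" "card W = k"
    and near: "\<And>x y. x \<in> W \<Longrightarrow> y < n \<Longrightarrow> y \<notin> W \<Longrightarrow> \<bar>b x - p\<bar> \<le> \<bar>b y - p\<bar>"
    and a: "rvar s ''a'' = real_of_int (\<Sum>x\<in>W. \<bar>b x - p\<bar>)"
  shows "runs (value_prog neg) s 80 (\<lambda>s'. rvar s' ''f'' = cand neg \<beta> c b n p k)"
proof -
  define K where "K = card (near b n p 1)"
  define Z where "Z = card (near b n p 0)"
  have ZK: "Z \<le> K" unfolding Z_def K_def by (intro card_mono) (auto simp: near_def)
  have v: "ivar s ''k01'' = int K" "ivar s ''k0'' = int Z" "ivar s ''dd'' = dd p" "rvar s ''c'' = c" "rvar s ''beta'' = \<beta>"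
    using rdy loc by (simp_all add: ready_def located_def K_def Z_def)
  define A where "A = minsum (\<lambda>x. dist_of neg (b x - p)) n k"
  have cand: "cand neg \<beta> c b n p k = gain neg c K k * exp (- \<beta> * (dd p + A))"
    by (simp add: cand_def A_def K_def)
  define S where "S = (\<Sum>x\<in>W. \<bar>b x - p\<bar>)"
  have aS: "rvar s ''a'' = real_of_int S" using a by (simp only: S_def)
  have cost: "A = (if neg then if k < K then int (k + Z - K) else S - int k + 2 * int Z else S)"
    using minsum_neg_small[of k b n p] minsum_neg_large[OF W near] minsum_eqI[OF W near] ZK
    by (auto simp: A_def S_def dist_of_def K_def Z_def)
  have xx: "real (K - k) = (if int K - int k < 0 then 0 else real K - real k)"
    by (auto simp: of_nat_diff)
  have yy: "real (k + Z - K) = (if int k + int Z - int K < 0 then 0 else real k + real Z - real K)"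
    by (auto simp: of_nat_diff)
  show ?thesis
    by (cases neg; cases "k < K"; cases "int k + int Z - int K < 0")
      (use cand in \<open>simp_all add: value_prog_def runs_Seq_assoc v k aS cost gain_def xx yy algebra_simps\<close>)
qed

lemma cand_runs:
  assumes rdy: "ready b n \<beta> c s" and loc: "located b n p s" and k: "ivar s ''k'' = int k" "k \<le> n"
    and n: "n < 2 ^ L" and sorted: "\<And>i j. i \<le> j \<Longrightarrow> j < n \<Longrightarrow> b i \<le> b j"
  shows "runs (cand_prog neg) s (160 + 40 * L) (\<lambda>s'. rvar s' ''f'' = cand neg \<beta> c b n p k)"
  unfolding cand_prog_def
proof (rule runs_Seq[OF runs_same[OF window_runs[OF rdy _ k n sorted, where p = p]]])
  show "ivar s ''ctr'' = p" using loc by (simp add: located_def)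
next
  fix s1 s'
  assume "same window_prog s s'" and "\<exists>l. l + k \<le> n \<and> ivar s' ''lo'' = int l \<and>
     (\<forall>i<l. b i + b (i + k) < 2 * p) \<and> (\<forall>i. l \<le> i \<longrightarrow> i < n - k \<longrightarrow> \<not> b i + b (i + k) < 2 * p)"
  then show "ready b n \<beta> c s' \<and> located b n p s' \<and> ivar s' ''k'' = int k \<and> (\<exists>l. l + k \<le> n \<and> ivar s' ''lo'' = int l \<and>
     (\<forall>i<l. b i + b (i + k) < 2 * p) \<and> (\<forall>i. l \<le> i \<longrightarrow> i < n - k \<longrightarrow> \<not> b i + b (i + k) < 2 * p))"
    using rdy loc k by (simp add: same_def ready_def located_def)
next
  fix s1
  assume "ready b n \<beta> c s1 \<and> located b n p s1 \<and> ivar s1 ''k'' = int k \<and> (\<exists>l. l + k \<le> n \<and> ivar s1 ''lo'' = int l \<and>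
     (\<forall>i<l. b i + b (i + k) < 2 * p) \<and> (\<forall>i. l \<le> i \<longrightarrow> i < n - k \<longrightarrow> \<not> b i + b (i + k) < 2 * p))"
  then obtain l where 1: "ready b n \<beta> c s1" "located b n p s1" "ivar s1 ''k'' = int k"
    and l: "l + k \<le> n" "ivar s1 ''lo'' = int l" "\<And>i. i < l \<Longrightarrow> b i + b (i + k) < 2 * p"
      "\<And>i. l \<le> i \<Longrightarrow> i < n - k \<Longrightarrow> \<not> b i + b (i + k) < 2 * p" by blast
  show "runs (cost_prog;; value_prog neg) s1 140 (\<lambda>s'. rvar s' ''f'' = cand neg \<beta> c b n p k)"
  proof (rule runs_Seq[OF runs_same[OF cost_runs[OF 1 sorted l(2,1)]]])
    fix s2
    assume "same cost_prog s1 s2" "rvar s2 ''a'' = real_of_int (\<Sum>x\<in>{l..<l+k}. \<bar>b x - p\<bar>)"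
    then show "ready b n \<beta> c s2 \<and> located b n p s2 \<and> ivar s2 ''k'' = int k \<and>
      rvar s2 ''a'' = real_of_int (\<Sum>x\<in>{l..<l+k}. \<bar>b x - p\<bar>)"
      using 1 by (simp add: same_def ready_def located_def cost_prog_def)
  next
    fix s2
    assume "ready b n \<beta> c s2 \<and> located b n p s2 \<and> ivar s2 ''k'' = int k \<and>
      rvar s2 ''a'' = real_of_int (\<Sum>x\<in>{l..<l+k}. \<bar>b x - p\<bar>)"
    then show "runs (value_prog neg) s2 80 (\<lambda>s'. rvar s' ''f'' = cand neg \<beta> c b n p k)"
    proof (intro value_runs[where W = "{l..<l+k}"])
      fix x y assume "x \<in> {l..<l+k}" "y < n" "y \<notin> {l..<l+k}"
      with sorted l(1,3,4) show "\<bar>b x - p\<bar> \<le> \<bar>b y - p\<bar>" by (rule window_minsum(2))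
    qed (use l(1) in auto)
  qed (use sorted in auto)
qed (use sorted in auto)

section \<open>The best \<open>k\<close> for one centre and sign\<close>

definition search_prog :: "bool \<Rightarrow> com" where
  "search_prog neg =
    ''klo'' ::= IConst 0;; ''khi'' ::= IVar ''n'';;
    bsearch ''klo'' ''khi'' ''kmid''
      (''k'' ::= IVar ''kmid'';; cand_prog neg;; ''f0'' :::= RVar ''f'';;
       ''k'' ::= IVar ''kmid'' \<oplus> IConst 1;; cand_prog neg)
      (RLess (RVar ''f0'') (RVar ''f''));;
    ''k'' ::= IVar ''klo'';; cand_prog neg;;
    If (RLess (RVar ''out'') (RVar ''f'')) (''out'' :::= RVar ''f'') Skip"

lemma writes_search_prog [simp]:
  "iwrites (search_prog neg) = {''lo'', ''hi'', ''mid'', ''r'', ''z'', ''x'', ''klo'', ''khi'', ''kmid'', ''k''}"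
  "rwrites (search_prog neg) = {''a'', ''f'', ''f0'', ''out''}" "awrites (search_prog neg) = {}"
  by (auto simp: search_prog_def bsearch_def)

text \<open>At most \<open>L\<close> rounds with two evaluations of cost linear in \<open>L\<close>
  each: this is the source of the squared logarithm.\<close>

lemma search_runs:
  assumes rdy: "ready b n \<beta> c s" and loc: "located b n p s" and pos: "\<beta> > 0" "c > 0"
    and n: "n < 2 ^ L" and sorted: "\<And>i j. i \<le> j \<Longrightarrow> j < n \<Longrightarrow> b i \<le> b j"
  shows "runs (search_prog neg) s (400 * (L + 1)^2) (\<lambda>s'. \<exists>k\<le>n. (\<forall>i\<le>n. cand neg \<beta> c b n p i \<le> cand neg \<beta> c b n p k) \<and>
     rvar s' ''out'' = max (rvar s ''out'') (cand neg \<beta> c b n p k))"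
proof -
  define s1 where "s1 = s\<lparr>ivar := (ivar s)(''klo'' := 0, ''khi'' := int n)\<rparr>"
  let ?pre = "(''k'' ::= IVar ''kmid'';; cand_prog neg;; ''f0'' :::= RVar ''f'';;
       ''k'' ::= IVar ''kmid'' \<oplus> IConst 1;; cand_prog neg)"
  let ?b = "RLess (RVar ''f0'') (RVar ''f'')"
  let ?bs = "bsearch ''klo'' ''khi'' ''kmid'' ?pre ?b"
  let ?F = "cand neg \<beta> c b n p"
  let ?rest = "''k'' ::= IVar ''klo'';; cand_prog neg;;
    If (RLess (RVar ''out'') (RVar ''f'')) (''out'' :::= RVar ''f'') Skip"
  have keep: "ready b n \<beta> c s' \<and> located b n p s' \<and> rvar s' ''out'' = rvar s ''out''" if "same ?bs s1 s'" for s'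
    using that rdy loc by (simp add: same_def ready_def located_def bsearch_def s1_def)
  have bs: "runs ?bs s1 (4 + L * ((340 + 80 * L) + bcost ?b + 15)) (\<lambda>s'. same ?bs s1 s' \<and> (\<exists>r\<le>n. ivar s' ''klo'' = int r \<and>
      (\<forall>x<r. ?F x < ?F (Suc x)) \<and> (\<forall>x. r \<le> x \<longrightarrow> x < n \<longrightarrow> \<not> ?F x < ?F (Suc x))))"
  proof (rule bsearch_runs)
    fix s' x
    assume sm: "same ?bs s1 s'" and x: "ivar s' ''kmid'' = int x" "x < n"
    define s2 where "s2 = s'\<lparr>ivar := (ivar s')(''k'' := int x)\<rparr>"
    have s2: "ready b n \<beta> c s2" "located b n p s2" "ivar s2 ''k'' = int x" "ivar s2 ''kmid'' = int x"
      using keep[OF sm] x by (simp_all add: ready_def located_def s2_def)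
    have r1: "runs (cand_prog neg) s2 (160 + 40 * L) (\<lambda>s'. rvar s' ''f'' = ?F x)"
      using cand_runs[OF s2(1-3) _ n sorted] x by simp
    have "runs (cand_prog neg;; ''f0'' :::= RVar ''f'';;
       ''k'' ::= IVar ''kmid'' \<oplus> IConst 1;; cand_prog neg) s2 (330 + 80 * L) (\<lambda>s''. bval ?b s'' = (?F x < ?F (Suc x)))"
    proof (rule runs_Seq[OF runs_same[OF r1, where Q' = "\<lambda>s'. same (cand_prog neg) s2 s' \<and> rvar s' ''f'' = ?F x"], where ?T2.0 = "170 + 40 * L"])
      fix s3 assume s3: "same (cand_prog neg) s2 s3 \<and> rvar s3 ''f'' = ?F x"
      define s4 where "s4 = s3\<lparr>rvar := (rvar s3)(''f0'' := ?F x), ivar := (ivar s3)(''k'' := int (Suc x))\<rparr>"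
      have s4: "ready b n \<beta> c s4" "located b n p s4" "ivar s4 ''k'' = int (Suc x)" "rvar s4 ''f0'' = ?F x"
        using s2 s3 by (simp_all add: ready_def located_def s4_def same_def)
      have "runs (cand_prog neg) s4 (160 + 40 * L) (\<lambda>s'. rvar s' ''f'' = ?F (Suc x))"
        using cand_runs[OF s4(1-3) _ n sorted] x by simp
      then have "runs (cand_prog neg) s4 (160 + 40 * L) (\<lambda>s''. bval ?b s'' = (?F x < ?F (Suc x)))"
        by (rule runs_same) (use s4 in \<open>auto simp: same_def\<close>)
      moreover have "s3\<lparr>rvar := (rvar s3)(''f0'' := rvar s3 ''f''), ivar := (ivar s3)(''k'' := ivar s3 ''kmid'' + 1)\<rparr> = s4"
        using s3 s2 by (simp add: s4_def same_def add.commute)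
      ultimately show "runs (''f0'' :::= RVar ''f'';; ''k'' ::= IVar ''kmid'' \<oplus> IConst 1;; cand_prog neg) s3
        (170 + 40 * L) (\<lambda>s''. bval ?b s'' = (?F x < ?F (Suc x)))"
        by (auto elim!: runs_mono)
    qed auto
    then show "runs ?pre s' (340 + 80 * L) (\<lambda>s''. bval ?b s'' = (?F x < ?F (Suc x)))"
      using x by (auto simp: s2_def elim!: runs_mono)
  next
    fix x y assume "x \<le> y" "y < n" "?F y < ?F (Suc y)"
    then show "?F x < ?F (Suc x)" by (rule cand_rising_down_closed[OF pos])
  qed (use n in \<open>auto simp: s1_def\<close>)
  have "runs (?bs;; ?rest) s1 (4 + L * ((340 + 80 * L) + bcost ?b + 15) + (180 + 40 * L))
    (\<lambda>s'. \<exists>k\<le>n. (\<forall>i\<le>n. ?F i \<le> ?F k) \<and> rvar s' ''out'' = max (rvar s ''out'') (?F k))"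
  proof (rule runs_Seq[OF bs])
    fix s2
    assume s2: "same ?bs s1 s2 \<and> (\<exists>r\<le>n. ivar s2 ''klo'' = int r \<and>
      (\<forall>x<r. ?F x < ?F (Suc x)) \<and> (\<forall>x. r \<le> x \<longrightarrow> x < n \<longrightarrow> \<not> ?F x < ?F (Suc x)))"
    then obtain r where r: "r \<le> n" "ivar s2 ''klo'' = int r" and up: "\<And>x. x < r \<Longrightarrow> ?F x < ?F (Suc x)"
      and down: "\<And>x. r \<le> x \<Longrightarrow> x < n \<Longrightarrow> \<not> ?F x < ?F (Suc x)" by blast
    have opt: "\<forall>i\<le>n. ?F i \<le> ?F r" using cand_search_correct[OF pos r(1) up down] by blast
    define s3 where "s3 = s2\<lparr>ivar := (ivar s2)(''k'' := int r)\<rparr>"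
    have s3: "ready b n \<beta> c s3" "located b n p s3" "ivar s3 ''k'' = int r" "rvar s3 ''out'' = rvar s ''out''"
      using keep[of s2] s2 by (simp_all add: ready_def located_def s3_def)
    have "runs (cand_prog neg;; If (RLess (RVar ''out'') (RVar ''f'')) (''out'' :::= RVar ''f'') Skip) s3 (178 + 40 * L)
      (\<lambda>s'. \<exists>k\<le>n. (\<forall>i\<le>n. ?F i \<le> ?F k) \<and> rvar s' ''out'' = max (rvar s ''out'') (?F k))"
    proof (rule runs_Seq[OF runs_same[OF cand_runs[OF s3(1-3) r(1) n sorted, of neg], where Q' = "\<lambda>s'. same (cand_prog neg) s3 s' \<and> rvar s' ''f'' = ?F r"]])
      fix s4 assume s4: "same (cand_prog neg) s3 s4 \<and> rvar s4 ''f'' = ?F r"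
      then have "rvar s4 ''out'' = rvar s ''out''" using s3 by (simp add: same_def)
      then show "runs (If (RLess (RVar ''out'') (RVar ''f'')) (''out'' :::= RVar ''f'') Skip) s4 18
        (\<lambda>s'. \<exists>k\<le>n. (\<forall>i\<le>n. ?F i \<le> ?F k) \<and> rvar s' ''out'' = max (rvar s ''out'') (?F k))"
        using s4 r opt by (auto simp: max_def intro!: exI[of _ r])
    qed (use sorted in auto)
    then show "runs ?rest s2 (180 + 40 * L) (\<lambda>s'. \<exists>k\<le>n. (\<forall>i\<le>n. ?F i \<le> ?F k) \<and> rvar s' ''out'' = max (rvar s ''out'') (?F k))"
      using r by (auto simp: s3_def elim!: runs_mono)
  qed simp
  \<comment> \<open>The 4 units withheld pay for the two assignments in front of the search.\<close>
  then have "runs (?bs;; ?rest) s1 (400 * (L + 1)^2 - 4) (\<lambda>s'. \<exists>k\<le>n. (\<forall>i\<le>n. ?F i \<le> ?F k) \<and> rvar s' ''out'' = max (rvar s ''out'') (?F k))"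
    by (rule runs_mono) (simp_all add: power2_eq_square algebra_simps)
  moreover have "4 \<le> 400 * (L + 1)^2" by (simp add: power2_eq_square)
  ultimately show ?thesis unfolding search_prog_def using rdy
    by (simp add: s1_def ready_def numeral_eq_Suc)
qed

definition forloop :: "vname \<Rightarrow> iexp \<Rightarrow> com \<Rightarrow> com" where
  "forloop i e body = i ::= IConst 0;; While (ILess (IVar i) e) (body;; i ::= IVar i \<oplus> IConst 1)"

lemma writes_forloop [simp]:
  "iwrites (forloop i e body) = insert i (iwrites body)" "rwrites (forloop i e body) = rwrites body"
  "awrites (forloop i e body) = awrites body"
  by (auto simp: forloop_def)

lemma forloop_runs:
  assumes i: "i \<notin> iwrites body"
    and bound: "\<And>s'. same (forloop i e body) s s' \<Longrightarrow> ival e s' = int n"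
    and init: "J 0 (s\<lparr>ivar := (ivar s)(i := 0)\<rparr>)"
    and step: "\<And>k s'. k < n \<Longrightarrow> same (forloop i e body) s s' \<Longrightarrow> ivar s' i = int k \<Longrightarrow> J k s' \<Longrightarrow>
      runs body s' \<tau> (\<lambda>s''. J (Suc k) (s''\<lparr>ivar := (ivar s'')(i := int (Suc k))\<rparr>))"
    and T: "10 + icost e + n * (\<tau> + 10 + icost e) \<le> T"
  shows "runs (forloop i e body) s T (\<lambda>s'. J n s')"
proof -
  let ?f = "forloop i e body"
  define s1 where "s1 = s\<lparr>ivar := (ivar s)(i := 0)\<rparr>"
  define I where "I r s' \<longleftrightarrow> same ?f s s' \<and> (\<exists>k\<le>n. r = n - k \<and> ivar s' i = int k \<and> J k s')" for r s'
  have "runs (While (ILess (IVar i) e) (body;; i ::= IVar i \<oplus> IConst 1)) s1 (8 + icost e + n * (\<tau> + 10 + icost e)) (J n)"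
  proof (rule runs_While[where I = I and N = n and \<tau> = "\<tau> + 5"])
    show "I n s1" using init by (auto simp: I_def s1_def same_def intro!: exI[of _ 0])
  next
    fix r s' assume I: "I r s'" and b: "bval (ILess (IVar i) e) s'"
    then obtain k where k: "k < n" "r = n - k" "ivar s' i = int k" "J k s'" "same ?f s s'"
      using bound by (auto simp: I_def)
    have "runs (body;; i ::= IVar i \<oplus> IConst 1) s' (\<tau> + 5) (I (n - Suc k))"
    proof (rule runs_Seq[OF runs_same[OF step[OF k(1,5,3,4)], where
          Q' = "\<lambda>s''. same body s' s'' \<and> J (Suc k) (s''\<lparr>ivar := (ivar s'')(i := int (Suc k))\<rparr>)"]])
      fix s2 assume s2: "same body s' s2 \<and> J (Suc k) (s2\<lparr>ivar := (ivar s2)(i := int (Suc k))\<rparr>)"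
      have "ivar s2 i = int k" using s2 k i by (simp add: same_def)
      moreover have "same ?f s (s2\<lparr>ivar := (ivar s2)(i := int (Suc k))\<rparr>)"
        using s2 k(5) by (auto simp: same_def)
      ultimately show "runs (i ::= IVar i \<oplus> IConst 1) s2 5 (I (n - Suc k))"
        using s2 k(1) by (simp add: I_def add.commute) (intro exI[of _ "Suc k"], simp add: add.commute)
    qed simp_all
    moreover have "r = Suc (n - Suc k)" using k by simp
    ultimately show "\<exists>k'. r = Suc k' \<and> runs (body;; i ::= IVar i \<oplus> IConst 1) s' (\<tau> + 5) (I k')" by blast
  next
    fix r s' assume "I r s'" "\<not> bval (ILess (IVar i) e) s'"
    then obtain k where "k \<le> n" "ivar s' i = int k" "J k s'" "ival e s' \<le> int k" "ival e s' = int n"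
      using bound by (auto simp: I_def)
    then have "k = n" by simp
    then show "J n s'" using \<open>J k s'\<close> by simp
  qed (simp add: algebra_simps)
  then show ?thesis using T by (auto simp: forloop_def s1_def elim!: runs_mono)
qed

section \<open>Ranks and counts at a centre\<close>

definition rank_prog :: "int \<Rightarrow> vname \<Rightarrow> com" where
  "rank_prog j res = ''lo'' ::= IConst 0;; ''hi'' ::= IVar ''n'';;
    bsearch ''lo'' ''hi'' ''mid'' Skip
      (ILess (IArr ''adj'' (IVar ''off'' \<oplus> IVar ''mid'')) (IVar ''ctr'' \<oplus> IConst j));;
    res ::= IVar ''lo''"

definition is_rank :: "(nat \<Rightarrow> int) \<Rightarrow> nat \<Rightarrow> int \<Rightarrow> nat \<Rightarrow> bool" where
  "is_rank b n t q \<longleftrightarrow> q \<le> n \<and> (\<forall>x<q. b x < t) \<and> (\<forall>x. q \<le> x \<longrightarrow> x < n \<longrightarrow> \<not> b x < t)"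

lemma writes_rank_prog [simp]:
  "iwrites (rank_prog j res) = {''lo'', ''hi'', ''mid'', res}" "rwrites (rank_prog j res) = {}" "awrites (rank_prog j res) = {}"
  by (auto simp: rank_prog_def bsearch_def)

lemma rank_runs:
  assumes rdy: "ready b n \<beta> c s" and p: "ivar s ''ctr'' = p"
    and n: "n < 2 ^ L" and sorted: "\<And>i j. i \<le> j \<Longrightarrow> j < n \<Longrightarrow> b i \<le> b j"
  shows "runs (rank_prog j res) s (20 + 40 * L) (\<lambda>s'. \<exists>q. ivar s' res = int q \<and> is_rank b n (p + j) q)"
proof -
  define s1 where "s1 = s\<lparr>ivar := (ivar s)(''lo'' := 0, ''hi'' := int n)\<rparr>"
  let ?b = "ILess (IArr ''adj'' (IVar ''off'' \<oplus> IVar ''mid'')) (IVar ''ctr'' \<oplus> IConst j)"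
  have "runs (bsearch ''lo'' ''hi'' ''mid'' Skip ?b) s1 (4 + L * (1 + bcost ?b + 15))
    (\<lambda>s'. same (bsearch ''lo'' ''hi'' ''mid'' Skip ?b) s1 s' \<and> (\<exists>r\<le>n. ivar s' ''lo'' = int r \<and>
      (\<forall>x<r. b x < p + j) \<and> (\<forall>x. r \<le> x \<longrightarrow> x < n \<longrightarrow> \<not> b x < p + j)))"
  proof (rule bsearch_runs)
    fix s' x
    assume sm: "same (bsearch ''lo'' ''hi'' ''mid'' Skip ?b) s1 s'" and x: "ivar s' ''mid'' = int x" "x < n"
    have v: "ivar s' ''off'' = ivar s ''off''" "ivar s' ''ctr'' = p" "iarr s' ''adj'' = iarr s ''adj''"
      using sm p by (simp_all add: same_def bsearch_def s1_def)
    have "iarr s ''adj'' (ivar s ''off'' + int x) = b x" using rdy x by (simp add: ready_def)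
    then show "runs Skip s' 1 (\<lambda>s''. bval ?b s'' = (b x < p + j))" using v x by simp
  next
    fix x y assume "x \<le> y" "y < n" "b y < p + j"
    then show "b x < p + j" using sorted[of x y] by linarith
  qed (use n in \<open>auto simp: s1_def\<close>)
  then have "runs (bsearch ''lo'' ''hi'' ''mid'' Skip ?b;; res ::= IVar ''lo'') s1 (8 + 40 * L)
    (\<lambda>s'. \<exists>q. ivar s' res = int q \<and> is_rank b n (p + j) q)"
    by (rule runs_Seq[where ?T2.0 = 2]) (auto simp: is_rank_def)
  then show ?thesis unfolding rank_prog_def using rdy
    by (auto simp: s1_def ready_def elim!: runs_mono)
qed

text \<open>For integers, \<open>b x\<close> is within \<open>r\<close> of \<open>p\<close> iff
  \<open>p - r \<le> b x\<close> and \<open>b x < p + r + 1\<close>. Both counts are therefore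
  differences of ranks, taken at \<open>p - 1\<close>, \<open>p\<close>, \<open>p + 1\<close> and
  \<open>p + 2\<close>; the rank at \<open>p\<close> also serves \<open>cost_prog\<close>.\<close>

definition locate_prog :: com where
  "locate_prog = rank_prog (- 1) ''y1'';; rank_prog 0 ''q'';; rank_prog 1 ''y3'';; rank_prog 2 ''y4'';;
    ''k0'' ::= IVar ''y3'' \<ominus> IVar ''q'';; ''k01'' ::= IVar ''y4'' \<ominus> IVar ''y1'';;
    If (ILess (IVar ''ctr'') (IConst 0)) (''dd'' ::= IConst (- 1) \<ominus> IVar ''ctr'') (''dd'' ::= IVar ''ctr'')"

lemma writes_locate_prog [simp]:
  "iwrites locate_prog = {''lo'', ''hi'', ''mid'', ''y1'', ''q'', ''y3'', ''y4'', ''k0'', ''k01'', ''dd''}"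
  "rwrites locate_prog = {}" "awrites locate_prog = {}"
  by (auto simp: locate_prog_def)

lemma card_near:
  assumes "is_rank b n (p - r) q" "is_rank b n (p + r + 1) q'" "0 \<le> r"
  shows "int (card (near b n p r)) = int q' - int q"
proof -
  have "q \<le> q'"
  proof (rule ccontr)
    assume "\<not> q \<le> q'"
    then have "b q' < p - r" "\<not> b q' < p + r + 1" using assms unfolding is_rank_def by (auto dest: order.strict_trans2)
    then show False using assms(3) by linarith
  qed
  moreover have "near b n p r = {q..<q'}"
  proof (rule set_eqI)
    fix x
    show "x \<in> near b n p r \<longleftrightarrow> x \<in> {q..<q'}"
    proof (cases "x < n")
      case True
      have "b x < p - r \<longleftrightarrow> x < q" "b x < p + r + 1 \<longleftrightarrow> x < q'"
        using assms(1,2) True unfolding is_rank_def by (meson leI)+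
      then show ?thesis using True by (auto simp: near_def abs_le_iff not_less)
    qed (use assms(2) in \<open>auto simp: near_def is_rank_def\<close>)
  qed
  ultimately show ?thesis by (simp add: of_nat_diff)
qed

lemma locate_runs:
  assumes rdy: "ready b n \<beta> c s" and p: "ivar s ''ctr'' = p"
    and n: "n < 2 ^ L" and sorted: "\<And>i j. i \<le> j \<Longrightarrow> j < n \<Longrightarrow> b i \<le> b j"
  shows "runs locate_prog s (120 + 160 * L) (\<lambda>s'. located b n p s')"
proof -
  let ?tail = "''k0'' ::= IVar ''y3'' \<ominus> IVar ''q'';; ''k01'' ::= IVar ''y4'' \<ominus> IVar ''y1'';;
    If (ILess (IVar ''ctr'') (IConst 0)) (''dd'' ::= IConst (- 1) \<ominus> IVar ''ctr'') (''dd'' ::= IVar ''ctr'')"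
  define R where "R s' \<longleftrightarrow> ready b n \<beta> c s' \<and> ivar s' ''ctr'' = p" for s'
  have step: "runs (rank_prog j res;; rest) s' T Q"
    if "R s'" "res \<notin> {''n'', ''ctr'', ''off''}"
      "\<And>s'' q. same (rank_prog j res) s' s'' \<Longrightarrow> R s'' \<Longrightarrow> ivar s'' res = int q \<Longrightarrow> is_rank b n (p + j) q \<Longrightarrow> runs rest s'' T' Q"
      "20 + 40 * L + T' \<le> T"
    for s' j res rest T T' Q
  proof (rule runs_Seq[OF runs_same[OF rank_runs[where b = b and n = n and \<beta> = \<beta> and c = c and s = s' and p = p and j = j and res = res, OF _ _ n sorted]], where ?T2.0 = T'])
    show "ready b n \<beta> c s'" "ivar s' ''ctr'' = p" using that(1) by (auto simp: R_def)
    fix s2 assume "same (rank_prog j res) s' s2" "\<exists>q. ivar s2 res = int q \<and> is_rank b n (p + j) q"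
    moreover have "''n'' \<noteq> res" "''ctr'' \<noteq> res" "''off'' \<noteq> res" using that(2) by auto
    moreover from calculation have "R s2" using that(1) by (simp add: R_def ready_def same_def)
    ultimately show "same (rank_prog j res) s' s2 \<and> R s2 \<and> (\<exists>q. ivar s2 res = int q \<and> is_rank b n (p + j) q)" by blast
  qed (use that sorted in auto)
  have "R s" using rdy p by (simp add: R_def)
  then show ?thesis unfolding locate_prog_def
  proof (rule step[where T' = "100 + 120 * L"], goal_cases)
    case (2 s1 q1)
    note f1 = 2
    from f1(2) show ?case
    proof (rule step[where T' = "80 + 80 * L"], goal_cases)
      case (2 s2 q2)
      note f2 = 2
      from f2(2) show ?case
      proof (rule step[where T' = "60 + 40 * L"], goal_cases)
        case (2 s3 q3)
        note f3 = 2
        from f3(2) show ?case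
        proof (rule step[where T' = 40], goal_cases)
          case (2 s4 q4)
          note f4 = 2
          have v: "ivar s4 ''y1'' = int q1" "ivar s4 ''q'' = int q2" "ivar s4 ''y3'' = int q3" "ivar s4 ''y4'' = int q4"
            "ivar s4 ''ctr'' = p"
            using f1(1,3) f2(1,3) f3(1,3) f4(1,2,3) by (simp_all add: same_def R_def)
          have "int (card (near b n p 0)) = int q3 - int q2" "int (card (near b n p 1)) = int q4 - int q1"
            using f1(4) f2(4) f3(4) f4(4) card_near[of b n p 0 q2 q3] card_near[of b n p 1 q1 q4] by (simp_all add: add.assoc)
          then show ?case using v f2(4) by (auto simp: located_def is_rank_def dd_def)
        qed simp_all
      qed simp_all
    qed simp_all
  qed simp_all
qed

section \<open>The maximum over all candidates of one edge\<close>

text \<open>\<open>r'\<close> is the greatest element of \<open>insert r X\<close>. In this form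
  successive updates of a running maximum compose by taking unions.\<close>

definition maximised :: "real set \<Rightarrow> real \<Rightarrow> real \<Rightarrow> bool" where
  "maximised X r r' \<longleftrightarrow> r \<le> r' \<and> (r' = r \<or> r' \<in> X) \<and> (\<forall>v\<in>X. v \<le> r')"

lemma maximised_Un: "maximised X r r' \<Longrightarrow> maximised Y r' r'' \<Longrightarrow> maximised (X \<union> Y) r r''"
  unfolding maximised_def by fastforce

lemma maximised_empty [simp]: "maximised {} r r' \<longleftrightarrow> r' = r"
  by (auto simp: maximised_def)

definition cands :: "real \<Rightarrow> real \<Rightarrow> (nat \<Rightarrow> int) \<Rightarrow> nat \<Rightarrow> int \<Rightarrow> real set" where
  "cands \<beta> c b n p = (\<Union>neg. cand neg \<beta> c b n p ` {..n})"

definition centre_prog :: com where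
  "centre_prog = locate_prog;; search_prog False;; search_prog True"

lemma writes_centre_prog [simp]:
  "iwrites centre_prog = {''lo'', ''hi'', ''mid'', ''y1'', ''q'', ''y3'', ''y4'', ''k0'', ''k01'', ''dd'',
     ''r'', ''z'', ''x'', ''klo'', ''khi'', ''kmid'', ''k''}"
  "rwrites centre_prog = {''a'', ''f'', ''f0'', ''out''}" "awrites centre_prog = {}"
  by (auto simp: centre_prog_def)

lemma centre_runs:
  assumes rdy: "ready b n \<beta> c s" and p: "ivar s ''ctr'' = p" and pos: "\<beta> > 0" "c > 0"
    and n: "n < 2 ^ L" and sorted: "\<And>i j. i \<le> j \<Longrightarrow> j < n \<Longrightarrow> b i \<le> b j"
  shows "runs centre_prog s (1000 * (L + 1)^2) (\<lambda>s'. maximised (cands \<beta> c b n p) (rvar s ''out'') (rvar s' ''out''))"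
  unfolding centre_prog_def
proof (rule runs_Seq[OF runs_same[OF locate_runs[OF rdy p n sorted]]])
  fix s' assume "same locate_prog s s'" "located b n p s'"
  then show "ready b n \<beta> c s' \<and> located b n p s' \<and> rvar s' ''out'' = rvar s ''out''"
    using rdy by (simp add: ready_def same_def)
next
  fix s1 assume s1: "ready b n \<beta> c s1 \<and> located b n p s1 \<and> rvar s1 ''out'' = rvar s ''out''"
  let ?X = "\<lambda>neg. cand neg \<beta> c b n p ` {..n}"
  have search: "runs (search_prog neg) s' (400 * (L + 1)^2) (\<lambda>s''. ready b n \<beta> c s'' \<and> located b n p s'' \<and>
    maximised (?X neg) (rvar s' ''out'') (rvar s'' ''out''))" if "ready b n \<beta> c s'" "located b n p s'" for s' neg
  proof (rule runs_same[OF search_runs[OF that pos n sorted]])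
    fix s'' assume sm: "same (search_prog neg) s' s''"
      and "\<exists>k\<le>n. (\<forall>i\<le>n. cand neg \<beta> c b n p i \<le> cand neg \<beta> c b n p k) \<and>
     rvar s'' ''out'' = max (rvar s' ''out'') (cand neg \<beta> c b n p k)"
    then have "maximised (?X neg) (rvar s' ''out'') (rvar s'' ''out'')"
      unfolding maximised_def by (force simp: max_def)
    moreover have "ready b n \<beta> c s''" "located b n p s''"
      using that sm by (simp_all add: ready_def located_def same_def)
    ultimately show "ready b n \<beta> c s'' \<and> located b n p s'' \<and> maximised (?X neg) (rvar s' ''out'') (rvar s'' ''out'')"
      by blast
  qed (use sorted in auto)
  have "ready b n \<beta> c s1" "located b n p s1" using s1 by auto
  note first = search[OF this, of False]
  show "runs (search_prog False;; search_prog True) s1 (800 * (L + 1)^2)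
    (\<lambda>s'. maximised (cands \<beta> c b n p) (rvar s ''out'') (rvar s' ''out''))"
  proof (rule runs_Seq[OF first, where ?T2.0 = "400 * (L + 1)^2"])
    fix s2 assume s2: "ready b n \<beta> c s2 \<and> located b n p s2 \<and> maximised (?X False) (rvar s1 ''out'') (rvar s2 ''out'')"
    have X: "cands \<beta> c b n p = ?X False \<union> ?X True" by (simp only: cands_def UNIV_bool UN_insert UN_empty Un_empty_right)
    have "ready b n \<beta> c s2" "located b n p s2" using s2 by auto
    then have "runs (search_prog True) s2 (400 * (L + 1)^2) (\<lambda>s''. ready b n \<beta> c s'' \<and> located b n p s'' \<and>
      maximised (?X True) (rvar s2 ''out'') (rvar s'' ''out''))" by (rule search)
    then show "runs (search_prog True) s2 (400 * (L + 1)^2) (\<lambda>s'. maximised (cands \<beta> c b n p) (rvar s ''out'') (rvar s' ''out''))"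
      by (rule runs_same) (use s1 s2 in \<open>auto simp: X intro: maximised_Un\<close>)
  qed simp
next
  show "120 + 160 * L + 800 * (L + 1)\<^sup>2 \<le> 1000 * (L + 1)\<^sup>2"
    by (simp add: power2_eq_square algebra_simps)
qed (use sorted in auto)

text \<open>The extra round \<open>i = n\<close> supplies the value 0 in \<open>centres\<close>, and
  \<open>j - 2\<close> for \<open>j < 5\<close> runs through the offsets from - 2 to 2.\<close>

definition vertex_prog :: com where
  "vertex_prog =
    ''off'' ::= IArr ''base'' (IVar ''u'');; ''n'' ::= IArr ''cnt'' (IVar ''u'');;
    IStore ''pre'' (IConst 0) (IConst 0);;
    forloop ''i'' (IVar ''n'') (IStore ''pre'' (IVar ''i'' \<oplus> IConst 1)
      (IArr ''pre'' (IVar ''i'') \<oplus> IArr ''adj'' (IVar ''off'' \<oplus> IVar ''i'')));;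
    forloop ''i'' (IVar ''n'' \<oplus> IConst 1)
     (If (ILess (IVar ''i'') (IVar ''n''))
        (''cc'' ::= IArr ''adj'' (IVar ''off'' \<oplus> IVar ''i'')) (''cc'' ::= IConst 0);;
      forloop ''j'' (IConst 5) (''ctr'' ::= IVar ''cc'' \<oplus> IVar ''j'' \<ominus> IConst 2;; centre_prog))"

lemma writes_vertex_prog [simp]:
  "iwrites vertex_prog = {''lo'', ''hi'', ''mid'', ''y1'', ''q'', ''y3'', ''y4'', ''k0'', ''k01'', ''dd'',
     ''r'', ''z'', ''x'', ''klo'', ''khi'', ''kmid'', ''k'', ''off'', ''n'', ''i'', ''j'', ''cc'', ''ctr''}"
  "rwrites vertex_prog = {''a'', ''f'', ''f0'', ''out''}" "awrites vertex_prog = {''pre''}"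
  by (auto simp: vertex_prog_def)

lemma vertex_runs:
  assumes v: "rvar s ''beta'' = \<beta>" "rvar s ''c'' = c" "iarr s ''base'' (ivar s ''u'') = off" "iarr s ''cnt'' (ivar s ''u'') = int n"
    and adj: "\<And>x. x < n \<Longrightarrow> iarr s ''adj'' (off + int x) = b x" and pos: "\<beta> > 0" "c > 0"
    and n: "n < 2 ^ L" and sorted: "\<And>i j. i \<le> j \<Longrightarrow> j < n \<Longrightarrow> b i \<le> b j"
  shows "runs vertex_prog s ((n + 1) * (6000 * (L + 1)^2))
    (\<lambda>s'. maximised (\<Union>p\<in>centres b n. cands \<beta> c b n p) (rvar s ''out'') (rvar s' ''out''))"
proof -
  let ?pre = "forloop ''i'' (IVar ''n'') (IStore ''pre'' (IVar ''i'' \<oplus> IConst 1)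
      (IArr ''pre'' (IVar ''i'') \<oplus> IArr ''adj'' (IVar ''off'' \<oplus> IVar ''i'')))"
  let ?inner = "forloop ''j'' (IConst 5) (''ctr'' ::= IVar ''cc'' \<oplus> IVar ''j'' \<ominus> IConst 2;; centre_prog)"
  let ?main = "forloop ''i'' (IVar ''n'' \<oplus> IConst 1)
     (If (ILess (IVar ''i'') (IVar ''n''))
        (''cc'' ::= IArr ''adj'' (IVar ''off'' \<oplus> IVar ''i'')) (''cc'' ::= IConst 0);; ?inner)"
  define M where "M = (L + 1)^2"
  let ?c = "cands \<beta> c b n"
  have L1: "1 \<le> M" by (simp add: M_def power2_eq_square)
  define s1 where "s1 = s\<lparr>ivar := (ivar s)(''off'' := off, ''n'' := int n), iarr := (iarr s)(''pre'' := (iarr s ''pre'')(0 := 0))\<rparr>"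
  have pre: "runs ?pre s1 (11 + n * 23) (\<lambda>s'. \<forall>x\<le>n. iarr s' ''pre'' (int x) = (\<Sum>i<x. b i))"
  proof (rule forloop_runs[where J = "\<lambda>k s'. \<forall>x\<le>k. iarr s' ''pre'' (int x) = (\<Sum>i<x. b i)" and \<tau> = 12])
    fix k s' assume k: "k < n" "same ?pre s1 s'" "ivar s' ''i'' = int k" "\<forall>x\<le>k. iarr s' ''pre'' (int x) = (\<Sum>i<x. b i)"
    have "iarr s' ''adj'' (ivar s' ''off'' + int k) = b k" using k adj by (simp add: same_def s1_def)
    then show "runs (IStore ''pre'' (IVar ''i'' \<oplus> IConst 1)
      (IArr ''pre'' (IVar ''i'') \<oplus> IArr ''adj'' (IVar ''off'' \<oplus> IVar ''i''))) s' 12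
      (\<lambda>s''. \<forall>x\<le>Suc k. iarr (s''\<lparr>ivar := (ivar s'')(''i'' := int (Suc k))\<rparr>) ''pre'' (int x) = (\<Sum>i<x. b i))"
      using k by (auto simp: le_Suc_eq)
  qed (auto simp: s1_def same_def)
  have inner: "runs ?inner s' (5500 * M) (\<lambda>s''. maximised (\<Union>p\<in>{y - 2..<y + 3}. ?c p) (rvar s' ''out'') (rvar s'' ''out''))"
    if s': "ready b n \<beta> c s'" "ivar s' ''cc'' = y" for s' y
  proof -
    define X where "X k = (\<Union>p\<in>{y - 2..<y - 2 + int k}. ?c p)" for k
    have "runs ?inner s' (5500 * M) (\<lambda>s''. maximised (X 5) (rvar s' ''out'') (rvar s'' ''out''))"
    proof (rule forloop_runs[where J = "\<lambda>k s''. maximised (X k) (rvar s' ''out'') (rvar s'' ''out'')" and \<tau> = "10 + 1000 * M"])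
      fix k s2 assume k: "k < 5" "same ?inner s' s2" "ivar s2 ''j'' = int k" "maximised (X k) (rvar s' ''out'') (rvar s2 ''out'')"
      define s3 where "s3 = s2\<lparr>ivar := (ivar s2)(''ctr'' := y + int k - 2)\<rparr>"
      have s3: "ready b n \<beta> c s3" "ivar s3 ''ctr'' = y + int k - 2" "rvar s3 ''out'' = rvar s2 ''out''"
        using s' k by (simp_all add: ready_def same_def s3_def)
      have cc: "ivar s2 ''cc'' = y" using k s' by (simp add: same_def)
      have "X (Suc k) = X k \<union> ?c (y + int k - 2)"
      proof -
        have "{y - 2..<y - 2 + int (Suc k)} = insert (y + int k - 2) {y - 2..<y - 2 + int k}" by auto
        then show ?thesis by (auto simp: X_def)
      qed
      then have "runs centre_prog s3 (1000 * M) (\<lambda>s''. maximised (X (Suc k)) (rvar s' ''out'') (rvar s'' ''out''))"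
        using k(4) s3(3) by (intro runs_mono[OF centre_runs[OF s3(1,2) pos n sorted, folded M_def]]) (auto intro: maximised_Un)
      then show "runs (''ctr'' ::= IVar ''cc'' \<oplus> IVar ''j'' \<ominus> IConst 2;; centre_prog) s2 (10 + 1000 * M)
        (\<lambda>s''. maximised (X (Suc k)) (rvar s' ''out'') (rvar (s''\<lparr>ivar := (ivar s'')(''j'' := int (Suc k))\<rparr>) ''out''))"
        using cc k by (auto simp: s3_def elim!: runs_mono)
    qed (use L1 in \<open>auto simp: X_def\<close>)
    moreover have "y - 2 + int 5 = y + 3" by simp
    ultimately show ?thesis by (simp only: X_def)
  qed
  define X where "X k = (\<Union>x<k. \<Union>p\<in>{(if x < n then b x else 0) - 2..<(if x < n then b x else 0) + 3}. ?c p)" for k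
  have main: "runs ?main s2 ((n + 1) * (5600 * M) + 20) (\<lambda>s'. maximised (X (Suc n)) (rvar s2 ''out'') (rvar s' ''out''))"
    if s2: "ready b n \<beta> c s2" for s2
  proof (rule forloop_runs[where J = "\<lambda>k s'. maximised (X k) (rvar s2 ''out'') (rvar s' ''out'')" and \<tau> = "20 + 5500 * M"])
    fix k s3 assume k: "k < Suc n" "same ?main s2 s3" "ivar s3 ''i'' = int k" "maximised (X k) (rvar s2 ''out'') (rvar s3 ''out'')"
    define y where "y = (if k < n then b k else 0)"
    define s4 where "s4 = s3\<lparr>ivar := (ivar s3)(''cc'' := y)\<rparr>"
    have s3: "ready b n \<beta> c s3" using s2 k by (simp add: ready_def same_def)
    have s4: "ready b n \<beta> c s4" "ivar s4 ''cc'' = y" "rvar s4 ''out'' = rvar s3 ''out''"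
      using s3 by (simp_all add: ready_def s4_def)
    have "X (Suc k) = X k \<union> (\<Union>p\<in>{y - 2..<y + 3}. ?c p)"
      by (simp only: X_def lessThan_Suc UN_insert y_def Un_commute)
    then have "runs ?inner s4 (5500 * M) (\<lambda>s''. maximised (X (Suc k)) (rvar s2 ''out'') (rvar s'' ''out''))"
      using k(4) s4(3) by (intro runs_mono[OF inner[OF s4(1,2)]]) (auto intro: maximised_Un)
    then show "runs (If (ILess (IVar ''i'') (IVar ''n''))
        (''cc'' ::= IArr ''adj'' (IVar ''off'' \<oplus> IVar ''i'')) (''cc'' ::= IConst 0);; ?inner) s3 (20 + 5500 * M)
        (\<lambda>s''. maximised (X (Suc k)) (rvar s2 ''out'') (rvar (s''\<lparr>ivar := (ivar s'')(''i'' := int (Suc k))\<rparr>) ''out''))"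
      using s3 k by (cases "k < n") (auto simp: s4_def y_def ready_def elim!: runs_mono)
  next
    fix s' assume "same ?main s2 s'"
    then show "ival (IVar ''n'' \<oplus> IConst 1) s' = int (Suc n)" using s2 by (simp add: ready_def same_def)
  next
    \<comment> \<open>As \<open>M\<close> is at least 1, constant overhead per round is absorbed
      into a multiple of \<open>M\<close>.\<close>
    have "Suc n * 33 \<le> Suc n * (33 * M)" using L1 by (intro mult_left_mono) auto
    then show "10 + icost (IVar ''n'' \<oplus> IConst 1) + Suc n * (20 + 5500 * M + 10 + icost (IVar ''n'' \<oplus> IConst 1)) \<le> (n + 1) * (5600 * M) + 20"
      by (simp add: algebra_simps)
  qed (auto simp: X_def)
  have Xc: "X (Suc n) = (\<Union>p\<in>centres b n. ?c p)"
  proof -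
    have "(\<Union>x<Suc n. {(if x < n then b x else 0) - 2..<(if x < n then b x else 0) + 3}) = centres b n" (is "?A = _")
    proof (intro equalityI subsetI)
      fix p assume "p \<in> ?A"
      then obtain x where x: "x < Suc n" "p \<in> {(if x < n then b x else 0) - 2..<(if x < n then b x else 0) + 3}" by blast
      define y where "y = (if x < n then b x else 0)"
      have "y \<in> insert 0 (b ` {..<n})" "p - y \<in> {-2..2}" "p = y + (p - y)" using x by (auto simp: y_def)
      then show "p \<in> centres b n" unfolding centres_def by blast
    next
      fix p assume "p \<in> centres b n"
      then obtain y j where yj: "p = y + j" "y \<in> insert 0 (b ` {..<n})" "j \<in> {-2..2}" by (auto simp: centres_def)
      have "\<exists>x<Suc n. y = (if x < n then b x else 0)"
      proof (cases "y = 0")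
        case False
        then show ?thesis using yj(2) by (auto intro: less_SucI)
      qed auto
      then obtain x where "x < Suc n" "y = (if x < n then b x else 0)" by blast
      then show "p \<in> ?A" using yj by (intro UN_I[of x]) auto
    qed
    then show ?thesis unfolding X_def by blast
  qed
  have "runs (?pre;; ?main) s1 ((n + 1) * (5600 * M) + 20 + (11 + n * 23))
     (\<lambda>s'. maximised (X (Suc n)) (rvar s ''out'') (rvar s' ''out''))"
  proof (rule runs_Seq[OF runs_same[OF pre, where Q' = "\<lambda>s'. ready b n \<beta> c s' \<and> rvar s' ''out'' = rvar s ''out''"]])
    fix s' assume "same ?pre s1 s'" "\<forall>x\<le>n. iarr s' ''pre'' (int x) = (\<Sum>i<x. b i)"
    then show "ready b n \<beta> c s' \<and> rvar s' ''out'' = rvar s ''out''"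
      using v adj by (simp add: ready_def same_def s1_def)
  next
    fix s' assume "ready b n \<beta> c s' \<and> rvar s' ''out'' = rvar s ''out''"
    then show "runs ?main s' ((n + 1) * (5600 * M) + 20) (\<lambda>s'. maximised (X (Suc n)) (rvar s ''out'') (rvar s' ''out''))"
      using main[of s'] by simp
  qed simp
  moreover define T1 T2 where "T1 = (n + 1) * (5600 * M) + 20 + (11 + n * 23)" and "T2 = (n + 1) * (6000 * M)"
  moreover have "(n + 1) * (5600 * M) + 20 + (11 + n * 23) + 20 \<le> (n + 1) * (6000 * M)"
  proof -
    have "Suc n * 60 \<le> Suc n * (60 * M)" using L1 by (intro mult_left_mono) auto
    then show ?thesis by (simp add: algebra_simps)
  qed
  ultimately have *: "runs (?pre;; ?main) s1 T1 (\<lambda>s'. maximised (X (Suc n)) (rvar s ''out'') (rvar s' ''out''))"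
    "T1 + 20 \<le> T2" by simp_all
  then show ?thesis unfolding vertex_prog_def Xc[symmetric] M_def[symmetric] T2_def[symmetric] using v
    by (auto simp: s1_def elim!: runs_mono)
qed

section \<open>Distributing the triangles in sorted order\<close>

text \<open>
  The tournament tree has the nodes \<open>1, \<dots>, 2m - 1\<close>, the children of \<open>j\<close> being \<open>2j\<close> and \<open>2j + 1\<close> and
  the leaf of item \<open>t\<close> being \<open>m + t\<close>.  Node \<open>j\<close> stores the winner \<open>W j\<close>; winners are located below
  their node, hence raising one key affects only one path.
\<close>

definition anc :: "nat \<Rightarrow> nat \<Rightarrow> nat \<Rightarrow> bool" where
  "anc m j t \<longleftrightarrow> (\<exists>k. (m + t) div 2 ^ k = j)"

text \<open>Only the nodes from \<open>lo\<close> on are filled in, which describes the tree during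
  its bottom-up construction; the finished tree has \<open>lo = 1\<close>.\<close>

definition tree_inv :: "nat \<Rightarrow> nat \<Rightarrow> (nat \<Rightarrow> nat) \<Rightarrow> state \<Rightarrow> bool" where
  "tree_inv m lo W s \<longleftrightarrow> (\<forall>j. lo \<le> j \<longrightarrow> j < 2 * m \<longrightarrow>
     iarr s ''tree'' (int j) = int (W j) \<and> W j < m \<and> anc m j (W j))"

definition wins :: "(nat \<Rightarrow> int) \<Rightarrow> (nat \<Rightarrow> nat) \<Rightarrow> nat \<Rightarrow> bool" where
  "wins K W j \<longleftrightarrow> K (W j) \<le> K (W (2 * j)) \<and> K (W j) \<le> K (W (Suc (2 * j)))"

definition play :: "(nat \<Rightarrow> int) \<Rightarrow> (nat \<Rightarrow> nat) \<Rightarrow> nat \<Rightarrow> nat \<Rightarrow> nat" where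
  "play K W i = W(i := if K (W (Suc (2 * i))) < K (W (2 * i)) then W (Suc (2 * i)) else W (2 * i))"

definition play_prog :: com where
  "play_prog = If (ILess (IArr ''key'' (IArr ''tree'' (IVar ''i'' \<oplus> IVar ''i'' \<oplus> IConst 1)))
                        (IArr ''key'' (IArr ''tree'' (IVar ''i'' \<oplus> IVar ''i''))))
     (IStore ''tree'' (IVar ''i'') (IArr ''tree'' (IVar ''i'' \<oplus> IVar ''i'' \<oplus> IConst 1)))
     (IStore ''tree'' (IVar ''i'') (IArr ''tree'' (IVar ''i'' \<oplus> IVar ''i'')))"

lemma writes_play_prog [simp]:
  "iwrites play_prog = {}" "rwrites play_prog = {}" "awrites play_prog = {''tree''}"
  by (auto simp: play_prog_def)

lemma anc_parent: "anc m (2 * i) t \<Longrightarrow> anc m i t" "anc m (Suc (2 * i)) t \<Longrightarrow> anc m i t"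
proof -
  have *: "anc m (a div 2) t" if a: "anc m a t" for a
  proof -
    obtain k where "(m + t) div 2 ^ k = a" using a by (auto simp: anc_def)
    then have "(m + t) div 2 ^ Suc k = a div 2" by (simp only: power_Suc2 div_mult2_eq)
    then show ?thesis unfolding anc_def by blast
  qed
  from *[of "2 * i"] *[of "Suc (2 * i)"] show "anc m (2 * i) t \<Longrightarrow> anc m i t" "anc m (Suc (2 * i)) t \<Longrightarrow> anc m i t"
    by simp_all
qed

text \<open>A proper ancestor of a leaf has a number at most \<open>(m + t') div 2 < m\<close>, so
  it is never a leaf. This works for every \<open>m\<close>, not just for powers of two.\<close>

lemma anc_leaf:
  assumes "anc m (m + t) t'" "t < m" "t' < m" shows "t' = t"
proof -
  obtain k where k: "(m + t') div 2 ^ k = m + t" using assms by (auto simp: anc_def)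
  show ?thesis
  proof (cases k)
    case (Suc k')
    have "(m + t') div 2 ^ k \<le> (m + t') div 2" unfolding Suc power_Suc div_mult2_eq by (rule div_le_dividend)
    then show ?thesis using k assms by simp
  qed (use k in simp)
qed

lemma play_runs:
  assumes T: "tree_inv m lo W s" and K: "\<And>t. t < m \<Longrightarrow> iarr s ''key'' (int t) = K t"
    and i: "ivar s ''i'' = int i" "1 \<le> i" "i < m" "lo \<le> Suc i"
  shows "runs play_prog s 25 (tree_inv m (min lo i) (play K W i))"
proof -
  have ch: "iarr s ''tree'' (int (2 * i)) = int (W (2 * i)) \<and> W (2 * i) < m \<and> anc m (2 * i) (W (2 * i))"
    "iarr s ''tree'' (int (Suc (2 * i))) = int (W (Suc (2 * i))) \<and> W (Suc (2 * i)) < m \<and> anc m (Suc (2 * i)) (W (Suc (2 * i)))"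
    using T[unfolded tree_inv_def, rule_format, of "2 * i"] T[unfolded tree_inv_def, rule_format, of "Suc (2 * i)"] i
    by auto
  have e: "int i + int i = int (2 * i)" "int i + int i + 1 = int (Suc (2 * i))" by simp_all
  define v where "v = (if K (W (Suc (2 * i))) < K (W (2 * i)) then W (Suc (2 * i)) else W (2 * i))"
  have v: "v < m" "anc m i v" using ch anc_parent(1)[of m i "W (2 * i)"] anc_parent(2)[of m i "W (Suc (2 * i))"]
    by (simp_all add: v_def)
  have "tree_inv m (min lo i) (play K W i) (s\<lparr>iarr := (iarr s)(''tree'' := (iarr s ''tree'')(int i := int v))\<rparr>)"
    unfolding tree_inv_def
  proof (intro allI impI)
    fix j assume j: "min lo i \<le> j" "j < 2 * m"
    show "iarr (s\<lparr>iarr := (iarr s)(''tree'' := (iarr s ''tree'')(int i := int v))\<rparr>) ''tree'' (int j) = int (play K W i j)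
      \<and> play K W i j < m \<and> anc m j (play K W i j)"
    proof (cases "j = i")
      case True
      then show ?thesis using v by (simp add: play_def v_def)
    next
      case False
      then have "lo \<le> j" using j i(4) by linarith
      then show ?thesis using False T j by (simp add: tree_inv_def play_def)
    qed
  qed
  moreover have tr: "iarr s ''tree'' (int i + int i) = int (W (2 * i))" "iarr s ''tree'' (int i + int i + 1) = int (W (Suc (2 * i)))"
    using ch by (simp_all add: add.commute)
  moreover have "iarr s ''key'' (int (W (2 * i))) = K (W (2 * i))" "iarr s ''key'' (int (W (Suc (2 * i)))) = K (W (Suc (2 * i)))"
    using ch K by simp_all
  ultimately show ?thesis
    unfolding play_prog_def by (cases "K (W (Suc (2 * i))) < K (W (2 * i))") (simp_all add: v_def i(1))
qed

lemma wins_play_same: "1 \<le> i \<Longrightarrow> wins K (play K W i) i"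
  by (auto simp: wins_def play_def)

text \<open>A change of \<open>W i\<close> can only be noticed at \<open>i\<close> and at its
  parent.\<close>

lemma wins_play_other:
  assumes "wins K W j" "j \<noteq> i" "j \<noteq> i div 2"
  shows "wins K (play K W i) j"
proof -
  have "2 * j \<noteq> i" "Suc (2 * j) \<noteq> i" using assms(3) by auto
  then show ?thesis using assms by (simp add: wins_def play_def)
qed

text \<open>Keys of winners do not increase on the way from a leaf to the root, and the leaf of
  \<open>t\<close> can only be won by \<open>t\<close>.\<close>

lemma root_minimal:
  assumes "tree_inv m 1 W s" "\<And>j. 1 \<le> j \<Longrightarrow> j < m \<Longrightarrow> wins K W j" "t < m"
  shows "K (W 1) \<le> K t"
proof -
  have *: "1 \<le> j \<Longrightarrow> j < 2 * m \<Longrightarrow> K (W 1) \<le> K (W j)" for j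
  proof (induction j rule: less_induct)
    case (less j)
    show ?case
    proof (cases "j = 1")
      case False
      then have j2: "1 \<le> j div 2" "j div 2 < j" "j div 2 < m" using less.prems by auto
      then have "K (W 1) \<le> K (W (j div 2))" using less by simp
      also have "\<dots> \<le> K (W j)"
      proof (cases "even j")
        case True
        then show ?thesis using assms(2)[OF j2(1,3)] by (simp add: wins_def)
      next
        case False
        then show ?thesis using assms(2)[OF j2(1,3)] by (simp add: wins_def odd_two_times_div_two_succ)
      qed
      finally show ?thesis .
    qed simp
  qed
  have "W (m + t) < m" "anc m (m + t) (W (m + t))" using assms(1,3) by (auto simp: tree_inv_def)
  then have "W (m + t) = t" using anc_leaf assms(3) by blast
  then show ?thesis using *[of "m + t"] assms(3) by simp
qed

definition build_prog :: com where
  "build_prog = ''i'' ::= IVar ''m'' \<ominus> IConst 1;;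
     While (ILess (IConst 0) (IVar ''i'')) (play_prog;; ''i'' ::= IVar ''i'' \<ominus> IConst 1)"

lemma writes_build_prog [simp]:
  "iwrites build_prog = {''i''}" "rwrites build_prog = {}" "awrites build_prog = {''tree''}"
  by (auto simp: build_prog_def)

lemma build_runs:
  assumes m: "ivar s ''m'' = int m" and K: "\<And>t. t < m \<Longrightarrow> iarr s ''key'' (int t) = K t"
    and leaves: "\<And>t. t < m \<Longrightarrow> iarr s ''tree'' (int (m + t)) = int t"
  shows "runs build_prog s (20 + m * 50) (\<lambda>s'. \<exists>W. tree_inv m 1 W s' \<and> (\<forall>j. 1 \<le> j \<longrightarrow> j < m \<longrightarrow> wins K W j))"
proof -
  let ?body = "play_prog;; ''i'' ::= IVar ''i'' \<ominus> IConst 1"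
  define s1 where "s1 = s\<lparr>ivar := (ivar s)(''i'' := int m - 1)\<rparr>"
  \<comment> \<open>For \<open>m = 0\<close> the counter starts at - 1, whereas the index
    \<open>r\<close> is the natural number 0.\<close>
  define I where "I r s' \<longleftrightarrow> iarr s' ''key'' = iarr s ''key'' \<and> ivar s' ''i'' = int r - (if m = 0 then 1 else 0) \<and> r \<le> m - 1 \<and>
    (\<exists>W. tree_inv m (Suc r) W s' \<and> (\<forall>j. r < j \<longrightarrow> j < m \<longrightarrow> wins K W j))" for r s'
  have "runs (While (ILess (IConst 0) (IVar ''i'')) ?body) s1 (12 + m * 50)
    (\<lambda>s'. \<exists>W. tree_inv m 1 W s' \<and> (\<forall>j. 1 \<le> j \<longrightarrow> j < m \<longrightarrow> wins K W j))"
  proof (rule runs_While[where I = I and N = "m - 1" and \<tau> = 30])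
    have "tree_inv m (Suc (m - 1)) (\<lambda>j. j - m) s1"
      unfolding tree_inv_def
    proof (intro allI impI)
      fix j assume j: "Suc (m - 1) \<le> j" "j < 2 * m"
      then have "j - m < m" "m + (j - m) = j" by auto
      then show "iarr s1 ''tree'' (int j) = int (j - m) \<and> j - m < m \<and> anc m j (j - m)"
        using leaves[of "j - m"] unfolding anc_def by (auto simp: s1_def intro!: exI[of _ 0])
    qed
    then show "I (m - 1) s1" unfolding I_def by (auto simp: s1_def of_nat_diff intro!: exI[of _ "\<lambda>j. j - m"])
  next
    fix r s' assume I: "I r s'" and "bval (ILess (IConst 0) (IVar ''i'')) s'"
    then obtain W where r: "1 \<le> r" "r < m" "ivar s' ''i'' = int r" "iarr s' ''key'' = iarr s ''key''"
      and W: "tree_inv m (Suc r) W s'" "\<forall>j. r < j \<longrightarrow> j < m \<longrightarrow> wins K W j"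
      by (auto simp: I_def split: if_splits)
    have "runs play_prog s' 25 (tree_inv m (min (Suc r) r) (play K W r))"
      using r K by (intro play_runs[OF W(1)]) auto
    then have "runs ?body s' 30 (I (r - 1))"
    proof (rule runs_Seq[OF runs_same, where ?T2.0 = 5 and ?Q1.0 = "\<lambda>s''. same play_prog s' s'' \<and> tree_inv m r (play K W r) s''"])
      fix s2 assume s2: "same play_prog s' s2 \<and> tree_inv m r (play K W r) s2"
      then have v: "ivar s2 ''i'' = int r" "iarr s2 ''key'' = iarr s ''key''" "tree_inv m r (play K W r) s2"
        using r by (simp_all add: same_def)
      have "wins K (play K W r) j" if "r - 1 < j" "j < m" for j
      proof (cases "j = r")
        case False
        then show ?thesis using that W r by (intro wins_play_other) auto
      qed (use r wins_play_same in auto)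
      moreover have "tree_inv m (Suc (r - 1)) (play K W r) (s2\<lparr>ivar := (ivar s2)(''i'' := int r - 1)\<rparr>)"
        using v r by (simp add: tree_inv_def)
      ultimately have "I (r - 1) (s2\<lparr>ivar := (ivar s2)(''i'' := int r - 1)\<rparr>)"
        unfolding I_def using v r by (auto simp: of_nat_diff)
      then show "runs (''i'' ::= IVar ''i'' \<ominus> IConst 1) s2 5 (I (r - 1))" using v by simp
    qed auto
    moreover have "r = Suc (r - 1)" using r by simp
    ultimately show "\<exists>k'. r = Suc k' \<and> runs ?body s' 30 (I k')" by blast
  next
    fix r s' assume I: "I r s'" and b: "\<not> bval (ILess (IConst 0) (IVar ''i'')) s'"
    then have "m = 0 \<or> r = 0" by (auto simp: I_def split: if_splits)
    then show "\<exists>W. tree_inv m 1 W s' \<and> (\<forall>j. 1 \<le> j \<longrightarrow> j < m \<longrightarrow> wins K W j)"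
      using I by (auto simp: I_def tree_inv_def)
  qed simp
  then show ?thesis unfolding build_prog_def using m by (auto simp: s1_def elim!: runs_mono)
qed

definition replay_prog :: com where
  "replay_prog = While (ILess (IConst 0) (IVar ''i'')) (play_prog;; ''i'' ::= IHalf (IVar ''i''))"

lemma writes_replay_prog [simp]:
  "iwrites replay_prog = {''i''}" "rwrites replay_prog = {}" "awrites replay_prog = {''tree''}"
  by (auto simp: replay_prog_def)

text \<open>Only nodes on the path from \<open>i\<close> to the root may violate
  \<open>wins\<close>. Replaying \<open>i\<close> repairs it and can at most harm its parent, which
  is the next node on the path.\<close>

lemma replay_runs:
  assumes K: "\<And>t. t < m \<Longrightarrow> iarr s ''key'' (int t) = K t"
    and W: "tree_inv m 1 W s" and i: "ivar s ''i'' = int i" "i < m" "i < 2 ^ L"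
    and wins: "\<And>j. 1 \<le> j \<Longrightarrow> j < m \<Longrightarrow> wins K W j \<or> (\<exists>k. i div 2 ^ k = j)"
  shows "runs replay_prog s (10 + L * 50) (\<lambda>s'. \<exists>W. tree_inv m 1 W s' \<and> (\<forall>j. 1 \<le> j \<longrightarrow> j < m \<longrightarrow> wins K W j))"
proof -
  let ?body = "play_prog;; ''i'' ::= IHalf (IVar ''i'')"
  define I where "I r s' \<longleftrightarrow> iarr s' ''key'' = iarr s ''key'' \<and> (\<exists>i W. ivar s' ''i'' = int i \<and> i < m \<and> i < 2 ^ r \<and>
    tree_inv m 1 W s' \<and> (\<forall>j. 1 \<le> j \<longrightarrow> j < m \<longrightarrow> wins K W j \<or> (\<exists>k. i div 2 ^ k = j)))" for r s'
  show ?thesis unfolding replay_prog_def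
  proof (rule runs_While[where I = I and N = L and \<tau> = 35])
    show "I L s" unfolding I_def using W i wins by blast
  next
    fix r s' assume I: "I r s'" and b: "bval (ILess (IConst 0) (IVar ''i'')) s'"
    then obtain i W where i: "ivar s' ''i'' = int i" "i < m" "i < 2 ^ r" "1 \<le> i" "iarr s' ''key'' = iarr s ''key''"
      and W: "tree_inv m 1 W s'" "\<And>j. 1 \<le> j \<Longrightarrow> j < m \<Longrightarrow> wins K W j \<or> (\<exists>k. i div 2 ^ k = j)"
      by (auto simp: I_def)
    obtain r' where r': "r = Suc r'" using i by (cases r) auto
    have "runs play_prog s' 25 (tree_inv m (min 1 i) (play K W i))"
      using i K by (intro play_runs[OF W(1)]) auto
    then have "runs ?body s' 35 (I r')"
    proof (rule runs_Seq[OF runs_same, where ?T2.0 = 5 and ?Q1.0 = "\<lambda>s''. same play_prog s' s'' \<and> tree_inv m 1 (play K W i) s''"])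
      fix s2 assume s2: "same play_prog s' s2 \<and> tree_inv m 1 (play K W i) s2"
      then have v: "ivar s2 ''i'' = int i" "iarr s2 ''key'' = iarr s ''key''" "tree_inv m 1 (play K W i) s2"
        using i by (simp_all add: same_def)
      define s3 where "s3 = s2\<lparr>ivar := (ivar s2)(''i'' := int (i div 2))\<rparr>"
      have "wins K (play K W i) j \<or> (\<exists>k. i div 2 div 2 ^ k = j)" if j: "1 \<le> j" "j < m" for j
      proof (cases "j = i \<or> j = i div 2")
        case True
        moreover have "\<exists>k. i div 2 div 2 ^ k = i div 2" by (rule exI[of _ 0]) simp
        ultimately show ?thesis using wins_play_same[OF i(4)] by auto
      next
        case False
        from W(2)[OF j] show ?thesis
        proof
          assume "\<exists>k. i div 2 ^ k = j"
          then obtain k where k: "i div 2 ^ k = j" by blast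
          then obtain k' where "k = Suc k'" using False by (cases k) auto
          then have "i div 2 div 2 ^ k' = j" using k by (simp only: power_Suc div_mult2_eq)
          then show ?thesis by blast
        qed (use False wins_play_other in blast)
      qed
      moreover have "tree_inv m 1 (play K W i) s3" using v by (simp add: tree_inv_def s3_def)
      moreover have "i div 2 < m" "i div 2 < 2 ^ r'" using i r' by auto
      moreover have "ivar s3 ''i'' = int (i div 2)" "iarr s3 ''key'' = iarr s ''key''" using v by (simp_all add: s3_def)
      ultimately have "I r' s3" unfolding I_def by blast
      then show "runs (''i'' ::= IHalf (IVar ''i'')) s2 5 (I r')" using v by (simp add: s3_def zdiv_int)
    qed (use i in auto)
    then show "\<exists>k'. r = Suc k' \<and> runs ?body s' 35 (I k')" using r' by blast
  next
    fix r s' assume I: "I r s'" and b: "\<not> bval (ILess (IConst 0) (IVar ''i'')) s'"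
    then obtain W where W: "tree_inv m 1 W s'" "\<And>j. 1 \<le> j \<Longrightarrow> j < m \<Longrightarrow> wins K W j \<or> (\<exists>k. 0 div 2 ^ k = j)"
      by (auto simp: I_def)
    then show "\<exists>W. tree_inv m 1 W s' \<and> (\<forall>j. 1 \<le> j \<longrightarrow> j < m \<longrightarrow> wins K W j)" by force
  qed simp
qed

section \<open>Buckets of triangle weights, one per edge\<close>

text \<open>Bucket \<open>u\<close> owns the \<open>d\<close> slots of \<open>adj\<close> that start
  at \<open>u * d\<close>. A block of this length suffices by \<open>degree_bound\<close>.\<close>

definition content :: "nat \<Rightarrow> (nat \<Rightarrow> int list) \<Rightarrow> state \<Rightarrow> bool" where
  "content d C s \<longleftrightarrow> (\<forall>u<d. iarr s ''cnt'' (int u) = int (length (C u)) \<and> length (C u) \<le> d \<and>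
     (\<forall>x<length (C u). iarr s ''adj'' (int (u * d) + int x) = C u ! x))"

definition append_prog :: "vname \<Rightarrow> com" where
  "append_prog a = ''j'' ::= IArr a (IVar ''t'');;
     IStore ''adj'' (IArr ''base'' (IVar ''j'') \<oplus> IArr ''cnt'' (IVar ''j'')) (IVar ''b'');;
     IStore ''cnt'' (IVar ''j'') (IArr ''cnt'' (IVar ''j'') \<oplus> IConst 1)"

lemma writes_append_prog [simp]:
  "iwrites (append_prog a) = {''j''}" "rwrites (append_prog a) = {}" "awrites (append_prog a) = {''adj'', ''cnt''}"
  by (auto simp: append_prog_def)

lemma slot_disjoint:
  fixes d u v x y :: nat
  assumes "x < d" "y < d" "int (u * d) + int x = int (v * d) + int y"
  shows "u = v \<and> x = y"
proof -
  have "u * d + x = v * d + y" using assms(3) by (simp flip: of_nat_add of_nat_mult)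
  then have "(u * d + x) div d = (v * d + y) div d" "(u * d + x) mod d = (v * d + y) mod d" by auto
  then show ?thesis using assms(1,2) by simp
qed

lemma append_runs:
  assumes C: "content d C s" and v: "iarr s a (ivar s ''t'') = int v" "v < d" "length (C v) < d"
    and base: "iarr s ''base'' (int v) = int (v * d)" and b: "ivar s ''b'' = y"
  shows "runs (append_prog a) s 30 (content d (C(v := C v @ [y])))"
proof -
  have cnt: "iarr s ''cnt'' (int v) = int (length (C v))" using C v by (simp add: content_def)
  define p where "p = int (v * d) + int (length (C v))"
  define s1 where "s1 = s\<lparr>ivar := (ivar s)(''j'' := int v), iarr := (iarr s)(''adj'' := (iarr s ''adj'')(p := y),
     ''cnt'' := (iarr s ''cnt'')(int v := int (length (C v)) + 1))\<rparr>"
  have slot: "u = v \<and> x = length (C v)" if "x < length (C u)" "u < d" "int (u * d) + int x = p" for u x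
  proof (rule slot_disjoint)
    show "x < d" using that C by (auto simp: content_def intro: order.strict_trans2)
  qed (use that v in \<open>auto simp: p_def\<close>)
  have "content d (C(v := C v @ [y])) s1"
    unfolding content_def
  proof (intro allI impI conjI)
    fix u x assume u: "u < d" and x: "x < length ((C(v := C v @ [y])) u)"
    show "iarr s1 ''adj'' (int (u * d) + int x) = (C(v := C v @ [y])) u ! x"
    proof (cases "u = v \<and> x = length (C v)")
      case True
      then show ?thesis by (simp add: s1_def p_def)
    next
      case False
      then have x': "x < length (C u)" using x by (auto split: if_splits)
      then have "int (u * d) + int x \<noteq> p" using slot[OF x' u] False by auto
      then have "iarr s1 ''adj'' (int (u * d) + int x) = C u ! x"
        using C u x' by (simp add: s1_def content_def)
      then show ?thesis using x' by (auto simp: nth_append)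
    qed
  qed (use C v in \<open>auto simp: content_def s1_def\<close>)
  then show ?thesis using v(1) base b cnt by (simp add: append_prog_def s1_def p_def)
qed

text \<open>Extracted items get the key \<open>inf\<close>, which exceeds all original keys.\<close>

definition extract_prog :: com where
  "extract_prog = forloop ''s'' (IVar ''m'') (
     ''t'' ::= IArr ''tree'' (IConst 1);; ''b'' ::= IArr ''key'' (IVar ''t'');;
     IStore ''key'' (IVar ''t'') (IVar ''inf'');;
     append_prog ''tri1'';; append_prog ''tri2'';;
     ''i'' ::= IHalf (IVar ''m'' \<oplus> IVar ''t'');; replay_prog)"

lemma writes_extract_prog [simp]:
  "iwrites extract_prog = {''s'', ''t'', ''b'', ''j'', ''i''}" "rwrites extract_prog = {}"
  "awrites extract_prog = {''key'', ''adj'', ''cnt'', ''tree''}"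
  by (auto simp: extract_prog_def)

text \<open>The triangles at \<open>v\<close> are viewed as the edges of a graph whose vertices are
  the \<open>d\<close> incident edges: no loops and no parallel edges. The absence of parallel edges
  makes \<open>other\<close> injective, which is why the other edges can be moved
  independently.\<close>

locale edge_pairs =
  fixes m d :: nat and e1 e2 :: "nat \<Rightarrow> nat"
  assumes ends: "t < m \<Longrightarrow> e1 t < d" "t < m \<Longrightarrow> e2 t < d" "t < m \<Longrightarrow> e1 t \<noteq> e2 t"
    and pairs_inj: "t < m \<Longrightarrow> t' < m \<Longrightarrow> {e1 t, e2 t} = {e1 t', e2 t'} \<Longrightarrow> t = t'"
begin

definition touches :: "nat \<Rightarrow> nat \<Rightarrow> bool" where
  "touches u t \<longleftrightarrow> e1 t = u \<or> e2 t = u"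

lemma pairs_count: "m \<le> d * d"
proof -
  have "inj_on (\<lambda>t. (e1 t, e2 t)) {..<m}" using pairs_inj by (auto intro!: inj_onI)
  moreover have "(\<lambda>t. (e1 t, e2 t)) ` {..<m} \<subseteq> {..<d} \<times> {..<d}" using ends by auto
  ultimately have "card {..<m} \<le> card ({..<d} \<times> {..<d})" by (intro card_inj_on_le) auto
  then show ?thesis by simp
qed

lemma degree_bound:
  assumes "distinct ds" "set ds \<subseteq> {..<m}"
  shows "length (filter (touches u) ds) \<le> d"
proof -
  define other where "other t = (if e1 t = u then e2 t else e1 t)" for t
  have "inj_on other (set (filter (touches u) ds))"
  proof (rule inj_onI)
    fix t t' assume t: "t \<in> set (filter (touches u) ds)" "t' \<in> set (filter (touches u) ds)" "other t = other t'"
    then have "{e1 t, e2 t} = {u, other t}" "{e1 t', e2 t'} = {u, other t'}"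
      by (auto simp: touches_def other_def split: if_splits)
    then show "t = t'" using t assms(2) by (intro pairs_inj) auto
  qed
  moreover have "other ` set (filter (touches u) ds) \<subseteq> {..<d}" using assms(2) ends by (auto simp: other_def)
  ultimately have "card (set (filter (touches u) ds)) \<le> card {..<d}" by (intro card_inj_on_le) auto
  then show ?thesis using distinct_card[of "filter (touches u) ds"] assms(1) by simp
qed

text \<open>The new triangle occupies one of the \<open>d\<close> places itself, so its bucket still
  has a free slot.\<close>

lemma degree_bound_Cons:
  assumes "distinct (ds @ [t])" "set (ds @ [t]) \<subseteq> {..<m}" "touches u t"
  shows "length (filter (touches u) ds) < d"
  using degree_bound[OF assms(1,2), of u] assms(3) by simp

definition buckets :: "(nat \<Rightarrow> int) \<Rightarrow> nat list \<Rightarrow> nat \<Rightarrow> int list" where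
  "buckets key ds u = map key (filter (touches u) ds)"

lemma buckets_snoc:
  assumes "t < m"
  shows "((buckets key ds)(e1 t := buckets key ds (e1 t) @ [key t]))
     (e2 t := buckets key ds (e2 t) @ [key t]) = buckets key (ds @ [t])"
  using ends(3)[OF assms] by (auto simp: buckets_def touches_def fun_eq_iff)

definition extracted :: "(nat \<Rightarrow> int) \<Rightarrow> nat \<Rightarrow> nat list \<Rightarrow> bool" where
  "extracted key k ds \<longleftrightarrow> length ds = k \<and> distinct ds \<and> set ds \<subseteq> {..<m} \<and> sorted (map key ds) \<and>
     (\<forall>x\<in>set ds. \<forall>y<m. y \<notin> set ds \<longrightarrow> key x \<le> key y)"

text \<open>Triangles leave the tournament in globally sorted order and are appended to the buckets
  of both their edges, so one sort of all triangles leaves every bucket sorted.\<close>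

lemma extract_runs:
  assumes m: "ivar s ''m'' = int m" and W: "tree_inv m 1 W s" "\<And>j. 1 \<le> j \<Longrightarrow> j < m \<Longrightarrow> wins key W j"
    and key: "\<And>t. t < m \<Longrightarrow> iarr s ''key'' (int t) = key t" "\<And>t. t < m \<Longrightarrow> key t < ivar s ''inf''"
    and tri: "\<And>t. t < m \<Longrightarrow> iarr s ''tri1'' (int t) = int (e1 t)" "\<And>t. t < m \<Longrightarrow> iarr s ''tri2'' (int t) = int (e2 t)"
    and base: "\<And>u. u < d \<Longrightarrow> iarr s ''base'' (int u) = int (u * d)" and cnt: "\<And>u. u < d \<Longrightarrow> iarr s ''cnt'' (int u) = 0"
    and L: "m < 2 ^ L"
  shows "runs extract_prog s (20 + m * (150 + L * 50)) (\<lambda>s'. \<exists>ds. extracted key m ds \<and> content d (buckets key ds) s')"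
proof -
  let ?body = "''t'' ::= IArr ''tree'' (IConst 1);; ''b'' ::= IArr ''key'' (IVar ''t'');;
     IStore ''key'' (IVar ''t'') (IVar ''inf'');;
     append_prog ''tri1'';; append_prog ''tri2'';;
     ''i'' ::= IHalf (IVar ''m'' \<oplus> IVar ''t'');; replay_prog"
  define inf where "inf = ivar s ''inf''"
  define cur where "cur ds t = (if t \<in> set ds then inf else key t)" for ds t
  define J where "J k s' \<longleftrightarrow> (\<exists>ds W. extracted key k ds \<and> content d (buckets key ds) s' \<and> tree_inv m 1 W s' \<and>
     (\<forall>j. 1 \<le> j \<longrightarrow> j < m \<longrightarrow> wins (cur ds) W j) \<and> (\<forall>t<m. iarr s' ''key'' (int t) = cur ds t))" for k s'
  have "runs extract_prog s (20 + m * (150 + L * 50)) (J m)"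
    unfolding extract_prog_def
  proof (rule forloop_runs[where J = J and \<tau> = "130 + L * 50"])
    have "cur [] = key" by (simp add: cur_def fun_eq_iff)
    moreover have "content d (buckets key []) (s\<lparr>ivar := (ivar s)(''s'' := 0)\<rparr>)"
      using cnt by (simp add: content_def buckets_def)
    moreover have "tree_inv m 1 W (s\<lparr>ivar := (ivar s)(''s'' := 0)\<rparr>)" using W by (simp add: tree_inv_def)
    ultimately show "J 0 (s\<lparr>ivar := (ivar s)(''s'' := 0)\<rparr>)"
      unfolding J_def using W key(1) by (intro exI[of _ "[]"] exI[of _ W]) (auto simp: extracted_def)
  next
    fix k s' assume k: "k < m" and sm: "same (forloop ''s'' (IVar ''m'') ?body) s s'" and "J k s'"
    then obtain ds W where ds: "extracted key k ds" and C: "content d (buckets key ds) s'" and W: "tree_inv m 1 W s'"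
      and wins: "\<And>j. 1 \<le> j \<Longrightarrow> j < m \<Longrightarrow> wins (cur ds) W j" and cur: "\<And>t. t < m \<Longrightarrow> iarr s' ''key'' (int t) = cur ds t"
      by (auto simp: J_def)
    have keep: "ivar s' ''m'' = int m" "ivar s' ''inf'' = inf" "iarr s' ''tri1'' = iarr s ''tri1''"
      "iarr s' ''tri2'' = iarr s ''tri2''" "iarr s' ''base'' = iarr s ''base''"
      using sm m by (simp_all add: same_def inf_def)
    define t where "t = W 1"
    have t: "t < m" "iarr s' ''tree'' 1 = int t"
      using W k unfolding tree_inv_def t_def by (auto dest!: spec[of _ 1])
    have min: "cur ds t \<le> cur ds y" if "y < m" for y
      unfolding t_def using root_minimal[OF W wins that] by simp
    \<comment> \<open>Some item is still to be extracted and its key is below \<open>inf\<close>;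
      hence the minimal item at the root is not an extracted one.\<close>
    have "card (set ds) < card {..<m}" using ds k by (simp add: extracted_def distinct_card)
    then obtain y where y: "y < m" "y \<notin> set ds"
      by (metis card_mono finite_set lessThan_iff not_le subsetI)
    have tds: "t \<notin> set ds"
    proof
      assume "t \<in> set ds"
      then have "inf \<le> key y" using min[OF y(1)] y by (simp add: cur_def)
      then show False using key(2)[OF y(1)] by (simp add: inf_def)
    qed
    then have kt: "cur ds t = key t" by (simp add: cur_def)
    have tmin: "key t \<le> key y" if "y < m" "y \<notin> set ds" for y
      using min[OF that(1)] that kt by (simp add: cur_def)
    have ds': "extracted key (Suc k) (ds @ [t])"
      using ds tds t tmin by (auto simp: extracted_def sorted_append)
    have cur': "cur (ds @ [t]) = (cur ds)(t := inf)" by (auto simp: cur_def fun_eq_iff)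
    \<comment> \<open>Only the key of \<open>t\<close> has grown, so \<open>wins\<close> can fail
      only at nodes won by \<open>t\<close>, all of which are ancestors of its leaf.\<close>
    have wins': "wins (cur (ds @ [t])) W j \<or> (\<exists>k. (m + t) div 2 div 2 ^ k = j)" if j: "1 \<le> j" "j < m" for j
    proof (cases "W j = t")
      case True
      then have "anc m j t" using W j by (auto simp: tree_inv_def)
      then obtain k where k: "(m + t) div 2 ^ k = j" by (auto simp: anc_def)
      then obtain k' where "k = Suc k'" using j by (cases k) auto
      then have "(m + t) div 2 div 2 ^ k' = j" using k by (simp only: power_Suc div_mult2_eq)
      then show ?thesis by blast
    next
      case False
      have "cur ds t \<le> inf" using kt key(2)[OF t(1)] by (simp add: inf_def)
      then have "cur ds x \<le> cur (ds @ [t]) x" for x by (simp add: cur')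
      moreover have "cur (ds @ [t]) (W j) = cur ds (W j)" using False by (simp add: cur')
      ultimately show ?thesis using wins[OF j] unfolding wins_def by (metis order_trans)
    qed
    define s1 where "s1 = s'\<lparr>ivar := (ivar s')(''t'' := int t, ''b'' := key t),
      iarr := (iarr s')(''key'' := (iarr s' ''key'')(int t := inf))\<rparr>"
    have dist: "distinct (ds @ [t])" "set (ds @ [t]) \<subseteq> {..<m}" using ds' by (auto simp: extracted_def)
    let ?C1 = "(buckets key ds)(e1 t := buckets key ds (e1 t) @ [key t])"
    define R where "R s2 \<longleftrightarrow> ivar s2 ''t'' = int t \<and> ivar s2 ''b'' = key t \<and> ivar s2 ''m'' = int m \<and>
      iarr s2 ''tri1'' = iarr s ''tri1'' \<and> iarr s2 ''tri2'' = iarr s ''tri2'' \<and> iarr s2 ''base'' = iarr s ''base'' \<and>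
      iarr s2 ''tree'' = iarr s' ''tree'' \<and> (\<forall>t'<m. iarr s2 ''key'' (int t') = cur (ds @ [t]) t')" for s2 :: state
    have R1: "R s1" using keep cur by (simp add: R_def s1_def cur')
    have Rsame: "R s3" if "R s2" "same (append_prog a) s2 s3" for s2 s3 a
      using that by (simp add: R_def same_def)
    have "runs (append_prog ''tri1'') s1 30 (content d ?C1)"
    proof (rule append_runs)
      show "content d (buckets key ds) s1" using C by (simp add: content_def s1_def)
      show "length (buckets key ds (e1 t)) < d"
        using degree_bound_Cons[OF dist, of "e1 t"] by (simp add: buckets_def touches_def)
    qed (use R1 t tri base ends in \<open>auto simp: R_def\<close>)
    then have a1: "runs (append_prog ''tri1'') s1 30 (\<lambda>s2. R s2 \<and> content d ?C1 s2)"
      by (rule runs_same) (use R1 Rsame in auto)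
    have a2: "runs (append_prog ''tri2'') s2 30 (\<lambda>s3. R s3 \<and> content d (buckets key (ds @ [t])) s3)"
      if "R s2" "content d ?C1 s2" for s2
    proof (rule runs_same[OF append_runs[OF that(2), of _ "e2 t" "key t"]])
      show "length (?C1 (e2 t)) < d" using degree_bound_Cons[OF dist, of "e2 t"] ends(3)[OF t(1)]
        by (simp add: buckets_def touches_def)
      fix s3 assume s3: "same (append_prog ''tri2'') s2 s3" "content d (?C1(e2 t := ?C1 (e2 t) @ [key t])) s3"
      have "?C1(e2 t := ?C1 (e2 t) @ [key t]) = buckets key (ds @ [t])"
        using buckets_snoc[OF t(1)] ends(3)[OF t(1)] by (simp add: fun_upd_other)
      then show "R s3 \<and> content d (buckets key (ds @ [t])) s3" using s3 Rsame that(1) by auto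
    qed (use that t tri base ends in \<open>auto simp: R_def\<close>)
    have a3: "runs (''i'' ::= IHalf (IVar ''m'' \<oplus> IVar ''t'');; replay_prog) s3 (30 + L * 50)
      (\<lambda>s''. J (Suc k) (s''\<lparr>ivar := (ivar s'')(''s'' := int (Suc k))\<rparr>))"
      if s3: "R s3" "content d (buckets key (ds @ [t])) s3" for s3
    proof -
      define s4 where "s4 = s3\<lparr>ivar := (ivar s3)(''i'' := int ((m + t) div 2))\<rparr>"
      have R4: "R s4" using s3 by (simp add: R_def s4_def)
      have "tree_inv m 1 W s4" using W R4 by (simp add: tree_inv_def R_def)
      then have "runs replay_prog s4 (10 + L * 50) (\<lambda>s'. \<exists>W. tree_inv m 1 W s' \<and> (\<forall>j. 1 \<le> j \<longrightarrow> j < m \<longrightarrow> wins (cur (ds @ [t])) W j))"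
        using R4 t L wins' by (intro replay_runs[where i = "(m + t) div 2"]) (auto simp: R_def s4_def)
      then have "runs replay_prog s4 (10 + L * 50) (\<lambda>s''. J (Suc k) (s''\<lparr>ivar := (ivar s'')(''s'' := int (Suc k))\<rparr>))"
      proof (rule runs_same)
        fix s5 assume sm5: "same replay_prog s4 s5" and "\<exists>W. tree_inv m 1 W s5 \<and> (\<forall>j. 1 \<le> j \<longrightarrow> j < m \<longrightarrow> wins (cur (ds @ [t])) W j)"
        then obtain W' where W': "tree_inv m 1 W' s5" "\<forall>j. 1 \<le> j \<longrightarrow> j < m \<longrightarrow> wins (cur (ds @ [t])) W' j" by blast
        define s6 where "s6 = s5\<lparr>ivar := (ivar s5)(''s'' := int (Suc k))\<rparr>"
        have "content d (buckets key (ds @ [t])) s6" using s3(2) sm5 by (simp add: content_def same_def s4_def s6_def)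
        moreover have "\<forall>t'<m. iarr s6 ''key'' (int t') = cur (ds @ [t]) t'" using R4 sm5 by (simp add: R_def same_def s6_def)
        moreover have "tree_inv m 1 W' s6" using W' by (simp add: tree_inv_def s6_def)
        ultimately have "J (Suc k) s6" unfolding J_def using ds' W'(2) by blast
        then show "J (Suc k) (s5\<lparr>ivar := (ivar s5)(''s'' := int (Suc k))\<rparr>)" by (simp add: s6_def)
      qed
      moreover have "ival (IHalf (IVar ''m'' \<oplus> IVar ''t'')) s3 = int ((m + t) div 2)"
        using s3 by (simp add: R_def zdiv_int)
      ultimately show ?thesis by (auto simp: s4_def elim!: runs_mono)
    qed
    have "runs (append_prog ''tri1'';; append_prog ''tri2'';; ''i'' ::= IHalf (IVar ''m'' \<oplus> IVar ''t'');; replay_prog) s1 (90 + L * 50)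
      (\<lambda>s''. J (Suc k) (s''\<lparr>ivar := (ivar s'')(''s'' := int (Suc k))\<rparr>))"
    proof (rule runs_Seq[OF a1, where ?T2.0 = "60 + L * 50"])
      fix s2 assume "R s2 \<and> content d ?C1 s2"
      then have a2': "runs (append_prog ''tri2'') s2 30 (\<lambda>s3. R s3 \<and> content d (buckets key (ds @ [t])) s3)"
        using a2 by blast
      show "runs (append_prog ''tri2'';; ''i'' ::= IHalf (IVar ''m'' \<oplus> IVar ''t'');; replay_prog) s2 (60 + L * 50)
        (\<lambda>s''. J (Suc k) (s''\<lparr>ivar := (ivar s'')(''s'' := int (Suc k))\<rparr>))"
        by (rule runs_Seq[OF a2', where ?T2.0 = "30 + L * 50"]) (use a3 in auto)
    qed simp
    moreover have "iarr s' ''key'' (int t) = key t" using cur[OF t(1)] kt by simp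
    ultimately show "runs ?body s' (130 + L * 50) (\<lambda>s''. J (Suc k) (s''\<lparr>ivar := (ivar s'')(''s'' := int (Suc k))\<rparr>))"
      using t keep by (auto simp: s1_def elim!: runs_mono)
  next
    fix s' assume "same (forloop ''s'' (IVar ''m'') ?body) s s'"
    then show "ival (IVar ''m'') s' = int m" using m by (simp add: same_def)
  qed (auto simp: algebra_simps)
  then show ?thesis by (rule runs_mono) (auto simp: J_def)
qed

end

section \<open>From local counts to the objective\<close>

lemma sum_nth_distinct: "distinct l \<Longrightarrow> (\<Sum>k<length l. g (l ! k)) = (\<Sum>t\<in>set l. g t)"
  using sum.reindex_bij_betw[OF bij_betw_nth[of l "{..<length l}" "set l"], of g] by simp

context edge_pairs
begin

definition inc :: "nat \<Rightarrow> nat set" where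
  "inc u = {t. t < m \<and> touches u t}"

definition other :: "nat \<Rightarrow> nat \<Rightarrow> nat" where
  "other u t = (if e1 t = u then e2 t else e1 t)"

definition count :: "(int \<Rightarrow> real) \<Rightarrow> (nat \<Rightarrow> int) \<Rightarrow> (nat \<Rightarrow> int) \<Rightarrow> real" where
  "count h q Y = (\<Sum>t<m. h (Y (e1 t) + Y (e2 t) + q t))"

lemma finite_inc [simp]: "finite (inc u)"
  by (simp add: inc_def)

lemma inj_on_other: "inj_on (other u) (inc u)"
proof (rule inj_onI)
  fix t t' assume t: "t \<in> inc u" "t' \<in> inc u" "other u t = other u t'"
  then have "{e1 t, e2 t} = {u, other u t}" "{e1 t', e2 t'} = {u, other u t'}"
    by (auto simp: inc_def touches_def other_def split: if_splits)
  then show "t = t'" using t by (intro pairs_inj) (auto simp: inc_def)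
qed

lemma other_props: "t \<in> inc u \<Longrightarrow> other u t < d \<and> other u t \<noteq> u"
  using ends[of t] by (auto simp: inc_def touches_def other_def)

lemma sum_ends: "t \<in> inc u \<Longrightarrow> Y (e1 t) + Y (e2 t) = Y u + (Y (other u t) :: int)"
  by (auto simp: inc_def touches_def other_def)

text \<open>A triangle at \<open>u\<close> contains \<open>u\<close> exactly once, so its weight
  drops by one; the terms of all other triangles cancel.\<close>

lemma count_diff:
  assumes h: "\<And>k. h (k - 1) - h k = contr c (k - lam)"
  shows "count h q (z(u := z u - 1)) - count h q z = (\<Sum>t\<in>inc u. contr c (z u + z (other u t) + q t - lam))"
proof -
  have "count h q (z(u := z u - 1)) - count h q z =
    (\<Sum>t<m. if t \<in> inc u then contr c (z u + z (other u t) + q t - lam) else 0)"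
    unfolding count_def sum_subtractf[symmetric]
  proof (rule sum.cong[OF refl])
    fix t assume "t \<in> {..<m}"
    let ?z = "z(u := z u - 1)"
    show "h (?z (e1 t) + ?z (e2 t) + q t) - h (z (e1 t) + z (e2 t) + q t) =
      (if t \<in> inc u then contr c (z u + z (other u t) + q t - lam) else 0)"
    proof (cases "t \<in> inc u")
      case True
      have "?z (e1 t) + ?z (e2 t) = z u - 1 + z (other u t)"
        unfolding sum_ends[OF True] using other_props[OF True] by simp
      then have *: "?z (e1 t) + ?z (e2 t) + q t = (z u + z (other u t) + q t) - 1" by simp
      show ?thesis unfolding * sum_ends[OF True, of z] using True by (simp only: h if_True)
    next
      case False
      then show ?thesis using \<open>t \<in> {..<m}\<close> by (auto simp: inc_def touches_def)
    qed
  qed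
  also have "\<dots> = (\<Sum>t\<in>inc u. contr c (z u + z (other u t) + q t - lam))"
    by (subst sum.inter_restrict[symmetric]) (auto simp: inc_def intro!: sum.cong)
  finally show ?thesis .
qed

text \<open>Passes from positions in a bucket to triangles; the sums do not depend on the
  order.\<close>

lemma objective_bucket:
  fixes key :: "nat \<Rightarrow> int"
  assumes ds: "distinct ds" "set ds = {..<m}" and bs: "bs = buckets key ds u"
    and l: "l = filter (touches u) ds"
  shows "objective \<beta> c ((!) bs) (length bs) p (\<lambda>k. \<tau> (l ! k)) =
    \<bar>\<Sum>t\<in>inc u. contr c (\<tau> t)\<bar> * exp (- \<beta> * (dd p + (\<Sum>t\<in>inc u. \<bar>\<tau> t - (key t - p)\<bar>)))"
proof -
  have sl: "set l = inc u" "distinct l" using ds by (auto simp: l inc_def)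
  have n: "length bs = length l" by (simp add: bs l buckets_def)
  have nth: "k < length l \<Longrightarrow> bs ! k = key (l ! k)" for k by (simp add: bs l buckets_def)
  have "(\<Sum>k<length l. contr c (\<tau> (l ! k))) = (\<Sum>t\<in>inc u. contr c (\<tau> t))"
    using sum_nth_distinct[OF sl(2), of "\<lambda>t. contr c (\<tau> t)"] sl by simp
  moreover have "(\<Sum>k<length l. \<bar>\<tau> (l ! k) - (bs ! k - p)\<bar>) = (\<Sum>t\<in>inc u. \<bar>\<tau> t - (key t - p)\<bar>)"
    using sum_nth_distinct[OF sl(2), of "\<lambda>t. \<bar>\<tau> t - (key t - p)\<bar>"] sl nth by simp
  ultimately show ?thesis by (simp add: objective_def move_cost_def n)
qed

definition all_cands :: "real \<Rightarrow> real \<Rightarrow> (nat \<Rightarrow> int list) \<Rightarrow> real set" where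
  "all_cands \<beta> c C = (\<Union>u<d. \<Union>p\<in>centres ((!) (C u)) (length (C u)). cands \<beta> c ((!) (C u)) (length (C u)) p)"

text \<open>Edges that share no triangle with \<open>u\<close> only add to the distance and are
  dropped. What remains is the move cost for the shift \<open>p = w u - z u\<close>, to which the
  reduction to centres and then to candidates applies.\<close>

lemma step_le_bound:
  assumes h: "\<And>k. h (k - 1) - h k = contr c (k - lam)" and pos: "\<beta> > 0" "c > 0"
    and ds: "distinct ds" "set ds = {..<m}" and key: "\<And>t. t < m \<Longrightarrow> key t = w (e1 t) + w (e2 t) + q t - lam"
    and R: "\<And>v. v \<in> all_cands \<beta> c (buckets key ds) \<Longrightarrow> v \<le> R"
    and u: "u < d" and A: "dd (w u - z u) + (\<Sum>x\<in>{..<d} - {u}. \<bar>w x - z x\<bar>) \<le> A"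
  shows "\<bar>count h q (z(u := z u - 1)) - count h q z\<bar> * exp (- \<beta> * real_of_int A) \<le> R"
proof -
  define p where "p = w u - z u"
  define \<tau> where "\<tau> t = z u + z (other u t) + q t - lam" for t
  define bs where "bs = buckets key ds u"
  define l where "l = filter (touches u) ds"
  have "(\<Sum>t\<in>inc u. \<bar>\<tau> t - (key t - p)\<bar>) = (\<Sum>t\<in>inc u. \<bar>w (other u t) - z (other u t)\<bar>)"
  proof (rule sum.cong[OF refl])
    fix t assume t: "t \<in> inc u"
    then have "key t = w u + w (other u t) + q t - lam" using key[of t] sum_ends[OF t, of w] by (simp add: inc_def)
    then show "\<bar>\<tau> t - (key t - p)\<bar> = \<bar>w (other u t) - z (other u t)\<bar>" by (simp add: \<tau>_def p_def)
  qed
  also have "\<dots> = (\<Sum>x\<in>other u ` inc u. \<bar>w x - z x\<bar>)"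
    using sum.reindex[OF inj_on_other, of "\<lambda>x. \<bar>w x - z x\<bar>" u] by simp
  also have "\<dots> \<le> (\<Sum>x\<in>{..<d} - {u}. \<bar>w x - z x\<bar>)"
    using other_props by (intro sum_mono2) auto
  finally have "dd p + (\<Sum>t\<in>inc u. \<bar>\<tau> t - (key t - p)\<bar>) \<le> A" using A by (simp add: p_def)
  then have "\<bar>count h q (z(u := z u - 1)) - count h q z\<bar> * exp (- \<beta> * real_of_int A) \<le>
      \<bar>\<Sum>t\<in>inc u. contr c (\<tau> t)\<bar> * exp (- \<beta> * (dd p + (\<Sum>t\<in>inc u. \<bar>\<tau> t - (key t - p)\<bar>)))"
    unfolding count_diff[OF h] \<tau>_def[symmetric] using pos
    by (intro mult_left_mono) (auto simp flip: of_int_sum of_int_add of_int_abs of_int_diff)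
  also have "\<dots> = objective \<beta> c ((!) bs) (length bs) p (\<lambda>k. \<tau> (l ! k))"
    by (rule objective_bucket[OF ds bs_def l_def, symmetric])
  also have "\<exists>p'\<in>centres ((!) bs) (length bs). \<exists>t'. objective \<beta> c ((!) bs) (length bs) p (\<lambda>k. \<tau> (l ! k))
      \<le> objective \<beta> c ((!) bs) (length bs) p' t'"
    by (rule objective_le_at_centre[OF pos(1)])
  then obtain p' t' where p': "p' \<in> centres ((!) bs) (length bs)"
    "objective \<beta> c ((!) bs) (length bs) p (\<lambda>k. \<tau> (l ! k)) \<le> objective \<beta> c ((!) bs) (length bs) p' t'" by blast
  note p'(2)
  also obtain neg k where k: "k \<le> length bs"
    "objective \<beta> c ((!) bs) (length bs) p' t' \<le> cand neg \<beta> c ((!) bs) (length bs) p' k"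
    using objective_le_cand[OF pos] by blast
  note k(2)
  also have "cand neg \<beta> c ((!) bs) (length bs) p' k \<le> R"
    using u p'(1) k(1) unfolding bs_def by (intro R) (auto simp: all_cands_def cands_def)
  finally show ?thesis .
qed

lemma bound_attained:
  assumes h: "\<And>k. h (k - 1) - h k = contr c (k - lam)" and pos: "\<beta> > 0" "c > 0"
    and ds: "distinct ds" "set ds = {..<m}" and key: "\<And>t. t < m \<Longrightarrow> key t = w (e1 t) + w (e2 t) + q t - lam"
    and R: "R \<in> all_cands \<beta> c (buckets key ds)"
  obtains u z where "u < d"
    "R \<le> \<bar>count h q (z(u := z u - 1)) - count h q z\<bar> *
       exp (- \<beta> * real_of_int (dd (w u - z u) + (\<Sum>x\<in>{..<d} - {u}. \<bar>w x - z x\<bar>)))"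
proof -
  obtain u p neg k where u: "u < d" and k: "k \<le> length (buckets key ds u)"
    and Req: "R = cand neg \<beta> c ((!) (buckets key ds u)) (length (buckets key ds u)) p k"
    using R by (auto simp: all_cands_def cands_def)
  define bs where "bs = buckets key ds u"
  define l where "l = filter (touches u) ds"
  obtain t' where t': "R \<le> objective \<beta> c ((!) bs) (length bs) p t'"
    using cand_le_objective[OF pos k] unfolding Req bs_def by blast
  have l: "set l = inc u" "distinct l" "length bs = length l" using ds by (auto simp: l_def inc_def bs_def buckets_def)
  define \<tau> where "\<tau> = (\<lambda>t. t' (the_inv_into {..<length l} ((!) l) t))"
  have inj: "inj_on ((!) l) {..<length l}" using l(2) by (auto simp: inj_on_def nth_eq_iff_index_eq)
  have \<tau>: "k < length l \<Longrightarrow> \<tau> (l ! k) = t' k" for k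
    unfolding \<tau>_def by (subst the_inv_into_f_f[OF inj]) auto
  have "objective \<beta> c ((!) bs) (length bs) p t' = objective \<beta> c ((!) bs) (length bs) p (\<lambda>k. \<tau> (l ! k))"
    by (simp add: objective_def move_cost_def l(3) \<tau>)
  also note objective_bucket[OF ds bs_def l_def]
  finally have obj: "R \<le> \<bar>\<Sum>t\<in>inc u. contr c (\<tau> t)\<bar> * exp (- \<beta> * (dd p + (\<Sum>t\<in>inc u. \<bar>\<tau> t - (key t - p)\<bar>)))"
    using t' by simp
  \<comment> \<open>Realises the targets: in each triangle at \<open>u\<close> the other edge
    absorbs the missing amount, which is well defined because \<open>other u\<close> is injective;
    all remaining edges keep their weights.\<close>
  define z where "z x = (if x = u then w u - p else if x \<in> other u ` inc u then
      (let t = the_inv_into (inc u) (other u) x in w x + (\<tau> t - (key t - p))) else w x)" for x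
  have zo: "z (other u t) = w (other u t) + (\<tau> t - (key t - p))" if "t \<in> inc u" for t
    using that other_props[OF that] by (simp add: z_def the_inv_into_f_f[OF inj_on_other])
  have tau: "z u + z (other u t) + q t - lam = \<tau> t" if "t \<in> inc u" for t
  proof -
    have "key t = w u + w (other u t) + q t - lam" using key[of t] sum_ends[OF that, of w] that by (simp add: inc_def)
    then show ?thesis using zo[OF that] by (simp add: z_def)
  qed
  have "(\<Sum>x\<in>{..<d} - {u}. \<bar>w x - z x\<bar>) = (\<Sum>x\<in>other u ` inc u. \<bar>w x - z x\<bar>)"
    using other_props by (intro sum.mono_neutral_right) (auto simp: z_def)
  also have "\<dots> = (\<Sum>t\<in>inc u. \<bar>w (other u t) - z (other u t)\<bar>)"
    using sum.reindex[OF inj_on_other, of "\<lambda>x. \<bar>w x - z x\<bar>" u] by simp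
  also have "\<dots> = (\<Sum>t\<in>inc u. \<bar>\<tau> t - (key t - p)\<bar>)"
    by (rule sum.cong) (auto simp: zo)
  finally have dist: "(\<Sum>x\<in>{..<d} - {u}. \<bar>w x - z x\<bar>) = (\<Sum>t\<in>inc u. \<bar>\<tau> t - (key t - p)\<bar>)" .
  have "count h q (z(u := z u - 1)) - count h q z = (\<Sum>t\<in>inc u. contr c (\<tau> t))"
    unfolding count_diff[OF h] using tau by simp
  moreover have "w u - z u = p" by (simp add: z_def)
  ultimately show thesis using obj dist by (intro that[OF u, of z]) simp
qed

end

section \<open>The program\<close>

definition constants_prog :: com where
  "constants_prog =
    ''p'' :::= RExp (RSub (rnum 0) (RVar ''eps1''));;
    ''c'' :::= RDiv (RVar ''p'') (RMul (RSub (rnum 1) (RVar ''p'')) (RSub (rnum 1) (RVar ''p'')))"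

text \<open>Multiples of \<open>d\<close> are obtained by repeated addition, as the machine has no
  product of integers.\<close>

definition base_prog :: com where
  "base_prog = ''z'' ::= IConst 0;;
    forloop ''i'' (IVar ''d'') (IStore ''base'' (IVar ''i'') (IVar ''z'');; ''z'' ::= IVar ''z'' \<oplus> IVar ''d'')"

text \<open>\<open>inf\<close> starts at the default 0 and is raised whenever a key reaches it, so
  in the end it exceeds all keys.\<close>

definition key_prog :: com where
  "key_prog = forloop ''i'' (IVar ''m'') (
    IStore ''key'' (IVar ''i'') (IArr ''w'' (IArr ''tri1'' (IVar ''i'')) \<oplus> IArr ''w'' (IArr ''tri2'' (IVar ''i''))
      \<oplus> IArr ''triw'' (IVar ''i'') \<ominus> IVar ''lambda'');;
    IStore ''tree'' (IVar ''m'' \<oplus> IVar ''i'') (IVar ''i'');;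
    If (ILess (IArr ''key'' (IVar ''i'')) (IVar ''inf'')) Skip (''inf'' ::= IArr ''key'' (IVar ''i'') \<oplus> IConst 1))"

definition main_prog :: com where
  "main_prog = constants_prog;; base_prog;; key_prog;; build_prog;; extract_prog;;
     forloop ''u'' (IVar ''d'') vertex_prog"

lemma writes_prep_progs [simp]:
  "iwrites constants_prog = {}" "rwrites constants_prog = {''p'', ''c''}" "awrites constants_prog = {}"
  "iwrites base_prog = {''z'', ''i''}" "rwrites base_prog = {}" "awrites base_prog = {''base''}"
  "iwrites key_prog = {''i'', ''inf''}" "rwrites key_prog = {}" "awrites key_prog = {''key'', ''tree''}"
  by (auto simp: constants_prog_def base_prog_def key_prog_def)

lemma base_runs:
  assumes d: "ivar s ''d'' = int d"
  shows "runs base_prog s (20 + d * 30) (\<lambda>s'. \<forall>u<d. iarr s' ''base'' (int u) = int (u * d))"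
proof -
  define s1 where "s1 = s\<lparr>ivar := (ivar s)(''z'' := 0)\<rparr>"
  let ?f = "forloop ''i'' (IVar ''d'') (IStore ''base'' (IVar ''i'') (IVar ''z'');; ''z'' ::= IVar ''z'' \<oplus> IVar ''d'')"
  have "runs ?f s1 (11 + d * 30) (\<lambda>s'. (\<forall>u<d. iarr s' ''base'' (int u) = int (u * d)) \<and> ivar s' ''z'' = int (d * d))"
  proof (rule forloop_runs[where J = "\<lambda>k s'. (\<forall>u<k. iarr s' ''base'' (int u) = int (u * d)) \<and> ivar s' ''z'' = int (k * d)" and \<tau> = 10])
    fix k s' assume "same ?f s1 s'" "ivar s' ''i'' = int k"
      "(\<forall>u<k. iarr s' ''base'' (int u) = int (u * d)) \<and> ivar s' ''z'' = int (k * d)"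
    moreover from this have "ivar s' ''d'' = int d" using d by (simp add: same_def s1_def)
    ultimately show "runs (IStore ''base'' (IVar ''i'') (IVar ''z'');; ''z'' ::= IVar ''z'' \<oplus> IVar ''d'') s' 10
      (\<lambda>s''. (\<forall>u<Suc k. iarr (s''\<lparr>ivar := (ivar s'')(''i'' := int (Suc k))\<rparr>) ''base'' (int u) = int (u * d)) \<and>
        ivar (s''\<lparr>ivar := (ivar s'')(''i'' := int (Suc k))\<rparr>) ''z'' = int (Suc k * d))"
      by (auto simp: less_Suc_eq algebra_simps)
  qed (use d in \<open>auto simp: s1_def same_def\<close>)
  then show ?thesis unfolding base_prog_def by (auto simp: s1_def elim!: runs_mono)
qed

lemma key_runs:
  assumes m: "ivar s ''m'' = int m" and lam: "ivar s ''lambda'' = lam"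
    and key: "\<And>t. t < m \<Longrightarrow> iarr s ''w'' (iarr s ''tri1'' (int t)) + iarr s ''w'' (iarr s ''tri2'' (int t)) + iarr s ''triw'' (int t) - lam = key t"
  shows "runs key_prog s (20 + m * 60) (\<lambda>s'. \<forall>t<m. iarr s' ''key'' (int t) = key t \<and>
    iarr s' ''tree'' (int m + int t) = int t \<and> key t < ivar s' ''inf'')"
  unfolding key_prog_def
proof (rule forloop_runs[where \<tau> = 45 and J = "\<lambda>k s'. \<forall>t<k. iarr s' ''key'' (int t) = key t \<and>
    iarr s' ''tree'' (int m + int t) = int t \<and> key t < ivar s' ''inf''"])
  let ?body = "IStore ''key'' (IVar ''i'') (IArr ''w'' (IArr ''tri1'' (IVar ''i'')) \<oplus> IArr ''w'' (IArr ''tri2'' (IVar ''i''))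
      \<oplus> IArr ''triw'' (IVar ''i'') \<ominus> IVar ''lambda'');;
    IStore ''tree'' (IVar ''m'' \<oplus> IVar ''i'') (IVar ''i'');;
    If (ILess (IArr ''key'' (IVar ''i'')) (IVar ''inf'')) Skip (''inf'' ::= IArr ''key'' (IVar ''i'') \<oplus> IConst 1)"
  {
    fix s' assume "same (forloop ''i'' (IVar ''m'') ?body) s s'"
    then show "ival (IVar ''m'') s' = int m" using m by (simp add: same_def)
  }
  fix k s' assume k: "k < m" and sm: "same (forloop ''i'' (IVar ''m'') ?body) s s'" and i: "ivar s' ''i'' = int k"
    and J: "\<forall>t<k. iarr s' ''key'' (int t) = key t \<and> iarr s' ''tree'' (int m + int t) = int t \<and> key t < ivar s' ''inf''"
  have v: "ivar s' ''m'' = int m" "ivar s' ''lambda'' = lam"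
    "iarr s' ''w'' (iarr s' ''tri1'' (int k)) + iarr s' ''w'' (iarr s' ''tri2'' (int k)) + iarr s' ''triw'' (int k) - lam = key k"
    using sm m lam key[OF k] by (simp_all add: same_def)
  show "runs ?body s' 45 (\<lambda>s''. \<forall>t<Suc k. iarr (s''\<lparr>ivar := (ivar s'')(''i'' := int (Suc k))\<rparr>) ''key'' (int t) = key t \<and>
    iarr (s''\<lparr>ivar := (ivar s'')(''i'' := int (Suc k))\<rparr>) ''tree'' (int m + int t) = int t \<and>
    key t < ivar (s''\<lparr>ivar := (ivar s'')(''i'' := int (Suc k))\<rparr>) ''inf'')"
    using v i J by (cases "key k < ivar s' ''inf''") (force simp: less_Suc_eq)+
qed auto

context edge_pairs
begin

lemma vertices_runs:
  assumes d: "ivar s ''d'' = int d" and v: "rvar s ''beta'' = \<beta>" "rvar s ''c'' = c" and pos: "\<beta> > 0" "c > 0"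
    and base: "\<And>u. u < d \<Longrightarrow> iarr s ''base'' (int u) = int (u * d)"
    and C: "content d (buckets key ds) s" and ds: "extracted key m ds" and L: "d < 2 ^ L"
  shows "runs (forloop ''u'' (IVar ''d'') vertex_prog) s (20 + d * (20 + (d + 1) * (6000 * (L + 1)^2)))
    (\<lambda>s'. maximised (all_cands \<beta> c (buckets key ds)) (rvar s ''out'') (rvar s' ''out''))"
proof -
  let ?C = "buckets key ds"
  define X where "X k = (\<Union>u<k. \<Union>p\<in>centres ((!) (?C u)) (length (?C u)). cands \<beta> c ((!) (?C u)) (length (?C u)) p)" for k
  have "runs (forloop ''u'' (IVar ''d'') vertex_prog) s (20 + d * (20 + (d + 1) * (6000 * (L + 1)^2)))
    (\<lambda>s'. maximised (X d) (rvar s ''out'') (rvar s' ''out''))"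
  proof (rule forloop_runs[where J = "\<lambda>k s'. maximised (X k) (rvar s ''out'') (rvar s' ''out'')"
        and \<tau> = "(d + 1) * (6000 * (L + 1)^2)"])
    fix k s' assume k: "k < d" and sm: "same (forloop ''u'' (IVar ''d'') vertex_prog) s s'" and i: "ivar s' ''u'' = int k"
      and J: "maximised (X k) (rvar s ''out'') (rvar s' ''out'')"
    define n where "n = length (?C k)"
    have n: "n \<le> d" using C k by (simp add: content_def n_def)
    have "sorted (?C k)" using ds by (simp add: buckets_def extracted_def sorted_filter)
    have "runs vertex_prog s' ((n + 1) * (6000 * (L + 1)^2))
      (\<lambda>s''. maximised (\<Union>p\<in>centres ((!) (?C k)) n. cands \<beta> c ((!) (?C k)) n p) (rvar s' ''out'') (rvar s'' ''out''))"
    proof (rule vertex_runs[where off = "int (k * d)"])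
      show "rvar s' ''beta'' = \<beta>" "rvar s' ''c'' = c" using v sm by (simp_all add: same_def)
      show "iarr s' ''base'' (ivar s' ''u'') = int (k * d)" using base[OF k] sm i by (simp add: same_def)
      show "iarr s' ''cnt'' (ivar s' ''u'') = int n" using C k sm i by (simp add: same_def content_def n_def)
      show "iarr s' ''adj'' (int (k * d) + int x) = ?C k ! x" if "x < n" for x
        using C k sm that by (simp add: same_def content_def n_def)
      show "?C k ! i \<le> ?C k ! j" if "i \<le> j" "j < n" for i j
        using \<open>sorted (?C k)\<close> that by (simp add: sorted_nth_mono n_def)
    qed (use pos n L in auto)
    then show "runs vertex_prog s' ((d + 1) * (6000 * (L + 1)^2))
      (\<lambda>s''. maximised (X (Suc k)) (rvar s ''out'') (rvar (s''\<lparr>ivar := (ivar s'')(''u'' := int (Suc k))\<rparr>) ''out''))"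
    proof (rule runs_mono)
      show "(n + 1) * (6000 * (L + 1)^2) \<le> (d + 1) * (6000 * (L + 1)^2)" using n by (intro mult_right_mono) auto
      fix s'' assume "maximised (\<Union>p\<in>centres ((!) (?C k)) n. cands \<beta> c ((!) (?C k)) n p) (rvar s' ''out'') (rvar s'' ''out'')"
      from maximised_Un[OF J this]
      show "maximised (X (Suc k)) (rvar s ''out'') (rvar (s''\<lparr>ivar := (ivar s'')(''u'' := int (Suc k))\<rparr>) ''out'')"
        by (simp add: X_def n_def lessThan_Suc Un_commute)
    qed
  next
    fix s' assume "same (forloop ''u'' (IVar ''d'') vertex_prog) s s'"
    then show "ival (IVar ''d'') s' = int d" using d by (simp add: same_def)
  qed (auto simp: X_def algebra_simps)
  then show ?thesis by (simp add: X_def all_cands_def)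
qed

lemma main_runs:
  assumes iv: "ivar s ''d'' = int d" "ivar s ''m'' = int m" "ivar s ''lambda'' = lam"
    and rv: "rvar s ''eps1'' = eps1" "rvar s ''beta'' = \<beta>" "rvar s ''out'' = 0" and pos: "\<beta> > 0" "eps1 > 0"
    and tri: "\<And>t. t < m \<Longrightarrow> iarr s ''tri1'' (int t) = int (e1 t)" "\<And>t. t < m \<Longrightarrow> iarr s ''tri2'' (int t) = int (e2 t)"
    and triw: "\<And>t. t < m \<Longrightarrow> iarr s ''triw'' (int t) = q t" and w: "\<And>u. u < d \<Longrightarrow> iarr s ''w'' (int u) = w u"
    and cnt: "\<And>u. iarr s ''cnt'' u = 0" and L: "d < 2 ^ L"
    and c: "c = exp (- eps1) / (1 - exp (- eps1))\<^sup>2"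
  shows "runs main_prog s (20000 * ((d + 1)^2 * (L + 1)^2)) (\<lambda>s'. \<exists>ds.
    extracted (\<lambda>t. w (e1 t) + w (e2 t) + q t - lam) m ds \<and>
    maximised (all_cands \<beta> c (buckets (\<lambda>t. w (e1 t) + w (e2 t) + q t - lam) ds)) 0 (rvar s' ''out''))"
proof -
  define key where "key t = w (e1 t) + w (e2 t) + q t - lam" for t
  have c0: "c > 0" using pos by (simp add: c)
  define M where "M = (L + 1)^2"
  \<comment> \<open>There are at most \<open>d * d\<close> triangles, so the tournament has at most
    twice the logarithmic depth available for \<open>d\<close>.\<close>
  have mL: "m < 2 ^ (2 * L)"
  proof -
    have "m \<le> d * d" by (rule pairs_count)
    also have "\<dots> < 2 ^ L * 2 ^ L" using L by (intro mult_strict_mono) auto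
    finally show ?thesis by (simp add: mult_2 power_add)
  qed
  define R where "R s' \<longleftrightarrow> ivar s' ''d'' = int d \<and> ivar s' ''m'' = int m \<and> ivar s' ''lambda'' = lam \<and>
    rvar s' ''beta'' = \<beta> \<and> rvar s' ''out'' = 0 \<and> rvar s' ''c'' = c \<and>
    iarr s' ''tri1'' = iarr s ''tri1'' \<and> iarr s' ''tri2'' = iarr s ''tri2''" for s' :: state
  let ?Q = "\<lambda>s'. \<exists>ds. extracted key m ds \<and> maximised (all_cands \<beta> c (buckets key ds)) 0 (rvar s' ''out'')"
  \<comment> \<open>Budgets for the tails of the program, from the last phase backwards.\<close>
  define T5 T4 T3 T2 T1 where T: "T5 = 20 + d * (20 + (d + 1) * (6000 * M))" "T4 = 20 + m * (150 + 2 * L * 50) + T5"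
    "T3 = 20 + m * 50 + T4" "T2 = 20 + m * 60 + T3" "T1 = 20 + d * 30 + T2"
  have r5: "runs (forloop ''u'' (IVar ''d'') vertex_prog) s' T5 ?Q"
    if "R s'" "\<forall>u<d. iarr s' ''base'' (int u) = int (u * d)" "extracted key m ds" "content d (buckets key ds) s'" for s' ds
  proof -
    have "runs (forloop ''u'' (IVar ''d'') vertex_prog) s' T5
      (\<lambda>s''. maximised (all_cands \<beta> c (buckets key ds)) (rvar s' ''out'') (rvar s'' ''out''))"
      unfolding T M_def using that pos c0 L by (intro vertices_runs) (auto simp: R_def)
    then show ?thesis by (rule runs_mono) (use that in \<open>auto simp: R_def\<close>)
  qed
  have r4: "runs (extract_prog;; forloop ''u'' (IVar ''d'') vertex_prog) s' T4 ?Q"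
    if s': "R s'" "\<forall>u<d. iarr s' ''base'' (int u) = int (u * d)" "iarr s' ''cnt'' = iarr s ''cnt''"
      "\<forall>t<m. iarr s' ''key'' (int t) = key t \<and> key t < ivar s' ''inf''"
      "tree_inv m 1 W s'" "\<forall>j. 1 \<le> j \<longrightarrow> j < m \<longrightarrow> wins key W j" for s' W
  proof (rule runs_Seq[OF runs_same[OF extract_runs[of s' W key "2 * L"]], where ?T2.0 = T5])
    show "ivar s' ''m'' = int m" "tree_inv m 1 W s'" using s' by (auto simp: R_def)
    fix s'' assume "same extract_prog s' s''" "\<exists>ds. extracted key m ds \<and> content d (buckets key ds) s''"
    then show "R s'' \<and> (\<forall>u<d. iarr s'' ''base'' (int u) = int (u * d)) \<and> (\<exists>ds. extracted key m ds \<and> content d (buckets key ds) s'')"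
      using s' by (simp add: same_def R_def)
  qed (use s' tri cnt mL r5 in \<open>auto simp: R_def T\<close>)
  have r3: "runs (build_prog;; extract_prog;; forloop ''u'' (IVar ''d'') vertex_prog) s' T3 ?Q"
    if s': "R s'" "\<forall>u<d. iarr s' ''base'' (int u) = int (u * d)" "iarr s' ''cnt'' = iarr s ''cnt''"
      "\<forall>t<m. iarr s' ''key'' (int t) = key t \<and> iarr s' ''tree'' (int m + int t) = int t \<and> key t < ivar s' ''inf''" for s'
  proof (rule runs_Seq[OF runs_same[OF build_runs[of s' m key]], where ?T2.0 = T4])
    show "ivar s' ''m'' = int m" using s' by (auto simp: R_def)
    fix s'' assume "same build_prog s' s''" "\<exists>W. tree_inv m 1 W s'' \<and> (\<forall>j. 1 \<le> j \<longrightarrow> j < m \<longrightarrow> wins key W j)"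
    then show "(R s'' \<and> (\<forall>u<d. iarr s'' ''base'' (int u) = int (u * d)) \<and> iarr s'' ''cnt'' = iarr s ''cnt'' \<and>
      (\<forall>t<m. iarr s'' ''key'' (int t) = key t \<and> key t < ivar s'' ''inf'')) \<and>
      (\<exists>W. tree_inv m 1 W s'' \<and> (\<forall>j. 1 \<le> j \<longrightarrow> j < m \<longrightarrow> wins key W j))"
      using s' by (simp add: same_def R_def)
  qed (use s' r4 in \<open>auto simp: R_def T\<close>)
  have r2: "runs (key_prog;; build_prog;; extract_prog;; forloop ''u'' (IVar ''d'') vertex_prog) s' T2 ?Q"
    if s': "R s'" "\<forall>u<d. iarr s' ''base'' (int u) = int (u * d)" "iarr s' ''cnt'' = iarr s ''cnt''"
      "iarr s' ''w'' = iarr s ''w''" "iarr s' ''triw'' = iarr s ''triw''" for s'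
  proof (rule runs_Seq[OF runs_same[OF key_runs[of s' m lam key]], where ?T2.0 = T3])
    show "ivar s' ''m'' = int m" "ivar s' ''lambda'' = lam" using s' by (auto simp: R_def)
    show "iarr s' ''w'' (iarr s' ''tri1'' (int t)) + iarr s' ''w'' (iarr s' ''tri2'' (int t)) + iarr s' ''triw'' (int t) - lam = key t"
      if "t < m" for t
      using s' tri[OF that] triw[OF that] w ends[OF that] by (simp add: R_def key_def)
    fix s'' assume "same key_prog s' s''" "\<forall>t<m. iarr s'' ''key'' (int t) = key t \<and>
      iarr s'' ''tree'' (int m + int t) = int t \<and> key t < ivar s'' ''inf''"
    then show "R s'' \<and> (\<forall>u<d. iarr s'' ''base'' (int u) = int (u * d)) \<and> iarr s'' ''cnt'' = iarr s ''cnt'' \<and>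
      (\<forall>t<m. iarr s'' ''key'' (int t) = key t \<and> iarr s'' ''tree'' (int m + int t) = int t \<and> key t < ivar s'' ''inf'')"
      using s' by (simp add: same_def R_def)
  qed (use r3 in \<open>auto simp: T\<close>)
  have r1: "runs (base_prog;; key_prog;; build_prog;; extract_prog;; forloop ''u'' (IVar ''d'') vertex_prog) s' T1 ?Q"
    if s': "R s'" "iarr s' ''cnt'' = iarr s ''cnt''" "iarr s' ''w'' = iarr s ''w''" "iarr s' ''triw'' = iarr s ''triw''" for s'
  proof (rule runs_Seq[OF runs_same[OF base_runs[of s' d]], where ?T2.0 = T2])
    show "ivar s' ''d'' = int d" using s' by (auto simp: R_def)
    fix s'' assume "same base_prog s' s''" "\<forall>u<d. iarr s'' ''base'' (int u) = int (u * d)"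
    then show "R s'' \<and> (\<forall>u<d. iarr s'' ''base'' (int u) = int (u * d)) \<and> iarr s'' ''cnt'' = iarr s ''cnt'' \<and>
      iarr s'' ''w'' = iarr s ''w'' \<and> iarr s'' ''triw'' = iarr s ''triw''"
      using s' by (simp add: same_def R_def)
  qed (use r2 in \<open>auto simp: T\<close>)
  have "runs main_prog s (30 + T1) ?Q"
    unfolding main_prog_def
  proof (rule runs_Seq[where ?T1.0 = 30 and ?T2.0 = T1])
    show "runs constants_prog s 30 (\<lambda>s'. R s' \<and> iarr s' ''cnt'' = iarr s ''cnt'' \<and> iarr s' ''w'' = iarr s ''w'' \<and> iarr s' ''triw'' = iarr s ''triw'')"
      using iv rv by (simp add: constants_prog_def R_def c power2_eq_square)
  qed (use r1 in auto)
  moreover have "30 + T1 \<le> 20000 * ((d + 1)^2 * M)"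
  proof -
    define D where "D = (d + 1)^2"
    have M1: "1 \<le> M" "L \<le> M" by (auto simp: M_def power2_eq_square)
    have D1: "1 \<le> D" "d \<le> D" "m \<le> D" "d * (d + 1) \<le> D"
      using pairs_count by (auto simp: D_def power2_eq_square)
    have "m * L \<le> D * M" using D1 M1 by (intro mult_mono) auto
    moreover have "d * (d + 1) * M \<le> D * M" using D1 by (intro mult_right_mono) auto
    moreover have "D * 1 \<le> D * M" using M1 by (intro mult_left_mono) auto
    moreover have "30 + T1 = 130 + d * 50 + 6000 * (d * (d + 1) * M) + m * 260 + 100 * (m * L)"
      by (simp add: T algebra_simps)
    ultimately show ?thesis unfolding D_def[symmetric] using D1 by linarith
  qed
  ultimately show ?thesis unfolding M_def key_def by (rule runs_mono)
qed

end

section \<open>Pairs of neighbouring vectors\<close>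

context edge_pairs
begin

lemma count_cong: "(\<And>i. i < d \<Longrightarrow> Y i = Z i) \<Longrightarrow> count h q Y = count h q Z"
  unfolding count_def using ends by (intro sum.cong) auto

text \<open>Different integer vectors at distance at most 1 differ by one in a single coordinate
  \<open>u\<close>, so one of them is the other lowered at \<open>u\<close>. Whichever of them is
  the centre, its distance from \<open>w\<close> is at least the distance formed with
  \<open>dd\<close>.\<close>

lemma neighbour_le_bound:
  assumes h: "\<And>k. h (k - 1) - h k = contr c (k - lam)" and pos: "\<beta> > 0" "c > 0"
    and ds: "distinct ds" "set ds = {..<m}" and key: "\<And>t. t < m \<Longrightarrow> key t = w (e1 t) + w (e2 t) + q t - lam"
    and R: "0 \<le> R" "\<And>v. v \<in> all_cands \<beta> c (buckets key ds) \<Longrightarrow> v \<le> R"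
    and near: "(\<Sum>i<d. \<bar>Y i - Y' i\<bar>) \<le> 1"
  shows "\<bar>count h q Y - count h q Y'\<bar> * exp (- \<beta> * real_of_int (\<Sum>i<d. \<bar>w i - Y i\<bar>)) \<le> R"
proof (cases "\<forall>i<d. Y i = Y' i")
  case True
  then show ?thesis using R(1) count_cong[of Y Y' h q] by simp
next
  case False
  then obtain u where u: "u < d" "Y u \<noteq> Y' u" by blast
  have "(\<Sum>i<d. \<bar>Y i - Y' i\<bar>) = \<bar>Y u - Y' u\<bar> + (\<Sum>i\<in>{..<d} - {u}. \<bar>Y i - Y' i\<bar>)"
    using u by (intro sum.remove) auto
  moreover have "(\<Sum>i\<in>{..<d} - {u}. \<bar>Y i - Y' i\<bar>) \<ge> 0" by (intro sum_nonneg) auto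
  ultimately have 1: "\<bar>Y u - Y' u\<bar> = 1" and 0: "(\<Sum>i\<in>{..<d} - {u}. \<bar>Y i - Y' i\<bar>) = 0" using near u(2) by linarith+
  have other: "Y i = Y' i" if "i < d" "i \<noteq> u" for i
    using 0 that by (subst (asm) sum_nonneg_eq_0_iff) auto
  have A: "(\<Sum>i<d. \<bar>w i - Y i\<bar>) = \<bar>w u - Y u\<bar> + (\<Sum>i\<in>{..<d} - {u}. \<bar>w i - Y i\<bar>)"
    using u by (intro sum.remove) auto
  consider "Y' u = Y u - 1" | "Y u = Y' u - 1" using 1 by linarith
  then show ?thesis
  proof cases
    case 1
    have "dd (w u - Y u) + (\<Sum>x\<in>{..<d} - {u}. \<bar>w x - Y x\<bar>) \<le> (\<Sum>i<d. \<bar>w i - Y i\<bar>)"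
      unfolding A by (simp add: dd_def)
    note bound = step_le_bound[OF h pos ds key R(2) u(1) this]
    have "count h q (Y(u := Y u - 1)) = count h q Y'"
      by (rule count_cong) (use 1 other in auto)
    then show ?thesis using bound by (simp add: abs_minus_commute)
  next
    case 2
    have "(\<Sum>x\<in>{..<d} - {u}. \<bar>w x - Y' x\<bar>) = (\<Sum>x\<in>{..<d} - {u}. \<bar>w x - Y x\<bar>)"
      by (rule sum.cong) (use other in auto)
    then have "dd (w u - Y' u) + (\<Sum>x\<in>{..<d} - {u}. \<bar>w x - Y' x\<bar>) \<le> (\<Sum>i<d. \<bar>w i - Y i\<bar>)"
      unfolding A using 2 by (simp add: dd_def)
    note bound = step_le_bound[OF h pos ds key R(2) u(1) this]
    have "count h q (Y'(u := Y' u - 1)) = count h q Y"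
      by (rule count_cong) (use 2 other in auto)
    then show ?thesis using bound by simp
  qed
qed

text \<open>The vector of the pair that is nearer to \<open>w\<close> becomes the centre:
  \<open>z\<close> if \<open>z u \<le> w u\<close>, and the lowered vector otherwise. For this
  choice \<open>dd\<close> gives the exact distance.\<close>

lemma neighbour_attains_bound:
  assumes h: "\<And>k. h (k - 1) - h k = contr c (k - lam)" and pos: "\<beta> > 0" "c > 0"
    and ds: "distinct ds" "set ds = {..<m}" and key: "\<And>t. t < m \<Longrightarrow> key t = w (e1 t) + w (e2 t) + q t - lam"
    and R: "R = 0 \<or> R \<in> all_cands \<beta> c (buckets key ds)"
  shows "\<exists>Y Y'. (\<Sum>i<d. \<bar>Y i - Y' i\<bar>) \<le> 1 \<and>
    R \<le> \<bar>count h q Y - count h q Y'\<bar> * exp (- \<beta> * real_of_int (\<Sum>i<d. \<bar>w i - Y i\<bar>))"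
  using R
proof
  \<comment> \<open>A vector paired with itself yields the value 0.\<close>
  assume "R = 0"
  then show ?thesis by (intro exI[of _ w]) simp
next
  assume "R \<in> all_cands \<beta> c (buckets key ds)"
  then obtain u z where u: "u < d" and R: "R \<le> \<bar>count h q (z(u := z u - 1)) - count h q z\<bar> *
       exp (- \<beta> * real_of_int (dd (w u - z u) + (\<Sum>x\<in>{..<d} - {u}. \<bar>w x - z x\<bar>)))"
    using bound_attained[OF h pos ds key] by blast
  define z' where "z' = z(u := z u - 1)"
  have near: "(\<Sum>i<d. \<bar>z i - z' i\<bar>) = 1"
  proof -
    have "(\<Sum>i<d. \<bar>z i - z' i\<bar>) = \<bar>z u - z' u\<bar> + (\<Sum>i\<in>{..<d} - {u}. \<bar>z i - z' i\<bar>)"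
      using u by (intro sum.remove) auto
    also have "(\<Sum>i\<in>{..<d} - {u}. \<bar>z i - z' i\<bar>) = 0" by (intro sum.neutral) (auto simp: z'_def)
    finally show ?thesis by (simp add: z'_def)
  qed
  then have near': "(\<Sum>i<d. \<bar>z' i - z i\<bar>) = 1" by (simp add: abs_minus_commute)
  have A: "(\<Sum>i<d. \<bar>w i - y i\<bar>) = \<bar>w u - y u\<bar> + (\<Sum>i\<in>{..<d} - {u}. \<bar>w i - y i\<bar>)" for y
    using u by (intro sum.remove) auto
  have rest: "(\<Sum>i\<in>{..<d} - {u}. \<bar>w i - z' i\<bar>) = (\<Sum>i\<in>{..<d} - {u}. \<bar>w i - z i\<bar>)"
    by (rule sum.cong) (auto simp: z'_def)
  show ?thesis
  proof (cases "0 \<le> w u - z u")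
    case True
    then have "dd (w u - z u) + (\<Sum>x\<in>{..<d} - {u}. \<bar>w x - z x\<bar>) = (\<Sum>i<d. \<bar>w i - z i\<bar>)"
      unfolding A by (simp add: dd_def)
    then show ?thesis using R near unfolding z'_def[symmetric]
      by (intro exI[of _ z] exI[of _ z']) (simp add: abs_minus_commute)
  next
    case False
    then have "dd (w u - z u) + (\<Sum>x\<in>{..<d} - {u}. \<bar>w x - z x\<bar>) = (\<Sum>i<d. \<bar>w i - z' i\<bar>)"
      unfolding A[of z'] rest by (simp add: dd_def z'_def)
    then show ?thesis using R near' unfolding z'_def[symmetric]
      by (intro exI[of _ z'] exI[of _ z]) simp
  qed
qed

end

lemma hfun_step:
  "hfun lam eps1 (k - 1) - hfun lam eps1 k = contr (exp (- eps1) / (1 - exp (- eps1))\<^sup>2) (k - lam)"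
  by (auto simp: hfun_def contr_def Let_def)

section \<open>Existence of the maxima in the smooth sensitivity\<close>

lemma finite_range_hfun: "finite (range (hfun lam eps1))"
proof (rule finite_subset)
  show "range (hfun lam eps1) \<subseteq> hfun lam eps1 ` {lam - 2..lam + 1}"
  proof
    fix y assume "y \<in> range (hfun lam eps1)"
    then obtain k where k: "y = hfun lam eps1 k" by blast
    have "hfun lam eps1 k = hfun lam eps1 (max (lam - 2) (min k (lam + 1)))" by (auto simp: hfun_def Let_def)
    then show "y \<in> hfun lam eps1 ` {lam - 2..lam + 1}" using k by auto
  qed
qed simp

text \<open>\<open>GREATEST\<close> in \<open>local_sens\<close> denotes a maximum only if one
  exists. Finitely many values of the count provide it, although the lattice is infinite.\<close>

lemma finite_range_local_count:
  assumes "finite \<Delta>"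
  shows "finite (local_count lam eps1 v \<Delta> w' ` X)"
proof (rule finite_subset)
  show "local_count lam eps1 v \<Delta> w' ` X \<subseteq> (\<lambda>g. \<Sum>t\<in>\<Delta>. g t) ` (\<Delta> \<rightarrow>\<^sub>E range (hfun lam eps1))"
  proof
    fix r assume "r \<in> local_count lam eps1 v \<Delta> w' ` X"
    then obtain y where "r = local_count lam eps1 v \<Delta> w' y" by blast
    moreover define g where "g = restrict (\<lambda>t. hfun lam eps1 ((\<Sum>u\<in>t - {v}. y {v, u}) + w' (t - {v}))) \<Delta>"
    ultimately have "r = (\<Sum>t\<in>\<Delta>. g t)" by (simp add: local_count_def)
    moreover have "g \<in> \<Delta> \<rightarrow>\<^sub>E range (hfun lam eps1)" by (auto simp: g_def)
    ultimately show "r \<in> (\<lambda>g. \<Sum>t\<in>\<Delta>. g t) ` (\<Delta> \<rightarrow>\<^sub>E range (hfun lam eps1))" by blast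
  qed
  show "finite ((\<lambda>g. \<Sum>t\<in>\<Delta>. g t) ` (\<Delta> \<rightarrow>\<^sub>E range (hfun lam eps1)))"
    by (intro finite_imageI finite_PiE assms finite_range_hfun)
qed

text \<open>Finiteness yields the inner maximum. The outer one ranges over all centres, with
  infinitely many different damping factors; it exists because \<open>y0\<close> and
  \<open>y1\<close> attain the common upper bound.\<close>

lemma smooth_sens_eqI:
  assumes fin: "finite (f ` (I \<rightarrow>\<^sub>E UNIV))"
    and upper: "\<And>y y'. y \<in> I \<rightarrow>\<^sub>E UNIV \<Longrightarrow> y' \<in> I \<rightarrow>\<^sub>E UNIV \<Longrightarrow> l1_dist I y y' \<le> 1 \<Longrightarrow>
      \<bar>f y - f y'\<bar> * exp (- \<beta> * real_of_int (l1_dist I w y)) \<le> R"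
    and attained: "y0 \<in> I \<rightarrow>\<^sub>E UNIV" "y1 \<in> I \<rightarrow>\<^sub>E UNIV" "l1_dist I y0 y1 \<le> 1"
      "R \<le> \<bar>f y0 - f y1\<bar> * exp (- \<beta> * real_of_int (l1_dist I w y0))"
  shows "smooth_sens I f \<beta> w = R"
proof -
  define D where "D y = {\<bar>f y - f y'\<bar> | y'. y' \<in> I \<rightarrow>\<^sub>E UNIV \<and> l1_dist I y y' \<le> 1}" for y
  have LS: "local_sens I f y \<in> D y \<and> (\<forall>a\<in>D y. a \<le> local_sens I f y)" if "y \<in> I \<rightarrow>\<^sub>E UNIV" for y
  proof -
    have "D y \<subseteq> (\<lambda>a. \<bar>f y - a\<bar>) ` (f ` (I \<rightarrow>\<^sub>E UNIV))" by (auto simp: D_def)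
    then have "finite (D y)" using fin by (meson finite_imageI finite_subset)
    moreover have "l1_dist I y y \<le> 1" by (simp add: l1_dist_def)
    then have "D y \<noteq> {}" using that by (auto simp: D_def)
    ultimately have "Max (D y) \<in> D y" "\<And>a. a \<in> D y \<Longrightarrow> a \<le> Max (D y)" by auto
    then have "(GREATEST a. a \<in> D y) = Max (D y)" by (rule Greatest_equality)
    then show ?thesis using \<open>Max (D y) \<in> D y\<close> \<open>finite (D y)\<close> by (simp add: local_sens_def D_def)
  qed
  define S where "S = {local_sens I f y * exp (- \<beta> * real_of_int (l1_dist I w y)) | y. y \<in> I \<rightarrow>\<^sub>E UNIV}"
  have S_le: "a \<le> R" if "a \<in> S" for a
  proof -
    obtain y where y: "y \<in> I \<rightarrow>\<^sub>E UNIV" "a = local_sens I f y * exp (- \<beta> * real_of_int (l1_dist I w y))"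
      using \<open>a \<in> S\<close> by (auto simp: S_def)
    then show ?thesis using LS[OF y(1)] upper[OF y(1)] by (auto simp: D_def)
  qed
  let ?E = "exp (- \<beta> * real_of_int (l1_dist I w y0))"
  have "\<bar>f y0 - f y1\<bar> \<in> D y0" using attained by (auto simp: D_def)
  then have "\<bar>f y0 - f y1\<bar> \<le> local_sens I f y0" using LS[OF attained(1)] by blast
  then have "\<bar>f y0 - f y1\<bar> * ?E \<le> local_sens I f y0 * ?E" by (intro mult_right_mono) auto
  then have "R \<le> local_sens I f y0 * ?E" using attained(4) by linarith
  moreover have "local_sens I f y0 * ?E \<in> S" using attained(1) by (auto simp: S_def)
  ultimately have "R \<in> S" using S_le by force
  then show ?thesis unfolding smooth_sens_def S_def[symmetric] using S_le by (intro Greatest_equality)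
qed

section \<open>From graphs to pairs of incident edges\<close>

lemma incident_edges:
  assumes "simple_graph V E" "enumerates E v \<Delta> es ts" "i < length es"
  shows "\<exists>x. es ! i = {v, x} \<and> x \<noteq> v"
proof -
  have "es ! i \<in> set es" using assms(3) by simp
  then have "es ! i \<in> E" "v \<in> es ! i" using assms(2) by (simp_all add: enumerates_def incident_def)
  moreover from this have "card (es ! i) = 2" using assms(1) by (simp add: simple_graph_def)
  ultimately show ?thesis by (auto simp: card_2_iff)
qed

lemma enumerates_edge_pairs:
  assumes G: "simple_graph V E" and \<Delta>: "\<Delta> \<subseteq> triangles_at E v" and en: "enumerates E v \<Delta> es ts"
  shows "edge_pairs (length ts) (length es) (\<lambda>t. fst (ts ! t)) (\<lambda>t. snd (ts ! t))"
    and "local_count lam eps1 v \<Delta> w' y = edge_pairs.count (length ts) (\<lambda>t. fst (ts ! t)) (\<lambda>t. snd (ts ! t))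
      (hfun lam eps1) (\<lambda>t. w' (triangle_of es (ts ! t) - {v})) (\<lambda>i. y (es ! i))"
proof -
  obtain nb where nb: "\<And>i. i < length es \<Longrightarrow> es ! i = {v, nb i} \<and> nb i \<noteq> v"
    using incident_edges[OF G en] by metis
  let ?e1 = "\<lambda>t. fst (ts ! t)" and ?e2 = "\<lambda>t. snd (ts ! t)" and ?tri = "\<lambda>t. triangle_of es (ts ! t)"
  have lt: "?e1 t < length es" "?e2 t < length es" if "t < length ts" for t
  proof -
    have "ts ! t \<in> {..<length es} \<times> {..<length es}" using en nth_mem[OF that] by (auto simp: enumerates_def)
    then show "?e1 t < length es" "?e2 t < length es" by auto
  qed
  have tri: "?tri t = {v, nb (?e1 t), nb (?e2 t)}" if "t < length ts" for t
    using nb[OF lt(1)[OF that]] nb[OF lt(2)[OF that]] by (auto simp: triangle_of_def case_prod_beta)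
  have ne: "nb (?e1 t) \<noteq> nb (?e2 t)" if "t < length ts" for t
  proof
    \<comment> \<open>With equal neighbours the triangle would have at most two vertices.\<close>
    assume eq: "nb (?e1 t) = nb (?e2 t)"
    have "?tri t \<in> \<Delta>" using en that by (auto simp: enumerates_def)
    then obtain u x where "?tri t = {v, u, x}" "v \<noteq> u" "v \<noteq> x" "u \<noteq> x" using \<Delta> by (auto simp: triangles_at_def)
    then have "card (?tri t) = 3" by simp
    moreover have "card (?tri t) \<le> 2" unfolding tri[OF that] eq by (simp add: card_insert_if)
    ultimately show False by simp
  qed
  have dist: "distinct (map (triangle_of es) ts)" "set (map (triangle_of es) ts) = \<Delta>"
    using en by (auto simp: enumerates_def)
  show ep: "edge_pairs (length ts) (length es) ?e1 ?e2"
  proof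
    fix t t' assume t: "t < length ts" "t' < length ts" and eq: "{?e1 t, ?e2 t} = {?e1 t', ?e2 t'}"
    \<comment> \<open>The two incident edges determine the triangle, and triangles are listed
      without repetition.\<close>
    have "?tri t = ?tri t'" using eq unfolding tri[OF t(1)] tri[OF t(2)] by (auto simp: doubleton_eq_iff)
    then have "map (triangle_of es) ts ! t = map (triangle_of es) ts ! t'" using t by simp
    then show "t = t'" using dist(1) t nth_eq_iff_index_eq by fastforce
  next
    fix t assume "t < length ts"
    then show "?e1 t \<noteq> ?e2 t" using ne by metis
  qed (use lt in auto)
  have "local_count lam eps1 v \<Delta> w' y = (\<Sum>t<length ts. hfun lam eps1
    ((\<Sum>u\<in>?tri t - {v}. y {v, u}) + w' (?tri t - {v})))"
    unfolding local_count_def dist(2)[symmetric] sum_nth_distinct[OF dist(1), symmetric] by simp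
  also have "\<dots> = (\<Sum>t<length ts. hfun lam eps1 (y (es ! ?e1 t) + y (es ! ?e2 t) + w' (?tri t - {v})))"
  proof (rule sum.cong[OF refl])
    fix t assume "t \<in> {..<length ts}"
    then have t: "t < length ts" by simp
    have n: "es ! ?e1 t = {v, nb (?e1 t)}" "es ! ?e2 t = {v, nb (?e2 t)}" "nb (?e1 t) \<noteq> v" "nb (?e2 t) \<noteq> v"
      using nb lt[OF t] by auto
    have "?tri t - {v} = {nb (?e1 t), nb (?e2 t)}" using n(3,4) unfolding tri[OF t] by auto
    then have "(\<Sum>u\<in>?tri t - {v}. y {v, u}) = y (es ! ?e1 t) + y (es ! ?e2 t)"
      using ne[OF t] unfolding n(1,2) by simp
    then show "hfun lam eps1 ((\<Sum>u\<in>?tri t - {v}. y {v, u}) + w' (?tri t - {v})) =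
      hfun lam eps1 (y (es ! ?e1 t) + y (es ! ?e2 t) + w' (?tri t - {v}))" by simp
  qed
  also have "\<dots> = edge_pairs.count (length ts) ?e1 ?e2 (hfun lam eps1) (\<lambda>t. w' (?tri t - {v})) (\<lambda>i. y (es ! i))"
    by (simp add: edge_pairs.count_def[OF ep])
  finally show "local_count lam eps1 v \<Delta> w' y = edge_pairs.count (length ts) ?e1 ?e2
      (hfun lam eps1) (\<lambda>t. w' (triangle_of es (ts ! t) - {v})) (\<lambda>i. y (es ! i))" .
qed

lemma l1_dist_nth:
  assumes "distinct es" "set es = I"
  shows "l1_dist I y y' = (\<Sum>i<length es. \<bar>y (es ! i) - y' (es ! i)\<bar>)"
  unfolding l1_dist_def assms(2)[symmetric] by (rule sum_nth_distinct[OF assms(1), symmetric])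

lemma extensional_of_indexed:
  assumes "distinct es" "set es = I"
  obtains y :: "'a \<Rightarrow> int" where "y \<in> I \<rightarrow>\<^sub>E UNIV" "\<And>i. i < length es \<Longrightarrow> y (es ! i) = z i"
proof
  define y where "y = restrict (\<lambda>e. z (the_inv_into {..<length es} ((!) es) e)) I"
  show "y \<in> I \<rightarrow>\<^sub>E UNIV" by (auto simp: y_def)
  have inj: "inj_on ((!) es) {..<length es}" using assms(1) by (auto simp: inj_on_def nth_eq_iff_index_eq)
  fix i assume "i < length es"
  then show "y (es ! i) = z i" using assms(2) the_inv_into_f_f[OF inj, of i] by (auto simp: y_def)
qed

section \<open>The time bound\<close>

text \<open>The argument is \<open>d + 1\<close> because the searches need \<open>d < 2 ^ L\<close>
  strictly; it also makes \<open>d = 0\<close> meaningful.\<close>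

definition log_bound :: "nat \<Rightarrow> nat" where
  "log_bound d = nat \<lceil>log 2 (real d + 1)\<rceil>"

lemma less_log_bound: "d < 2 ^ log_bound d"
proof -
  have "real d + 1 = 2 powr log 2 (real d + 1)" by simp
  also have "\<dots> \<le> 2 powr real (log_bound d)"
    unfolding log_bound_def by (intro powr_mono real_nat_ceiling_ge) auto
  also have "\<dots> = real (2 ^ log_bound d)" by (simp add: powr_realpow)
  finally show ?thesis by linarith
qed

definition time_bound :: "nat \<Rightarrow> nat" where
  "time_bound d = 20000 * ((d + 1)^2 * (log_bound d + 1)^2)"

lemma time_bound_bigo: "(\<lambda>d. real (time_bound d)) \<in> O(\<lambda>d. (real d)\<^sup>2 * (ln (real d))\<^sup>2)"
proof -
  \<comment> \<open>Removes the ceiling, so that only a smooth expression is left for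
    \<open>real_asymp\<close>.\<close>
  have le: "real (time_bound d) \<le> 20000 * ((real d + 1)^2 * (log 2 (real d + 1) + 2)^2)" for d
  proof -
    have "0 \<le> log 2 (real d + 1)" by simp
    then have "real (log_bound d) + 1 \<le> log 2 (real d + 1) + 2" unfolding log_bound_def by linarith
    then have "(real (log_bound d) + 1)^2 \<le> (log 2 (real d + 1) + 2)^2" by (intro power_mono) auto
    then have "20000 * ((real d + 1)^2 * (real (log_bound d) + 1)^2) \<le> 20000 * ((real d + 1)^2 * (log 2 (real d + 1) + 2)^2)"
      by (intro mult_left_mono) auto
    then show ?thesis by (simp add: time_bound_def add.commute)
  qed
  have "(\<lambda>d. real (time_bound d)) \<in> O(\<lambda>d. 20000 * ((real d + 1)^2 * (log 2 (real d + 1) + 2)^2))"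
    using le by (intro landau_o.big_mono always_eventually) auto
  also have "(\<lambda>d::nat. 20000 * ((real d + 1)^2 * (log 2 (real d + 1) + 2)^2)) \<in> O(\<lambda>d. (real d)\<^sup>2 * (ln (real d))\<^sup>2)"
    by real_asymp
  finally show ?thesis .
qed

lemma main_prog_correct:
  assumes G: "simple_graph V E" and \<Delta>: "\<Delta> \<subseteq> triangles_at E v" and w: "w \<in> incident E v \<rightarrow>\<^sub>E UNIV"
    and pos: "eps1 > 0" "\<beta> > 0" and en: "enumerates E v \<Delta> es ts"
  shows "runs main_prog (input_state v es ts w w' lam eps1 \<beta>) (time_bound (card (incident E v)))
    (\<lambda>s. rvar s ''out'' = smooth_sens (incident E v) (local_count lam eps1 v \<Delta> w') \<beta> w)"
proof -
  define d m where "d = length es" and "m = length ts"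
  define e1 e2 where "e1 t = fst (ts ! t)" and "e2 t = snd (ts ! t)" for t
  define q where "q t = w' (triangle_of es (ts ! t) - {v})" for t
  define W where "W i = w (es ! i)" for i
  define c where "c = exp (- eps1) / (1 - exp (- eps1))\<^sup>2"
  define s where "s = input_state v es ts w w' lam eps1 \<beta>"
  note e_abs = e1_def[abs_def, symmetric] e2_def[abs_def, symmetric]
  interpret edge_pairs m d e1 e2
    using enumerates_edge_pairs(1)[OF G \<Delta> en] unfolding d_def m_def e_abs .
  have f: "local_count lam eps1 v \<Delta> w' y = count (hfun lam eps1) q (\<lambda>i. y (es ! i))" for y
    using enumerates_edge_pairs(2)[OF G \<Delta> en] unfolding m_def e_abs q_def[abs_def] .
  have es: "distinct es" "set es = incident E v" using en by (auto simp: enumerates_def)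
  have card: "card (incident E v) = d" using es distinct_card[of es] by (simp add: d_def)
  have c0: "c > 0" using pos by (simp add: c_def)
  define key where "key t = W (e1 t) + W (e2 t) + q t - lam" for t
  have run: "runs main_prog s (20000 * ((d + 1)^2 * (log_bound d + 1)^2)) (\<lambda>s'. \<exists>ds. extracted key m ds \<and>
    maximised (all_cands \<beta> c (buckets key ds)) 0 (rvar s' ''out''))"
    unfolding key_def
  proof (rule main_runs)
    show "d < 2 ^ log_bound d" by (rule less_log_bound)
  qed (use pos in \<open>auto simp: s_def input_state_def array_of_def d_def m_def e1_def e2_def q_def W_def c_def case_prod_beta\<close>)
  show ?thesis unfolding card time_bound_def s_def[symmetric]
  proof (rule runs_mono[OF run order_refl])
    fix s' assume "\<exists>ds. extracted key m ds \<and> maximised (all_cands \<beta> c (buckets key ds)) 0 (rvar s' ''out'')"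
    then obtain ds where ds: "extracted key m ds" and max: "maximised (all_cands \<beta> c (buckets key ds)) 0 (rvar s' ''out'')" by blast
    define R where "R = rvar s' ''out''"
    have "distinct ds" "set ds \<subseteq> {..<m}" "length ds = m" using ds by (auto simp: extracted_def)
    moreover from this have "set ds = {..<m}" by (intro card_subset_eq) (auto simp: distinct_card)
    ultimately have ds': "distinct ds" "set ds = {..<m}" by blast+
    \<comment> \<open>\<open>out\<close> starts at the default 0, which may remain the maximum; as
      the value of a vector paired with itself it is legitimate.\<close>
    have R: "0 \<le> R" "\<And>v. v \<in> all_cands \<beta> c (buckets key ds) \<Longrightarrow> v \<le> R" "R = 0 \<or> R \<in> all_cands \<beta> c (buckets key ds)"
      using max by (auto simp: maximised_def R_def)
    have h: "hfun lam eps1 (k - 1) - hfun lam eps1 k = contr c (k - lam)" for k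
      unfolding c_def by (rule hfun_step)
    have dist: "l1_dist (incident E v) y y' = (\<Sum>i<d. \<bar>y (es ! i) - y' (es ! i)\<bar>)" for y y'
      unfolding d_def by (rule l1_dist_nth[OF es])
    obtain Y Y' where Y: "(\<Sum>i<d. \<bar>Y i - Y' i\<bar>) \<le> 1"
      "R \<le> \<bar>count (hfun lam eps1) q Y - count (hfun lam eps1) q Y'\<bar> * exp (- \<beta> * real_of_int (\<Sum>i<d. \<bar>W i - Y i\<bar>))"
      using neighbour_attains_bound[OF h pos(2) c0 ds' key_def R(3)] by blast
    obtain y where y: "y \<in> incident E v \<rightarrow>\<^sub>E UNIV" "\<And>i. i < d \<Longrightarrow> y (es ! i) = Y i"
      using extensional_of_indexed[OF es, of Y] unfolding d_def by blast
    obtain y' where y': "y' \<in> incident E v \<rightarrow>\<^sub>E UNIV" "\<And>i. i < d \<Longrightarrow> y' (es ! i) = Y' i"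
      using extensional_of_indexed[OF es, of Y'] unfolding d_def by blast
    have "smooth_sens (incident E v) (local_count lam eps1 v \<Delta> w') \<beta> w = R"
    proof (rule smooth_sens_eqI)
      have "finite \<Delta>" using en by (auto simp: enumerates_def)
      then show "finite (local_count lam eps1 v \<Delta> w' ` (incident E v \<rightarrow>\<^sub>E UNIV))" by (rule finite_range_local_count)
    next
      fix a b :: "'a set \<Rightarrow> int" assume "l1_dist (incident E v) a b \<le> 1"
      then have "(\<Sum>i<d. \<bar>a (es ! i) - b (es ! i)\<bar>) \<le> 1" by (simp only: dist)
      note bound = neighbour_le_bound[OF h pos(2) c0 ds' key_def R(1,2) this]
      show "\<bar>local_count lam eps1 v \<Delta> w' a - local_count lam eps1 v \<Delta> w' b\<bar> *
          exp (- \<beta> * real_of_int (l1_dist (incident E v) w a)) \<le> R"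
        unfolding f dist using bound by (simp only: W_def)
    next
      show "l1_dist (incident E v) y y' \<le> 1" using Y(1) y(2) y'(2) by (simp add: dist)
      have "count (hfun lam eps1) q (\<lambda>i. y (es ! i)) = count (hfun lam eps1) q Y"
        "count (hfun lam eps1) q (\<lambda>i. y' (es ! i)) = count (hfun lam eps1) q Y'"
        by (rule count_cong, simp add: y y')+
      moreover have "(\<Sum>i<d. \<bar>w (es ! i) - y (es ! i)\<bar>) = (\<Sum>i<d. \<bar>W i - Y i\<bar>)"
        by (rule sum.cong) (auto simp: y W_def)
      ultimately show "R \<le> \<bar>local_count lam eps1 v \<Delta> w' y - local_count lam eps1 v \<Delta> w' y'\<bar> *
          exp (- \<beta> * real_of_int (l1_dist (incident E v) w y))"
        using Y(2) by (simp only: f dist)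
    qed (use y y' in auto)
    then show "rvar s' ''out'' = smooth_sens (incident E v) (local_count lam eps1 v \<Delta> w') \<beta> w"
      by (simp add: R_def)
  qed
qed

theorem mainTheorem10:
  "\<exists>(prog :: com) (T :: nat \<Rightarrow> nat).
     (\<lambda>d. real (T d)) \<in> O(\<lambda>d. (real d)\<^sup>2 * (ln (real d))\<^sup>2) \<and>
     (\<forall>(V :: 'a set) E v \<Delta> w w' lam eps1 \<beta> es ts.
        simple_graph V E \<longrightarrow> v \<in> V \<longrightarrow> \<Delta> \<subseteq> triangles_at E v \<longrightarrow>
        w \<in> incident E v \<rightarrow>\<^sub>E UNIV \<longrightarrow> eps1 > 0 \<longrightarrow> \<beta> > 0 \<longrightarrow>
        enumerates E v \<Delta> es ts \<longrightarrow>
        (\<exists>t s. exec prog (input_state v es ts w w' lam eps1 \<beta>) t s \<and>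
               t \<le> T (card (incident E v)) \<and>
               rvar s ''out'' =
                 smooth_sens (incident E v) (local_count lam eps1 v \<Delta> w') \<beta> w))"
proof (rule exI[of _ main_prog], rule exI[of _ time_bound], intro conjI allI impI)
  show "(\<lambda>d. real (time_bound d)) \<in> O(\<lambda>d. (real d)\<^sup>2 * (ln (real d))\<^sup>2)" by (rule time_bound_bigo)
qed (rule main_prog_correct[unfolded runs_def])

end
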